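(* Let $\alpha\in(0,1)$ and let $\mathcal{N}\subseteq\{1,\dots,m\}$ be the (unknown, arbitrary) set of indices $l$ for which $H_l$ is true. Let $\mathrm{FWER}_n$ denote the probability that a multiple testing procedure applied with sample size $n$ rejects at least one $H_l$ with $l\in\mathcal{N}$. Then, both for the single-step max-$T$ method and for the sequential max-$T$ method based on the $w\times m$ matrix $\bm{M}^n$ of sign-flipped effective scores, with $w$ and $m$ fixed, $$\limsup_{n\to\infty}\mathrm{FWER}_n\le\alpha.$$
   Context: Model. Fix $m\ge 2$ and a number of flips $w\in\mathbb{N}$. For each $n$ there are $m$ response vectors $Y^l=(Y^l_1,\dots,Y^l_n)^T$, $1\le l\le m$. The $m$-vectors $(Y^1_i,\dots,Y^m_i)$, $i=1,\dots,n$, are independent over $i$; the dependence among the $m$ responses of the same unit $i$ is arbitrary and unknown. Each $Y^l_i$ follows an exponential dispersion family with density $\exp\{(y\theta-b(\theta))/a(\phi)+c(y,\phi)\}$, where $\theta=\theta^l_i$ and $\phi=\phi^l_i$ are the canonical and dispersion parameters and the known functions $a,b,c$ may depend on $l$. With $\mu^l=\mathbb{E}(Y^l)$, the $l$-th model is $\mu^l=(h^l)^{-1}(\eta^l)$ (componentwise), $\eta^l=X\beta^l+Z\gamma^l$, where $h^l$ is the link function (assumed correctly specified), $X$ is an $n\times 1$ matrix of target covariates, $\beta^l\in\mathbb{R}$, $Z$ is an $n\times(k-1)$ matrix of nuisance covariates, and $\gamma^l\in\mathbb{R}^{k-1}$ is a nuisance parameter with true value $\gamma^l_0$, consistently estimated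 by $\hat\gamma^l$. The null hypothesis is $H_l:\beta^l=\beta^l_0$, with $\beta^l_0$ given. Effective scores. For each $l$ let $D^l=\mathrm{diag}\{\partial\mu^l_i/\partial\eta^l_i\}$, $V^l=\mathrm{diag}\{\mathrm{Var}(Y^l_i)\}$, $W^l=D^l(V^l)^{-1}D^l$, and $P^l=(W^l)^{1/2}Z(Z^TW^lZ)^{-1}Z^T(W^l)^{1/2}$, evaluated at $\beta^l=\beta^l_0$ and at a value of the nuisance parameter. For that value $\gamma^l$, the effective score is $S^{*,l}_{\gamma}=n^{-1/2}X^T(W^l)^{1/2}(I-P^l)(V^l)^{-1/2}(Y^l-\mu^l)=n^{-1/2}\sum_{i=1}^n\nu^{*l}_{\gamma,i}$, where $\nu^{*l}_{\gamma,i}$ is the product of the $i$-th entry of the row vector $X^T(W^l)^{1/2}(I-P^l)(V^l)^{-1/2}$ and the $i$-th entry of $Y^l-\mu^l$. Subscript $\hat\gamma$ means that $\hat\gamma^l$ is plugged in (so $\mu^l$ becomes $\hat\mu^l$), and subscript $\gamma_0$ means that the true nuisance parameter is used. Sign flips. $g_1=(1,\dots,1)\in\mathbb{R}^n$, and $g_2,\dots,g_w$ are drawn independently and uniformly (with replacement) from $\{-1,1\}^n$, independently of the data. The same flips are used for all $m$ models. $G_j$ is the diagonal matrix with diagonal $g_{j1},\dots,g_{jn}$. The sign-flipped effective score is $S^{*,j,l}_{\gamma}=n^{-1/2}X^T(W^l)^{1/2}(I-P^l)(V^l)^{-1/2}G_j(Y^l-\mu^l)=n^{-1/2}\sum_{i=1}^n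 g_{ji}\nu^{*l}_{\gamma,i}$. $\bm{M}^n$ is the $w\times m$ matrix with $(j,l)$-th entry $\bm{M}^n_{j,l}=S^{*,j,l}_{\hat\gamma}$. Single-step max-$T$ method. For $1\le j\le w$ let $m_j=\max_{1\le l\le m}|\bm{M}^n_{j,l}|$, and let $m_{(1)}\le\dots\le m_{(w)}$ be the sorted values. Reject every $H_l$ with $|\bm{M}^n_{1,l}|>m_{(\lceil(1-\alpha)w\rceil)}$. Sequential max-$T$ method. Carry out the single-step method; then remove from $\bm{M}^n$ the columns corresponding to the rejected hypotheses and reapply the single-step method to the remaining matrix (with maxima over the remaining columns only), rejecting further hypotheses; continue until a step yields no new rejections (or no columns remain). The method rejects all hypotheses rejected in some step. Standing regularity conditions, for all $l,l'$ whose null hypotheses are true: (i) $n^{-1}\sum_{i=1}^n\mathrm{Cov}(\nu^{*l}_{\gamma_0,i},\nu^{*l'}_{\gamma_0,i})$ converges as $n\to\infty$ to a finite limit, which is positive when $l=l'$; (ii) (Lindeberg) for every $\epsilon>0$, $n^{-1}\sum_{i=1}^n\mathbb{E}[(\nu^{*l}_{\gamma_0,i})^2\mathbf{1}\{|\nu^{*l}_{\gamma_0,i}|>\epsilon\sqrt n\}]\to0$; (iii) the nuisance estimators are such that $S^{*,j,l}_{\hat\gamma}=S^{*,j,l}_{\gamma_0}+o_p(1)$ for each $1\le j\le w$. *)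

theory Defs
  imports "HOL-Probability.Probability" "Jordan_Normal_Form.Gauss_Jordan_Elimination"
begin

no_notation Finite_Cartesian_Product.vec_nth (infixl "$" 90)
hide_type (open) Finite_Cartesian_Product.vec
hide_const (open) Finite_Cartesian_Product.vec Finite_Cartesian_Product.row
  Finite_Cartesian_Product.mat

text \<open>
  All indices are 0-based: units are \<open>i < n\<close>, responses \<open>l < m\<close>, flips \<open>j < w\<close>, and flip
  \<open>0\<close> is the identity.
\<close>

text \<open>
  The functions \<open>a\<close>, \<open>b\<close>, \<open>c\<close> of the density \<open>exp ((y \<theta> - b \<theta>) / a \<phi> + c y \<phi>)\<close>, its
  reference measure and the link function. The reference measure may depend on the dispersion
  parameter, because \<open>exp (c y \<phi>)\<close> never vanishes and the support (for instance of binomial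
  proportions) may depend on \<open>\<phi>\<close>. The link is injective on \<open>mean_space\<close> only, its values elsewhere
  being irrelevant.
\<close>

record glm =
  disp_fun :: "real \<Rightarrow> real"
  cumulant :: "real \<Rightarrow> real"
  base_fun :: "real \<Rightarrow> real \<Rightarrow> real"
  ref_measure :: "real \<Rightarrow> real measure"
  link :: "real \<Rightarrow> real"
  mean_space :: "real set"

definition edf_density :: "glm \<Rightarrow> real \<Rightarrow> real \<Rightarrow> real \<Rightarrow> real" where
  "edf_density F \<theta> \<phi> y =
     exp ((y * \<theta> - cumulant F \<theta>) / disp_fun F \<phi> + base_fun F y \<phi>)"

definition edf :: "glm \<Rightarrow> real \<Rightarrow> real \<Rightarrow> real measure" where
  "edf F \<theta> \<phi> = density (ref_measure F \<phi>) (\<lambda>y. ennreal (edf_density F \<theta> \<phi> y))"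

definition edf_mean :: "glm \<Rightarrow> real \<Rightarrow> real \<Rightarrow> real" where
  "edf_mean F \<phi> \<theta> = (\<integral>y. y \<partial>edf F \<theta> \<phi>)"

definition edf_var :: "glm \<Rightarrow> real \<Rightarrow> real \<Rightarrow> real" where
  "edf_var F \<phi> \<theta> = (\<integral>y. (y - edf_mean F \<phi> \<theta>)\<^sup>2 \<partial>edf F \<theta> \<phi>)"

text \<open>The parameters at which the density is a probability density with finite variance.\<close>

definition edf_params :: "glm \<Rightarrow> real \<Rightarrow> real set" where
  "edf_params F \<phi> = {\<theta>. prob_space (edf F \<theta> \<phi>) \<and> integrable (edf F \<theta> \<phi>) (\<lambda>y. y\<^sup>2)}"

definition edf_at :: "glm \<Rightarrow> real \<Rightarrow> bool" where
  "edf_at F \<phi> \<longleftrightarrow>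
     sigma_finite_measure (ref_measure F \<phi>) \<and> sets (ref_measure F \<phi>) = sets borel \<and>
     disp_fun F \<phi> \<noteq> 0 \<and>
     mean_space F \<subseteq> edf_mean F \<phi> ` edf_params F \<phi>"

definition inv_link :: "glm \<Rightarrow> real \<Rightarrow> real" where
  "inv_link F = the_inv_into (mean_space F) (link F)"

definition link_function :: "glm \<Rightarrow> bool" where
  "link_function F \<longleftrightarrow>
     inj_on (link F) (mean_space F) \<and> open (link F ` mean_space F) \<and>
     inv_link F differentiable_on (link F ` mean_space F)"

text \<open>
  \<open>X\<close> is an \<open>n \<times> 1\<close> and \<open>Z\<close> an \<open>n \<times> (k - 1)\<close> matrix; \<open>\<phi> i\<close> is the dispersion parameter of unit
  \<open>i\<close>. The matrices are evaluated at an arbitrary \<open>(\<beta>, \<gamma>)\<close>.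
\<close>

definition lin_pred :: "real mat \<Rightarrow> real mat \<Rightarrow> real \<Rightarrow> real vec \<Rightarrow> real vec" where
  "lin_pred X Z \<beta> \<gamma> = \<beta> \<cdot>\<^sub>v col X 0 + Z *\<^sub>v \<gamma>"

definition mean_vec :: "glm \<Rightarrow> real mat \<Rightarrow> real mat \<Rightarrow> real \<Rightarrow> real vec \<Rightarrow> real vec" where
  "mean_vec F X Z \<beta> \<gamma> = map_vec (inv_link F) (lin_pred X Z \<beta> \<gamma>)"

text \<open>\<open>\<partial>\<mu>\<^sub>i / \<partial>\<eta>\<^sub>i\<close>\<close>

definition dmean :: "glm \<Rightarrow> real mat \<Rightarrow> real mat \<Rightarrow> real \<Rightarrow> real vec \<Rightarrow> nat \<Rightarrow> real" where
  "dmean F X Z \<beta> \<gamma> i = deriv (inv_link F) (lin_pred X Z \<beta> \<gamma> $ i)"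

text \<open>
  The variance of \<open>Y\<^sub>i\<close> under \<open>(\<beta>, \<gamma>)\<close>: the variance of the member of the family that has dispersion
  parameter \<open>\<phi> i\<close> and mean \<open>\<mu>\<^sub>i\<close>.
\<close>

definition resp_var ::
  "glm \<Rightarrow> (nat \<Rightarrow> real) \<Rightarrow> real mat \<Rightarrow> real mat \<Rightarrow> real \<Rightarrow> real vec \<Rightarrow> nat \<Rightarrow> real" where
  "resp_var F \<phi> X Z \<beta> \<gamma> i =
     edf_var F (\<phi> i)
       (the_inv_into (edf_params F (\<phi> i)) (edf_mean F (\<phi> i)) (mean_vec F X Z \<beta> \<gamma> $ i))"

text \<open>
  The row vector \<open>X\<^sup>T W\<^sup>1\<^sup>/\<^sup>2 (I - P) V\<^sup>-\<^sup>1\<^sup>/\<^sup>2\<close>. The matrix \<open>Z\<^sup>T W Z\<close> is meant to be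
  nonsingular; otherwise its inverse is an unspecified matrix.
\<close>

definition score_row ::
  "glm \<Rightarrow> (nat \<Rightarrow> real) \<Rightarrow> real mat \<Rightarrow> real mat \<Rightarrow> real \<Rightarrow> real vec \<Rightarrow> real mat" where
  "score_row F \<phi> X Z \<beta> \<gamma> =
    (let n = dim_row X;
         D = mat_diag n (dmean F X Z \<beta> \<gamma>);
         v = resp_var F \<phi> X Z \<beta> \<gamma>;
         W = D * mat_diag n (\<lambda>i. 1 / v i) * D;
         Whalf = mat_diag n (\<lambda>i. sqrt (W $$ (i, i)));
         P = Whalf * Z * the (mat_inverse (Z\<^sup>T * W * Z)) * Z\<^sup>T * Whalf
     in X\<^sup>T * Whalf * (1\<^sub>m n - P) * mat_diag n (\<lambda>i. 1 / sqrt (v i)))"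

definition score_contrib ::
  "glm \<Rightarrow> (nat \<Rightarrow> real) \<Rightarrow> real mat \<Rightarrow> real mat \<Rightarrow> real \<Rightarrow> real vec \<Rightarrow> real vec \<Rightarrow> nat \<Rightarrow> real" where
  "score_contrib F \<phi> X Z \<beta> \<gamma> y i =
     score_row F \<phi> X Z \<beta> \<gamma> $$ (0, i) * (y - mean_vec F X Z \<beta> \<gamma>) $ i"

definition flipped_score ::
  "glm \<Rightarrow> (nat \<Rightarrow> real) \<Rightarrow> real mat \<Rightarrow> real mat \<Rightarrow> real \<Rightarrow> real vec \<Rightarrow> real vec \<Rightarrow> real vec \<Rightarrow> real" where
  "flipped_score F \<phi> X Z \<beta> \<gamma> g y =
     1 / sqrt (real (dim_row X)) *
       (score_row F \<phi> X Z \<beta> \<gamma> * mat_diag (dim_row X) (\<lambda>i. g $ i)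
          *\<^sub>v (y - mean_vec F X Z \<beta> \<gamma>)) $ 0"

definition sign_vecs :: "nat \<Rightarrow> real vec set" where
  "sign_vecs n = {g \<in> carrier_vec n. \<forall>i<n. g $ i \<in> {-1, 1}}"

text \<open>
  \<open>A\<close> is the matrix of flipped statistics (rows: flips, columns: hypotheses) and \<open>C\<close> a finite
  nonempty set of column indices over which the maxima are taken.
\<close>

definition max_stat :: "real mat \<Rightarrow> nat set \<Rightarrow> nat \<Rightarrow> real" where
  "max_stat A C j = Max ((\<lambda>l. \<bar>A $$ (j, l)\<bar>) ` C)"

text \<open>The order statistic with 1-based rank \<open>\<lceil>(1 - \<alpha>) w\<rceil>\<close>.\<close>

definition crit_value :: "real \<Rightarrow> real mat \<Rightarrow> nat set \<Rightarrow> real" where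
  "crit_value \<alpha> A C =
     sort (map (max_stat A C) [0..<dim_row A]) ! (nat \<lceil>(1 - \<alpha>) * real (dim_row A)\<rceil> - 1)"

definition max_T_step :: "real \<Rightarrow> real mat \<Rightarrow> nat set \<Rightarrow> nat set" where
  "max_T_step \<alpha> A C = {l \<in> C. \<bar>A $$ (0, l)\<bar> > crit_value \<alpha> A C}"

definition single_step_max_T :: "real \<Rightarrow> real mat \<Rightarrow> nat set" where
  "single_step_max_T \<alpha> A = max_T_step \<alpha> A {..<dim_col A}"

fun remaining :: "real \<Rightarrow> real mat \<Rightarrow> nat \<Rightarrow> nat set" where
  "remaining \<alpha> A 0 = {..<dim_col A}"
| "remaining \<alpha> A (Suc t) = remaining \<alpha> A t - max_T_step \<alpha> A (remaining \<alpha> A t)"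

text \<open>
  After a step without rejections the set of remaining columns is stationary and no later step
  rejects anything, so stopping there amounts to taking the union over all steps.
\<close>

definition sequential_max_T :: "real \<Rightarrow> real mat \<Rightarrow> nat set" where
  "sequential_max_T \<alpha> A = (\<Union>t. max_T_step \<alpha> A (remaining \<alpha> A t))"

text \<open>As \<^term>\<open>prob_space.indep_var\<close>, for random variables with values in different types.\<close>

definition indep_rvs ::
  "'a measure \<Rightarrow> 'b measure \<Rightarrow> ('a \<Rightarrow> 'b) \<Rightarrow> 'c measure \<Rightarrow> ('a \<Rightarrow> 'c) \<Rightarrow> bool" where
  "indep_rvs M S U T V \<longleftrightarrow>
     U \<in> measurable M S \<and> V \<in> measurable M T \<and>
     prob_space.indep_set M {U -` A \<inter> space M | A. A \<in> sets S} {V -` A \<inter> space M | A. A \<in> sets T}"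

definition fwer :: "'a measure \<Rightarrow> ('a \<Rightarrow> nat set) \<Rightarrow> nat set \<Rightarrow> real" where
  "fwer M rej N = measure M {\<omega> \<in> space M. rej \<omega> \<inter> N \<noteq> {}}"

definition cov :: "'a measure \<Rightarrow> ('a \<Rightarrow> real) \<Rightarrow> ('a \<Rightarrow> real) \<Rightarrow> real" where
  "cov M U V = (\<integral>\<omega>. (U \<omega> - (\<integral>\<omega>'. U \<omega>' \<partial>M)) * (V \<omega> - (\<integral>\<omega>'. V \<omega>' \<partial>M)) \<partial>M)"

text \<open>\<open>R n = o\<^sub>p(1)\<close>, where \<open>R n\<close> lives on \<open>M n\<close>.\<close>

definition op1 :: "(nat \<Rightarrow> 'a measure) \<Rightarrow> (nat \<Rightarrow> 'a \<Rightarrow> real) \<Rightarrow> bool" where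
  "op1 M R \<longleftrightarrow>
     (\<forall>n. R n \<in> borel_measurable (M n)) \<and>
     (\<forall>\<epsilon>>0. (\<lambda>n. measure (M n) {\<omega> \<in> space (M n). \<bar>R n \<omega>\<bar> > \<epsilon>}) \<longlonglongrightarrow> 0)"

definition lindeberg :: "(nat \<Rightarrow> 'a measure) \<Rightarrow> (nat \<Rightarrow> nat \<Rightarrow> 'a \<Rightarrow> real) \<Rightarrow> bool" where
  "lindeberg M U \<longleftrightarrow>
     (\<forall>\<epsilon>>0. (\<lambda>n. 1 / real n *
        (\<Sum>i<n. \<integral>\<omega>. (U n i \<omega>)\<^sup>2 * indicator {\<omega>. \<bar>U n i \<omega>\<bar> > \<epsilon> * sqrt (real n)} \<omega> \<partial>M n)) \<longlonglongrightarrow> 0)"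

end

theory Submission
  imports Defs
begin

text \<open>
  For a matrix with exchangeable rows the claim is a matter of counting. Let \<open>c\<close> be the rank of the
  critical value. Both procedures can reject a true null hypothesis only if at least \<open>c\<close> rows have
  a maximum over the true nulls that is strictly smaller than the one of the first row
  (\<open>rejection_imp_many_smaller_rows\<close>). Of \<open>w\<close> rows at most \<open>w - c\<close> can be in that position
  (\<open>card_many_below\<close>), so by exchangeability the first row is with probability at most
  \<open>(w - c) / w \<le> \<alpha>\<close>.

  The rows of flipped scores are not exchangeable, because the first flip is the identity and the
  score contributions need not be symmetric, but asymptotically they are. Random signs
  make different rows uncorrelated and leave the covariances within a row unchanged, so under the
  Lindeberg condition the characteristic function of the whole matrix at \<open>t\<close> converges to
  \<open>exp (- Q t / 2)\<close>, where \<open>Q t = \<Sum>\<^sub>j t\<^sub>j\<^sup>T L t\<^sub>j\<close> is invariant under permutations of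
  the rows. For this, independence of the units, averaged over the uniform flips, factorises the
  characteristic function into one factor per unit (\<open>flip_factorization\<close>), and each factor is expanded
  to second order (\<open>averaged_char_product_limit\<close>).

  The passage from characteristic functions to the rejection event goes through bounded variables
  instead of multivariate weak convergence. The event only compares absolute values, and on a box
  \<open>\<bar>x\<bar> \<le> K\<close> the absolute value is a continuous function of \<open>cos (\<pi> x / K)\<close>. By Stone-Weierstrass
  every continuous function of these cosines is a uniform limit of trigonometric polynomials, whose
  expectations are combinations of values of the characteristic function
  (\<open>char_convergence_imp_cos_vec_convergence\<close>). The indicator of the event is replaced by a
  continuous function that lies below it, which keeps the counting bound (\<open>sum_soft_top\<close>). The two
  differ only if two rows nearly tie. Near ties and entries outside the box concern linear
  forms of the scores, hence one-dimensional normal limits (\<open>linear_form_interval\<close>); the plug-in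
  error is absorbed in the tolerance for ties (\<open>top_row_probability\<close>).
\<close>

section \<open>Counting rows, exactly and softly\<close>

lemma Max_image_attained:
  assumes "finite N" "N \<noteq> {}"
  shows "\<exists>l\<in>N. Max (f ` N) = f l"
proof -
  have "Max (f ` N) \<in> f ` N"
    using assms by (intro Max_in) auto
  then show ?thesis by auto
qed

text \<open>
  Among the rows counted, a row with the smallest value has at least \<open>c\<close> rows below
  it, none of which is counted.
\<close>

lemma card_many_below:
  fixes T :: "nat \<Rightarrow> real"
  shows "card {j \<in> {..<w}. c \<le> card {k \<in> {..<w}. T k < T j}} \<le> w - c"
proof -
  define J where "J = {j \<in> {..<w}. c \<le> card {k \<in> {..<w}. T k < T j}}"
  have "finite J" "J \<subseteq> {..<w}"
    by (auto simp: J_def)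
  show ?thesis
  proof (cases "J = {}")
    case False
    then obtain j where j: "j \<in> J" "\<And>i. i \<in> J \<Longrightarrow> T j \<le> T i"
      using ex_min_if_finite[of "T ` J"] \<open>finite J\<close> by (auto simp: not_less)
    let ?B = "{k \<in> {..<w}. T k < T j}"
    have "J \<inter> ?B = {}"
      using j(2) by force
    then have "card J + card ?B = card (J \<union> ?B)"
      using \<open>finite J\<close> by (simp add: card_Un_disjoint)
    also have "\<dots> \<le> card {..<w}"
      using \<open>J \<subseteq> {..<w}\<close> by (intro card_mono) auto
    finally show ?thesis
      using j(1) unfolding J_def by (simp only: mem_Collect_eq card_lessThan) linarith
  qed (simp only: J_def[symmetric], simp)
qed

definition clamp01 :: "real \<Rightarrow> real" where
  "clamp01 x = max 0 (min 1 x)"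

text \<open>
  A continuous lower bound for the number of rows below row \<open>j\<close>: a row counts fully only if it
  lies below by at least \<open>\<delta>\<close>.
\<close>

definition soft_count :: "real \<Rightarrow> nat \<Rightarrow> (nat \<Rightarrow> real) \<Rightarrow> nat \<Rightarrow> real" where
  "soft_count \<delta> w T j = (\<Sum>k<w. clamp01 ((T j - T k) / \<delta>))"

text \<open>
  The offset \<open>c - 1\<close> makes the value \<open>0\<close> as soon as fewer than \<open>c\<close> rows lie below row \<open>j\<close>, and
  \<open>1\<close> once \<open>c\<close> rows lie below it by \<open>\<delta>\<close>.
\<close>

definition soft_top :: "real \<Rightarrow> nat \<Rightarrow> nat \<Rightarrow> (nat \<Rightarrow> real) \<Rightarrow> nat \<Rightarrow> real" where
  "soft_top \<delta> w c T j = clamp01 (soft_count \<delta> w T j - (real c - 1))"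

lemma clamp01_bounds: "0 \<le> clamp01 x" "clamp01 x \<le> 1"
  by (auto simp: clamp01_def)

lemma soft_top_bounds: "0 \<le> soft_top \<delta> w c T j" "soft_top \<delta> w c T j \<le> 1"
  by (auto simp: soft_top_def clamp01_bounds)

lemma soft_top_le:
  assumes "\<delta> > 0"
  shows "soft_top \<delta> w c T j \<le> of_bool (c \<le> card {k \<in> {..<w}. T k < T j})"
proof (cases "c \<le> card {k \<in> {..<w}. T k < T j}")
  case False
  have "soft_count \<delta> w T j \<le> (\<Sum>k<w. of_bool (T k < T j))"
    unfolding soft_count_def
    by (intro sum_mono) (use assms in \<open>auto simp: clamp01_def divide_le_0_iff\<close>)
  also have "\<dots> = card {k \<in> {..<w}. T k < T j}"
    by (simp add: sum.If_cases of_bool_def Int_def)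
  also have "\<dots> \<le> real c - 1"
    using False by linarith
  finally show ?thesis
    by (auto simp: soft_top_def clamp01_def)
qed (simp add: soft_top_bounds)

lemma soft_top_eq_1:
  assumes "\<delta> > 0" and "c \<le> card {k \<in> {..<w}. T k \<le> T j - \<delta>}"
  shows "soft_top \<delta> w c T j = 1"
proof -
  have "real c \<le> card {k \<in> {..<w}. T k \<le> T j - \<delta>}"
    using assms(2) by simp
  also have "\<dots> = (\<Sum>k<w. of_bool (T k \<le> T j - \<delta>))"
    by (simp add: sum.If_cases of_bool_def Int_def)
  also have "\<dots> \<le> soft_count \<delta> w T j"
    unfolding soft_count_def
    by (intro sum_mono) (use assms in \<open>auto simp: clamp01_def field_simps\<close>)
  finally show ?thesis
    by (simp add: soft_top_def clamp01_def)
qed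

text \<open>
  The soft indicators stay below the exact ones, so they inherit the counting bound.
\<close>

lemma sum_soft_top:
  assumes "\<delta> > 0"
  shows "(\<Sum>j<w. soft_top \<delta> w c T j) \<le> real (w - c)"
proof -
  have "(\<Sum>j<w. soft_top \<delta> w c T j) \<le> (\<Sum>j<w. of_bool (c \<le> card {k \<in> {..<w}. T k < T j}))"
    by (intro sum_mono soft_top_le assms)
  also have "\<dots> = card {j \<in> {..<w}. c \<le> card {k \<in> {..<w}. T k < T j}}"
    by (simp add: sum.If_cases of_bool_def Int_def)
  also have "\<dots> \<le> real (w - c)"
    using card_many_below[of w c T] by simp
  finally show ?thesis .
qed

lemma soft_top_permute:
  assumes "bij_betw \<tau> {..<w} {..<w}"
  shows "soft_top \<delta> w c (\<lambda>k. T (\<tau> k)) j = soft_top \<delta> w c T (\<tau> j)"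
  unfolding soft_top_def soft_count_def
  using sum.reindex_bij_betw[OF assms, of "\<lambda>k. clamp01 ((T (\<tau> j) - T k) / \<delta>)"] by simp

lemma continuous_on_Max:
  fixes f :: "'i \<Rightarrow> 'a::topological_space \<Rightarrow> real"
  assumes "finite N" "N \<noteq> {}" "\<And>l. l \<in> N \<Longrightarrow> continuous_on A (f l)"
  shows "continuous_on A (\<lambda>x. Max ((\<lambda>l. f l x) ` N))"
  using assms
proof (induction rule: finite_ne_induct)
  case (insert l N)
  have "(\<lambda>x. Max ((\<lambda>l. f l x) ` insert l N)) = (\<lambda>x. max (f l x) (Max ((\<lambda>l. f l x) ` N)))"
    using insert by simp
  then show ?case
    using insert by (auto intro!: continuous_on_max)
qed auto

lemma continuous_on_soft_top:
  assumes "\<And>k. k < w \<Longrightarrow> continuous_on A (\<lambda>x. T x k)" "j < w" "\<delta> > 0"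
  shows "continuous_on A (\<lambda>x. soft_top \<delta> w c (T x) j)"
  unfolding soft_top_def soft_count_def clamp01_def
  by (intro continuous_intros assms) (use assms in auto)

section \<open>Second-order expansion of characteristic functions\<close>

text \<open>
  The size of the error of the second-order expansion of \<open>exp (\<i> x)\<close>: the cubic Taylor bound for
  small \<open>x\<close> and the quadratic one for large \<open>x\<close>, up to constants. It is integrable as soon as the
  square is, and its expectation is what the Lindeberg condition controls.
\<close>

definition trunc_cube :: "real \<Rightarrow> real" where
  "trunc_cube x = x\<^sup>2 * min 1 \<bar>x\<bar>"

lemma trunc_cube_nonneg: "0 \<le> trunc_cube x"
  by (simp add: trunc_cube_def)

lemma trunc_cube_le_square: "trunc_cube x \<le> x\<^sup>2"
  unfolding trunc_cube_def by (intro mult_left_le) auto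

lemma trunc_cube_measurable [measurable]: "trunc_cube \<in> borel_measurable borel"
  unfolding trunc_cube_def by measurable

lemma iexp_quadratic_approx:
  "cmod (iexp x - (1 + \<i> * x - x\<^sup>2 / 2)) \<le> trunc_cube x"
proof -
  have s: "(\<Sum>k\<le>2. (\<i> * x)^k / fact k) = 1 + \<i> * x - x\<^sup>2 / 2"
    by (simp add: numeral_2_eq_2 power2_eq_square field_simps)
  have "cmod (iexp x - (1 + \<i> * x - x\<^sup>2 / 2)) \<le> \<bar>x\<bar> ^ 3 / 6"
    using iexp_approx1[of x 2] unfolding s by (simp add: numeral_eq_Suc)
  also have "\<dots> \<le> x\<^sup>2 * \<bar>x\<bar>"
  proof -
    have "\<bar>x\<bar> ^ 3 = x\<^sup>2 * \<bar>x\<bar>"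
      by (simp add: power3_eq_cube power2_eq_square)
    moreover have "0 \<le> x\<^sup>2 * \<bar>x\<bar>" by simp
    ultimately show ?thesis by linarith
  qed
  finally have 1: "cmod (iexp x - (1 + \<i> * x - x\<^sup>2 / 2)) \<le> x\<^sup>2 * \<bar>x\<bar>" .
  have "cmod (iexp x - (1 + \<i> * x - x\<^sup>2 / 2)) \<le> x\<^sup>2"
    using iexp_approx2[of x 2] unfolding s by simp
  with 1 show ?thesis
    by (auto simp: trunc_cube_def min_def)
qed

text \<open>
  Small expansion errors force small variances, which is the asymptotic negligibility of single
  units.
\<close>

lemma square_le_trunc_cube:
  assumes "0 < \<delta>" "\<delta> \<le> 1"
  shows "x\<^sup>2 \<le> \<delta>\<^sup>2 + trunc_cube x / \<delta>"
proof (cases "\<bar>x\<bar> \<le> \<delta>")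
  case True
  then have "x\<^sup>2 \<le> \<delta>\<^sup>2"
    using abs_le_square_iff[of x \<delta>] assms by simp
  moreover have "0 \<le> trunc_cube x / \<delta>"
    using assms trunc_cube_nonneg by simp
  ultimately show ?thesis by simp
next
  case False
  then have "x\<^sup>2 * \<delta> \<le> trunc_cube x"
    unfolding trunc_cube_def using assms by (intro mult_left_mono) auto
  then have "x\<^sup>2 \<le> trunc_cube x / \<delta>"
    using assms by (simp add: field_simps)
  then show ?thesis by (smt (verit) zero_le_power2)
qed

lemma trunc_cube_lindeberg:
  assumes "0 < \<epsilon>"
  shows "trunc_cube x \<le> \<epsilon> * x\<^sup>2 + x\<^sup>2 * indicator {y. \<bar>y\<bar> > \<epsilon>} x"
proof (cases "\<bar>x\<bar> > \<epsilon>")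
  case True
  then show ?thesis
    using assms trunc_cube_le_square[of x] by (simp add: add_increasing)
next
  case False
  have "trunc_cube x \<le> x\<^sup>2 * \<epsilon>"
    unfolding trunc_cube_def using False by (intro mult_left_mono) auto
  then show ?thesis by (simp add: False mult.commute)
qed

lemma trunc_cube_mono: "\<bar>x\<bar> \<le> \<bar>y\<bar> \<Longrightarrow> trunc_cube x \<le> trunc_cube y"
  unfolding trunc_cube_def by (intro mult_mono min.mono) (auto simp: abs_le_square_iff[symmetric])

lemma trunc_cube_scale:
  assumes "1 \<le> b"
  shows "trunc_cube (b * x) \<le> b ^ 3 * trunc_cube x"
proof -
  have "min 1 \<bar>b * x\<bar> \<le> b * min 1 \<bar>x\<bar>"
  proof (cases "1 \<le> \<bar>x\<bar>")
    case False
    then have "\<bar>b * x\<bar> = b * min 1 \<bar>x\<bar>"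
      using assms by (simp add: abs_mult)
    then show ?thesis by simp
  qed (use assms in simp)
  then have "trunc_cube (b * x) \<le> (b * x)\<^sup>2 * (b * min 1 \<bar>x\<bar>)"
    unfolding trunc_cube_def by (intro mult_left_mono) auto
  also have "\<dots> = b ^ 3 * trunc_cube x"
    by (simp add: trunc_cube_def power2_eq_square power3_eq_cube)
  finally show ?thesis .
qed

text \<open>
  Lindeberg-type smallness passes from the scores of the single hypotheses to their linear
  combinations, because a sum is at most \<open>card N\<close> times its largest term and \<open>trunc_cube\<close> grows
  at most cubically under scaling.
\<close>

lemma trunc_cube_sum:
  fixes b :: real and a :: "'i \<Rightarrow> real"
  assumes "finite N" "1 \<le> b" "card N \<le> b" "\<bar>x\<bar> \<le> b * (\<Sum>l\<in>N. \<bar>a l\<bar>)"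
  shows "trunc_cube x \<le> (b\<^sup>2) ^ 3 * (\<Sum>l\<in>N. trunc_cube (a l))"
proof (cases "N = {}")
  case True
  then show ?thesis using assms by (simp add: trunc_cube_def)
next
  case False
  obtain p where p: "p \<in> N" "\<And>l. l \<in> N \<Longrightarrow> \<bar>a l\<bar> \<le> \<bar>a p\<bar>"
  proof -
    obtain p where "p \<in> N" "Max ((\<lambda>l. \<bar>a l\<bar>) ` N) = \<bar>a p\<bar>"
      using Max_image_attained[OF assms(1) False, of "\<lambda>l. \<bar>a l\<bar>"] by blast
    then show thesis
      using that[of p] Max_ge[of "(\<lambda>l. \<bar>a l\<bar>) ` N"] assms(1) by auto
  qed
  have "(\<Sum>l\<in>N. \<bar>a l\<bar>) \<le> card N * \<bar>a p\<bar>"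
    using sum_bounded_above[of N "\<lambda>l. \<bar>a l\<bar>" "\<bar>a p\<bar>"] p by simp
  also have "\<dots> \<le> b * \<bar>a p\<bar>"
    using assms by (intro mult_right_mono) auto
  finally have "\<bar>x\<bar> \<le> b * (b * \<bar>a p\<bar>)"
    using order_trans[OF assms(4) mult_left_mono] assms(2) by simp
  then have "\<bar>x\<bar> \<le> \<bar>b\<^sup>2 * a p\<bar>"
    using assms by (simp add: abs_mult power2_eq_square)
  then have "trunc_cube x \<le> trunc_cube (b\<^sup>2 * a p)"
    by (rule trunc_cube_mono)
  also have "\<dots> \<le> (b\<^sup>2) ^ 3 * trunc_cube (a p)"
    using assms by (intro trunc_cube_scale) (simp add: one_le_power)
  also have "\<dots> \<le> (b\<^sup>2) ^ 3 * (\<Sum>l\<in>N. trunc_cube (a l))"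
    using p assms by (intro mult_left_mono member_le_sum) (auto simp: trunc_cube_nonneg)
  finally show ?thesis .
qed

lemma exp_minus_linear_approx:
  assumes "0 \<le> (x::real)"
  shows "\<bar>exp (- x) - (1 - x)\<bar> \<le> x\<^sup>2"
proof -
  have "1 - x \<le> exp (- x)"
    using exp_ge_add_one_self[of "-x"] by simp
  moreover have "exp (- x) \<le> 1 - x + x\<^sup>2"
  proof -
    have "exp (- x) = 1 / exp x" by (simp add: exp_minus field_simps)
    also have "\<dots> \<le> 1 / (1 + x)"
      using assms exp_ge_add_one_self[of x] by (intro divide_left_mono) auto
    also have "\<dots> \<le> 1 - x + x\<^sup>2"
    proof -
      have "(1 - x + x\<^sup>2) * (1 + x) = 1 + x ^ 3"
        by (simp add: algebra_simps power2_eq_square power3_eq_cube)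
      then have "1 \<le> (1 - x + x\<^sup>2) * (1 + x)"
        using assms by simp
      then show ?thesis
        using assms by (simp add: divide_le_eq)
    qed
    finally show ?thesis .
  qed
  ultimately show ?thesis by linarith
qed

text \<open>
  The analytic core of the Lindeberg central limit theorem: \<open>f\<close> are the characteristic functions of
  the summands, \<open>v\<close> their variances and \<open>\<rho>\<close> the errors of the second-order expansions. The
  factors are compared with \<open>exp (- v / 2)\<close>; the error of that comparison is of order
  \<open>\<Sum> v\<^sup>2 \<le> max v * \<Sum> v\<close>, and \<open>v_small\<close> makes the maximum vanish.
\<close>

lemma prod_tendsto_exp:
  fixes f :: "nat \<Rightarrow> nat \<Rightarrow> complex" and v \<rho> :: "nat \<Rightarrow> nat \<Rightarrow> real"
  assumes norm_f: "\<And>n i. i < n \<Longrightarrow> cmod (f n i) \<le> 1"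
    and approx: "\<And>n i. i < n \<Longrightarrow> cmod (f n i - (1 - v n i / 2)) \<le> \<rho> n i"
    and v_nonneg: "\<And>n i. i < n \<Longrightarrow> 0 \<le> v n i"
    and v_small: "\<And>n i \<delta>. i < n \<Longrightarrow> 0 < \<delta> \<Longrightarrow> \<delta> \<le> 1 \<Longrightarrow> v n i \<le> \<delta>\<^sup>2 + \<rho> n i / \<delta>"
    and v_sum: "(\<lambda>n. \<Sum>i<n. v n i) \<longlonglongrightarrow> q"
    and \<rho>_sum: "(\<lambda>n. \<Sum>i<n. \<rho> n i) \<longlonglongrightarrow> 0"
  shows "(\<lambda>n. \<Prod>i<n. f n i) \<longlonglongrightarrow> complex_of_real (exp (- q / 2))"
proof -
  have \<rho>_nonneg: "0 \<le> \<rho> n i" if "i < n" for n i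
    using approx[OF that] norm_ge_zero order_trans by blast
  \<comment> \<open>the sum of squares is at most the largest variance times the sum of the variances\<close>
  have sq: "(\<lambda>n. \<Sum>i<n. (v n i)\<^sup>2) \<longlonglongrightarrow> 0"
  proof (rule tendstoI)
    fix e :: real assume "0 < e"
    define C where "C = \<bar>q\<bar> + 1"
    have "C > 0" by (simp add: C_def add_nonneg_pos)
    define \<delta> where "\<delta> = min 1 (e / (2 * C))"
    have \<delta>: "0 < \<delta>" "\<delta> \<le> 1" "\<delta>\<^sup>2 * C \<le> e / 2"
    proof -
      show "0 < \<delta>" "\<delta> \<le> 1" using \<open>0 < e\<close> \<open>C > 0\<close> by (auto simp: \<delta>_def)
      then have "\<delta>\<^sup>2 \<le> \<delta>" by (simp add: power2_eq_square mult_left_le)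
      also have "\<delta> \<le> e / (2 * C)" by (simp add: \<delta>_def)
      finally show "\<delta>\<^sup>2 * C \<le> e / 2" using \<open>C > 0\<close> by (simp add: field_simps)
    qed
    have "\<forall>\<^sub>F n in sequentially. (\<Sum>i<n. v n i) < C"
      by (rule order_tendstoD(2)[OF v_sum]) (simp add: C_def)
    moreover have "\<forall>\<^sub>F n in sequentially. (\<Sum>i<n. \<rho> n i) < \<delta> * e / (2 * C)"
      by (rule order_tendstoD(2)[OF \<rho>_sum]) (use \<delta> \<open>0 < e\<close> \<open>C > 0\<close> in auto)
    ultimately show "\<forall>\<^sub>F n in sequentially. dist (\<Sum>i<n. (v n i)\<^sup>2) 0 < e"
    proof eventually_elim
      case (elim n)
      let ?R = "\<Sum>i<n. \<rho> n i"
      have R: "0 \<le> ?R" by (intro sum_nonneg) (auto simp: \<rho>_nonneg)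
      have "(\<Sum>i<n. (v n i)\<^sup>2) \<le> (\<Sum>i<n. (\<delta>\<^sup>2 + ?R / \<delta>) * v n i)"
      proof (intro sum_mono)
        fix i assume "i \<in> {..<n}"
        then have i: "i < n" by simp
        have "v n i \<le> \<delta>\<^sup>2 + \<rho> n i / \<delta>"
          using v_small[OF i \<delta>(1,2)] .
        also have "\<dots> \<le> \<delta>\<^sup>2 + ?R / \<delta>"
          using i \<delta>(1) by (intro add_left_mono divide_right_mono member_le_sum)
            (auto simp: \<rho>_nonneg)
        finally show "(v n i)\<^sup>2 \<le> (\<delta>\<^sup>2 + ?R / \<delta>) * v n i"
          unfolding power2_eq_square using v_nonneg[OF i] by (rule mult_right_mono)
      qed
      also have "\<dots> = (\<delta>\<^sup>2 + ?R / \<delta>) * (\<Sum>i<n. v n i)"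
        by (simp add: sum_distrib_left)
      also have "\<dots> \<le> (\<delta>\<^sup>2 + ?R / \<delta>) * C"
        using elim \<delta> R by (intro mult_left_mono) auto
      also have "\<dots> = \<delta>\<^sup>2 * C + ?R * C / \<delta>"
        by (simp add: algebra_simps)
      also have "?R * C / \<delta> < e / 2"
        using elim(2) \<delta>(1) \<open>C > 0\<close> by (simp add: field_simps)
      finally show ?case
        using \<delta>(3) by (simp add: sum_nonneg)
    qed
  qed
  have "(\<lambda>n. (\<Prod>i<n. f n i) - (\<Prod>i<n. complex_of_real (exp (- (v n i / 2))))) \<longlonglongrightarrow> 0"
  proof (rule Lim_null_comparison)
    show "\<forall>\<^sub>F n in sequentially. norm ((\<Prod>i<n. f n i) - (\<Prod>i<n. complex_of_real (exp (- (v n i / 2)))))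
      \<le> (\<Sum>i<n. \<rho> n i) + (\<Sum>i<n. (v n i)\<^sup>2)"
    proof (intro always_eventually allI)
      fix n
      have "norm ((\<Prod>i<n. f n i) - (\<Prod>i<n. complex_of_real (exp (- (v n i / 2)))))
        \<le> (\<Sum>i<n. norm (f n i - complex_of_real (exp (- (v n i / 2)))))"
        by (intro norm_prod_diff) (auto simp: norm_f v_nonneg simp del: of_real_exp)
      also have "\<dots> \<le> (\<Sum>i<n. \<rho> n i + (v n i)\<^sup>2)"
      proof (intro sum_mono)
        fix i assume "i \<in> {..<n}"
        then have i: "i < n" by simp
        have "norm (f n i - complex_of_real (exp (- (v n i / 2))))
          \<le> norm (f n i - (1 - v n i / 2)) + norm (complex_of_real (1 - v n i / 2) - complex_of_real (exp (- (v n i / 2))))"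
          using norm_triangle_ineq[of "f n i - (1 - v n i / 2)" "complex_of_real (1 - v n i / 2) - complex_of_real (exp (- (v n i / 2)))"]
          by simp
        also have "norm (complex_of_real (1 - v n i / 2) - complex_of_real (exp (- (v n i / 2)))) = \<bar>exp (- (v n i / 2)) - (1 - v n i / 2)\<bar>"
          unfolding of_real_diff[symmetric] norm_of_real by (rule abs_minus_commute)
        also have "\<dots> \<le> (v n i / 2)\<^sup>2"
          using v_nonneg[OF i] by (intro exp_minus_linear_approx) simp
        also have "\<dots> \<le> (v n i)\<^sup>2"
          by (simp add: power_divide)
        finally show "norm (f n i - complex_of_real (exp (- (v n i / 2)))) \<le> \<rho> n i + (v n i)\<^sup>2"
          using approx[OF i] by linarith
      qed
      finally show "norm ((\<Prod>i<n. f n i) - (\<Prod>i<n. complex_of_real (exp (- (v n i / 2)))))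
      \<le> (\<Sum>i<n. \<rho> n i) + (\<Sum>i<n. (v n i)\<^sup>2)"
        by (simp add: sum.distrib)
    qed
    show "(\<lambda>n. (\<Sum>i<n. \<rho> n i) + (\<Sum>i<n. (v n i)\<^sup>2)) \<longlonglongrightarrow> 0"
      using tendsto_add[OF \<rho>_sum sq] by simp
  qed
  moreover have "(\<lambda>n. \<Prod>i<n. complex_of_real (exp (- (v n i / 2)))) \<longlonglongrightarrow> complex_of_real (exp (- q / 2))"
  proof -
    have "(\<Prod>i<n. complex_of_real (exp (- (v n i / 2)))) = complex_of_real (exp (- (\<Sum>i<n. v n i) / 2))" for n
      unfolding of_real_prod[symmetric]
      by (simp add: exp_sum[symmetric] sum_divide_distrib sum_negf del: of_real_exp)
    then show ?thesis
      by (simp del: of_real_exp) (intro tendsto_intros v_sum; simp)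
  qed
  ultimately show ?thesis
    using tendsto_add by fastforce
qed

section \<open>Cosines as test functions\<close>

text \<open>
  Cosines with arbitrary frequency vectors suffice, because the product of two of them is a
  combination of two others.
\<close>

inductive_set trig_poly :: "'i set \<Rightarrow> (('i \<Rightarrow> real) \<Rightarrow> real) set" for I where
  cos: "(\<lambda>x. c * cos (\<Sum>i\<in>I. t i * x i)) \<in> trig_poly I"
| add: "f \<in> trig_poly I \<Longrightarrow> g \<in> trig_poly I \<Longrightarrow> (\<lambda>x. f x + g x) \<in> trig_poly I"

lemma trig_poly_mult:
  assumes "f \<in> trig_poly I" "g \<in> trig_poly I"
  shows "(\<lambda>x. f x * g x) \<in> trig_poly I"
  using assms(1)
proof induction
  case (cos c t)
  show ?case
    using assms(2)
  proof induction
    case (cos d u)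
    have "(\<lambda>x. c * cos (\<Sum>i\<in>I. t i * x i) * (d * cos (\<Sum>i\<in>I. u i * x i)))
        = (\<lambda>x. (c * d / 2) * cos (\<Sum>i\<in>I. (t i - u i) * x i) + (c * d / 2) * cos (\<Sum>i\<in>I. (t i + u i) * x i))"
    proof
      fix x :: "'a \<Rightarrow> real"
      let ?a = "\<Sum>i\<in>I. t i * x i" and ?b = "\<Sum>i\<in>I. u i * x i"
      have e: "(\<Sum>i\<in>I. (t i - u i) * x i) = ?a - ?b" "(\<Sum>i\<in>I. (t i + u i) * x i) = ?a + ?b"
        by (simp_all add: left_diff_distrib distrib_right sum.distrib sum_subtractf)
      show "c * cos ?a * (d * cos ?b) = (c * d / 2) * cos (\<Sum>i\<in>I. (t i - u i) * x i)
          + (c * d / 2) * cos (\<Sum>i\<in>I. (t i + u i) * x i)"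
        unfolding e by (simp add: cos_diff cos_add algebra_simps)
    qed
    then show ?case
      by (simp only:) (intro trig_poly.intros)
  next
    case (add f g)
    from trig_poly.add[OF add.IH] show ?case
      by (simp add: algebra_simps)
  qed
next
  case (add f h)
  from trig_poly.add[OF add.IH] show ?case
    by (simp add: algebra_simps)
qed

text \<open>
  The coordinates outside \<open>I\<close> are set to \<open>0\<close>, so that the values lie in a compact set whose points
  are separated by the coordinates in \<open>I\<close>.
\<close>

definition cos_vec :: "real \<Rightarrow> 'i set \<Rightarrow> ('i \<Rightarrow> real) \<Rightarrow> 'i \<Rightarrow> real" where
  "cos_vec a I x = (\<lambda>i. if i \<in> I then cos (a * x i) else 0)"

definition cos_box :: "'i set \<Rightarrow> ('i \<Rightarrow> real) set" where
  "cos_box I = (\<Pi>\<^sub>E i\<in>UNIV. if i \<in> I then {-1..1} else {0})"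

lemma cos_vec_in_box: "cos_vec a I x \<in> cos_box I"
  by (auto simp: cos_vec_def cos_box_def)

lemma compact_cos_box: "compact (cos_box I)"
proof -
  have "compactin (product_topology (\<lambda>i. euclidean) UNIV) (cos_box I)"
    unfolding cos_box_def by (subst compactin_PiE) auto
  then show ?thesis
    by (simp add: euclidean_product_topology)
qed

text \<open>
  A coordinate of \<open>cos_vec a I x\<close> is itself a trigonometric polynomial in \<open>x\<close>, and trigonometric
  polynomials form an algebra. Stone-Weierstrass therefore applies on the compact cosine box, and the
  approximation is uniform over all \<open>x\<close>, however large.
\<close>

lemma cos_vec_approximation:
  fixes I :: "'i::countable set" and F :: "('i \<Rightarrow> real) \<Rightarrow> real"
  assumes "finite I" "continuous_on (cos_box I) F" "0 < e"
  obtains h where "h \<in> trig_poly I" "\<And>x. \<bar>F (cos_vec a I x) - h x\<bar> < e"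
proof -
  define R where "R = {f. continuous_on (cos_box I) f \<and> (\<lambda>x. f (cos_vec a I x)) \<in> trig_poly I}"
  interpret function_ring_on R "cos_box I"
  proof
    show "compact (cos_box I)" by (rule compact_cos_box)
    show "(\<lambda>_. c) \<in> R" for c
      using trig_poly.cos[of c "\<lambda>_. 0" I] by (simp add: R_def)
    fix x y :: "'i \<Rightarrow> real" assume xy: "x \<in> cos_box I" "y \<in> cos_box I" "x \<noteq> y"
    then obtain p where p: "x p \<noteq> y p" by auto
    with xy have "p \<in> I"
      by (auto simp: cos_box_def PiE_iff split: if_splits) (metis singletonD)
    have "(\<lambda>x. x p) \<in> R"
    proof -
      have "(\<Sum>i\<in>I. (if i = p then a else 0) * x i) = a * x p" for x :: "'i \<Rightarrow> real"
        using \<open>p \<in> I\<close> assms(1) by (simp add: if_distrib[of "\<lambda>z. z * _"] cong: if_cong)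
      moreover have "(\<lambda>x. 1 * cos (\<Sum>i\<in>I. (if i = p then a else 0) * x i)) \<in> trig_poly I"
        by (rule trig_poly.cos)
      ultimately have "(\<lambda>x. cos_vec a I x p) \<in> trig_poly I"
        using \<open>p \<in> I\<close> by (simp add: cos_vec_def)
      then show ?thesis
        by (auto simp: R_def intro: continuous_on_product_coordinates continuous_on_subset)
    qed
    with p show "\<exists>f\<in>R. f x \<noteq> f y" by (intro bexI[of _ "\<lambda>x. x p"])
  qed (auto simp: R_def intro!: continuous_intros trig_poly.add trig_poly_mult)
  obtain f where "f \<in> R" "\<forall>x\<in>cos_box I. \<bar>F x - f x\<bar> < e"
    using Stone_Weierstrass_basic[OF assms(2,3)] by auto
  then show ?thesis
    using that[of "\<lambda>x. f (cos_vec a I x)"] cos_vec_in_box by (auto simp: R_def)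
qed

lemma trig_poly_integrable:
  assumes "h \<in> trig_poly I" "prob_space M" "\<And>i. i \<in> I \<Longrightarrow> x i \<in> borel_measurable M"
  shows "integrable M (\<lambda>\<omega>. h (\<lambda>i. x i \<omega>))"
  using assms(1)
proof induction
  case (cos c t)
  interpret prob_space M by fact
  show ?case
    by (rule integrable_const_bound[where B="\<bar>c\<bar>"]) (use assms(3) in \<open>auto simp: abs_mult mult_left_le\<close>)
qed auto

lemma cos_vec_integrable:
  fixes I :: "'i::countable set" and F :: "('i \<Rightarrow> real) \<Rightarrow> real"
  assumes "finite I" "continuous_on (cos_box I) F"
    and "prob_space M" "\<And>i. i \<in> I \<Longrightarrow> x i \<in> borel_measurable M"
  shows "integrable M (\<lambda>\<omega>. F (cos_vec a I (\<lambda>i. x i \<omega>)))"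
proof -
  interpret prob_space M by fact
  have "\<exists>h. h \<in> trig_poly I \<and> (\<forall>x. \<bar>F (cos_vec a I x) - h x\<bar> < inverse (real (Suc k)))" for k
    using cos_vec_approximation[OF assms(1,2), of "inverse (real (Suc k))" a] by auto
  then obtain h where h: "\<And>k. h k \<in> trig_poly I"
    "\<And>k x. \<bar>F (cos_vec a I x) - h k x\<bar> < inverse (real (Suc k))"
    by metis
  have "(\<lambda>\<omega>. F (cos_vec a I (\<lambda>i. x i \<omega>))) \<in> borel_measurable M"
  proof (rule borel_measurable_LIMSEQ_metric)
    show "(\<lambda>\<omega>. h k (\<lambda>i. x i \<omega>)) \<in> borel_measurable M" for k
      using trig_poly_integrable[OF h(1)[of k] assms(3,4)] by auto
    fix \<omega>
    have "(\<lambda>k. h k (\<lambda>i. x i \<omega>) - F (cos_vec a I (\<lambda>i. x i \<omega>))) \<longlonglongrightarrow> 0"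
      by (rule Lim_null_comparison[OF _ LIMSEQ_inverse_real_of_nat])
        (use h(2) in \<open>auto simp: abs_minus_commute intro!: always_eventually less_imp_le\<close>)
    then show "(\<lambda>k. h k (\<lambda>i. x i \<omega>)) \<longlonglongrightarrow> F (cos_vec a I (\<lambda>i. x i \<omega>))"
      by (simp add: LIM_zero_iff)
  qed
  moreover have "bounded (F ` cos_box I)"
    using assms(2) compact_cos_box compact_continuous_image compact_imp_bounded by blast
  then obtain B where "\<And>x. x \<in> cos_box I \<Longrightarrow> norm (F x) \<le> B"
    by (auto simp: bounded_iff)
  ultimately show ?thesis
    by (intro integrable_const_bound[where B=B]) (auto intro: cos_vec_in_box)
qed

text \<open>
  Two sequences of random vectors whose characteristic functions are asymptotically equal cannot be
  told apart by continuous functions of the cosines: uniform approximation reduces these to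
  trigonometric polynomials, whose expectations are combinations of values of the characteristic function.
\<close>

lemma char_convergence_imp_cos_vec_convergence:
  fixes I :: "'i::countable set" and F :: "('i \<Rightarrow> real) \<Rightarrow> real"
  assumes "finite I"
    and M: "\<And>n. prob_space (M n)"
    and x: "\<And>n i. i \<in> I \<Longrightarrow> x n i \<in> borel_measurable (M n)"
    and y: "\<And>n i. i \<in> I \<Longrightarrow> y n i \<in> borel_measurable (M n)"
    and char: "\<And>t. (\<lambda>n. (\<integral>\<omega>. cos (\<Sum>i\<in>I. t i * x n i \<omega>) \<partial>M n)
                   - (\<integral>\<omega>. cos (\<Sum>i\<in>I. t i * y n i \<omega>) \<partial>M n)) \<longlonglongrightarrow> 0"
    and F: "continuous_on (cos_box I) F"
  shows "(\<lambda>n. (\<integral>\<omega>. F (cos_vec a I (\<lambda>i. x n i \<omega>)) \<partial>M n)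
            - (\<integral>\<omega>. F (cos_vec a I (\<lambda>i. y n i \<omega>)) \<partial>M n)) \<longlonglongrightarrow> 0"
proof (rule tendstoI)
  fix e :: real assume "0 < e"
  then obtain h where h: "h \<in> trig_poly I" "\<And>x. \<bar>F (cos_vec a I x) - h x\<bar> < e / 3"
    using cos_vec_approximation[OF assms(1) F, of "e / 3" a] by auto
  have "(\<lambda>n. (\<integral>\<omega>. h (\<lambda>i. x n i \<omega>) \<partial>M n) - (\<integral>\<omega>. h (\<lambda>i. y n i \<omega>) \<partial>M n)) \<longlonglongrightarrow> 0"
    using h(1)
  proof induction
    case (cos c t)
    show ?case
      using tendsto_mult_left[OF char[of t], of c] by (simp add: algebra_simps)
  next
    case (add f g)
    have "(\<integral>\<omega>. f (\<lambda>i. z n i \<omega>) + g (\<lambda>i. z n i \<omega>) \<partial>M n)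
        = (\<integral>\<omega>. f (\<lambda>i. z n i \<omega>) \<partial>M n) + (\<integral>\<omega>. g (\<lambda>i. z n i \<omega>) \<partial>M n)"
      if "\<And>i. i \<in> I \<Longrightarrow> z n i \<in> borel_measurable (M n)" for n z
      using that by (intro Bochner_Integration.integral_add trig_poly_integrable[where I=I] add M)
    from this[of x, OF x] this[of y, OF y] tendsto_add[OF add.IH] show ?case
      by (simp add: algebra_simps)
  qed
  then have "\<forall>\<^sub>F n in sequentially. \<bar>(\<integral>\<omega>. h (\<lambda>i. x n i \<omega>) \<partial>M n) - (\<integral>\<omega>. h (\<lambda>i. y n i \<omega>) \<partial>M n)\<bar> < e / 3"
    using tendstoD[where e="e / 3"] \<open>0 < e\<close> by (fastforce simp: dist_real_def)
  then show "\<forall>\<^sub>F n in sequentially. dist ((\<integral>\<omega>. F (cos_vec a I (\<lambda>i. x n i \<omega>)) \<partial>M n)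
            - (\<integral>\<omega>. F (cos_vec a I (\<lambda>i. y n i \<omega>)) \<partial>M n)) 0 < e"
  proof eventually_elim
    case (elim n)
    interpret prob_space "M n" by (rule M)
    have close: "\<bar>(\<integral>\<omega>. F (cos_vec a I (\<lambda>i. z i \<omega>)) \<partial>M n) - (\<integral>\<omega>. h (\<lambda>i. z i \<omega>) \<partial>M n)\<bar> \<le> e / 3"
      if z: "\<And>i. i \<in> I \<Longrightarrow> z i \<in> borel_measurable (M n)" for z
    proof -
      show ?thesis
      proof (subst Bochner_Integration.integral_diff[symmetric])
        show "\<bar>\<integral>\<omega>. F (cos_vec a I (\<lambda>i. z i \<omega>)) - h (\<lambda>i. z i \<omega>) \<partial>M n\<bar> \<le> e / 3"
        proof -
          have "\<bar>\<integral>\<omega>. F (cos_vec a I (\<lambda>i. z i \<omega>)) - h (\<lambda>i. z i \<omega>) \<partial>M n\<bar>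
              \<le> (\<integral>\<omega>. \<bar>F (cos_vec a I (\<lambda>i. z i \<omega>)) - h (\<lambda>i. z i \<omega>)\<bar> \<partial>M n)"
            by (rule integral_abs_bound)
          also have "\<dots> \<le> (\<integral>\<omega>. e / 3 \<partial>M n)"
            using h(2) by (intro integral_mono integrable_abs Bochner_Integration.integrable_diff
              cos_vec_integrable[OF assms(1) F M] trig_poly_integrable[OF h(1) M] z) (auto intro: less_imp_le)
          finally show ?thesis by (simp add: prob_space)
        qed
      qed (intro cos_vec_integrable[OF assms(1) F M] trig_poly_integrable[OF h(1) M] z; assumption)+
    qed
    from close[of "x n", OF x] close[of "y n", OF y] elim show ?case
      unfolding dist_real_def diff_0_right by linarith
  qed
qed

section \<open>Normal limits of one-dimensional variables\<close>

lemma std_normal_interval_le: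
  assumes "0 \<le> a"
  shows "measure std_normal_distribution {-a..a} \<le> 2 * a"
proof -
  have "emeasure std_normal_distribution {-a..a} = (\<integral>\<^sup>+x\<in>{-a..a}. ennreal (std_normal_density x) \<partial>lborel)"
    by (subst emeasure_density) auto
  also have "\<dots> \<le> (\<integral>\<^sup>+x. indicator {-a..a} x \<partial>lborel)"
  proof (intro nn_integral_mono)
    fix x :: real
    have "std_normal_density x \<le> 1"
    proof -
      have "1 \<le> sqrt (2 * pi)"
        using pi_ge_two by (intro real_le_rsqrt) simp
      then have "1 / sqrt (2 * pi) \<le> 1" by simp
      then show ?thesis
        unfolding std_normal_density_def by (intro mult_le_one) auto
    qed
    then show "ennreal (std_normal_density x) * indicator {-a..a} x \<le> indicator {-a..a} x"
      by (auto simp: indicator_def)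
  qed
  also have "\<dots> = ennreal (2 * a)"
    using assms by simp
  finally show ?thesis
    unfolding measure_def using assms by (intro enn2real_leI) auto
qed

lemma std_normal_interval_tendsto_1:
  "(\<lambda>K. measure std_normal_distribution {- real K..real K}) \<longlonglongrightarrow> 1"
proof -
  interpret real_distribution std_normal_distribution
    by (rule real_dist_normal_dist)
  have "(\<lambda>K. measure std_normal_distribution {- real K..real K})
      \<longlonglongrightarrow> measure std_normal_distribution (\<Union>K. {- real K..real K})"
    by (intro finite_Lim_measure_incseq) (auto simp: incseq_def)
  also have "(\<Union>K. {- real K..real K}) = UNIV"
  proof -
    have "\<exists>K. - real K \<le> x \<and> x \<le> real K" for x :: real
      using real_arch_simple[of "\<bar>x\<bar>"] by (smt (verit))
    then show ?thesis by auto
  qed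
  also have "measure std_normal_distribution UNIV = 1"
    using prob_space by simp
  finally show ?thesis .
qed

text \<open>
  Levy's continuity theorem, with the boundary of the interval being a null set of the normal
  distribution.
\<close>

lemma char_tendsto_normal_imp_interval:
  assumes M: "\<And>n. prob_space (M n)"
    and X [measurable]: "\<And>n. X n \<in> borel_measurable (M n)"
    and "0 < q"
    and char: "\<And>s. (\<lambda>n. \<integral>\<omega>. iexp (s * X n \<omega>) \<partial>M n) \<longlonglongrightarrow> complex_of_real (exp (- (s\<^sup>2 * q) / 2))"
  shows "(\<lambda>n. measure (M n) {\<omega> \<in> space (M n). \<bar>X n \<omega>\<bar> \<le> K})
           \<longlonglongrightarrow> measure std_normal_distribution {- K / sqrt q..K / sqrt q}"
proof -
  let ?D = "\<lambda>n. distr (M n) borel (\<lambda>\<omega>. X n \<omega> / sqrt q)"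
  let ?A = "{- K / sqrt q..K / sqrt q}"
  have D: "real_distribution (?D n)" for n
    by (rule prob_space.real_distribution_distr[OF M]) simp
  have "weak_conv_m ?D std_normal_distribution"
  proof (rule levy_continuity[OF D real_dist_normal_dist])
    fix t :: real
    have "Characteristic_Functions.char (?D n) t = (\<integral>\<omega>. iexp (t / sqrt q * X n \<omega>) \<partial>M n)" for n
      by (simp add: char_def integral_distr)
    moreover have "(t / sqrt q)\<^sup>2 * q = t\<^sup>2"
      using \<open>0 < q\<close> by (simp add: power_divide)
    ultimately show "(\<lambda>n. Characteristic_Functions.char (?D n) t)
        \<longlonglongrightarrow> Characteristic_Functions.char std_normal_distribution t"
      using char[of "t / sqrt q"] by (simp add: char_std_normal_distribution)
  qed
  moreover have "emeasure std_normal_distribution (frontier ?A) = 0"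
  proof -
    have "frontier ?A \<subseteq> {- K / sqrt q, K / sqrt q}"
      by (auto simp: frontier_def)
    then have "frontier ?A \<in> null_sets lborel"
      by (intro finite_imp_null_set_lborel) (auto intro: finite_subset)
    then have "AE x in lborel. x \<notin> frontier ?A"
      by (rule AE_not_in)
    then have "(\<integral>\<^sup>+x\<in>frontier ?A. ennreal (std_normal_density x) \<partial>lborel) = (\<integral>\<^sup>+x. 0 \<partial>(lborel :: real measure))"
      by (intro nn_integral_cong_AE) (auto elim!: eventually_mono)
    then show ?thesis
      by (subst emeasure_density) (auto intro: borel_closed frontier_closed)
  qed
  ultimately have "(\<lambda>n. measure (?D n) ?A) \<longlonglongrightarrow> measure std_normal_distribution ?A"
    by (intro weak_conv_imp_continuity_set_conv[OF D real_dist_normal_dist]) auto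
  moreover have "measure (?D n) ?A = measure (M n) {\<omega> \<in> space (M n). \<bar>X n \<omega>\<bar> \<le> K}" for n
  proof -
    have "measure (?D n) ?A = measure (M n) ((\<lambda>\<omega>. X n \<omega> / sqrt q) -` ?A \<inter> space (M n))"
      by (intro measure_distr) auto
    also have "(\<lambda>\<omega>. X n \<omega> / sqrt q) -` ?A \<inter> space (M n) = {\<omega> \<in> space (M n). \<bar>X n \<omega>\<bar> \<le> K}"
    proof -
      have "x / sqrt q \<in> ?A \<longleftrightarrow> \<bar>x\<bar> \<le> K" for x
        using \<open>0 < q\<close> by (simp only: atLeastAtMost_iff divide_le_cancel real_sqrt_gt_0_iff) auto
      then show ?thesis
        by (intro Set.set_eqI) (simp only: Int_iff vimage_eq mem_Collect_eq, blast)
    qed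
    finally show ?thesis .
  qed
  ultimately show ?thesis by simp
qed

section \<open>Matrices with asymptotically exchangeable rows\<close>

text \<open>
  Monotonicity in \<open>\<delta>\<close> lets finitely many events share one tolerance.
\<close>

lemma eventually_small_sum:
  fixes P :: "'i \<Rightarrow> real \<Rightarrow> nat \<Rightarrow> real"
  assumes "finite A"
    and mono: "\<And>i \<delta> \<delta>' n. i \<in> A \<Longrightarrow> 0 < \<delta> \<Longrightarrow> \<delta> \<le> \<delta>' \<Longrightarrow> P i \<delta> n \<le> P i \<delta>' n"
    and small: "\<And>i e. i \<in> A \<Longrightarrow> 0 < e \<Longrightarrow> \<exists>\<delta>>0. \<forall>\<^sub>F n in sequentially. P i \<delta> n < e"
    and "0 < e"
  shows "\<exists>\<delta>>0. \<forall>\<^sub>F n in sequentially. (\<Sum>i\<in>A. P i \<delta> n) < e"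
  using assms
proof (induction A arbitrary: e rule: finite_induct)
  case empty
  then show ?case by (auto intro: exI[of _ 1])
next
  case (insert i A)
  obtain \<delta>1 where \<delta>1: "0 < \<delta>1" "\<forall>\<^sub>F n in sequentially. P i \<delta>1 n < e / 2"
    using insert.prems(2)[of i "e / 2"] insert.prems(3) by auto
  have "\<exists>\<delta>>0. \<forall>\<^sub>F n in sequentially. (\<Sum>i\<in>A. P i \<delta> n) < e / 2"
    using insert.prems by (intro insert.IH) auto
  then obtain \<delta>2 where \<delta>2: "0 < \<delta>2" "\<forall>\<^sub>F n in sequentially. (\<Sum>i\<in>A. P i \<delta>2 n) < e / 2"
    by auto
  show ?case
  proof (intro exI conjI)
    show "0 < min \<delta>1 \<delta>2" using \<delta>1 \<delta>2 by simp
    show "\<forall>\<^sub>F n in sequentially. (\<Sum>i\<in>insert i A. P i (min \<delta>1 \<delta>2) n) < e"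
      using \<delta>1(2) \<delta>2(2)
    proof eventually_elim
      case (elim n)
      have "P i (min \<delta>1 \<delta>2) n \<le> P i \<delta>1 n"
        using \<delta>1 \<delta>2 by (intro insert.prems(1)) auto
      moreover have "(\<Sum>i\<in>A. P i (min \<delta>1 \<delta>2) n) \<le> (\<Sum>i\<in>A. P i \<delta>2 n)"
        using \<delta>1 \<delta>2 by (intro sum_mono insert.prems(1)) auto
      ultimately show ?case
        using elim insert.hyps by simp
    qed
  qed
qed

lemma Max_image_close:
  fixes f g :: "'i \<Rightarrow> real"
  assumes "finite N" "N \<noteq> {}" "\<And>l. l \<in> N \<Longrightarrow> \<bar>f l - g l\<bar> \<le> \<delta>"
  shows "\<bar>Max (f ` N) - Max (g ` N)\<bar> \<le> \<delta>"
proof -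
  have *: "Max (f ` N) \<le> Max (g ` N) + \<delta>"
    if "\<And>l. l \<in> N \<Longrightarrow> \<bar>f l - g l\<bar> \<le> \<delta>" for f g :: "'i \<Rightarrow> real"
  proof -
    have "f l \<le> Max (g ` N) + \<delta>" if "l \<in> N" for l
    proof -
      have "g l \<le> Max (g ` N)" using assms(1) that by simp
      then show ?thesis
        using \<open>\<And>l. l \<in> N \<Longrightarrow> \<bar>f l - g l\<bar> \<le> \<delta>\<close>[OF that] by linarith
    qed
    then show ?thesis using assms by (subst Max_le_iff) auto
  qed
  show ?thesis
    using *[of f g] *[of g f] assms(3) by (force simp: abs_le_iff abs_minus_commute)
qed

text \<open>
  The cosine with period \<open>2 K\<close> determines the absolute value on the box \<open>\<bar>x\<bar> \<le> K\<close>.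
\<close>

lemma arccos_cos_scaled:
  assumes "0 < K" "\<bar>x\<bar> \<le> K"
  shows "arccos (cos (pi / K * x)) / (pi / K) = \<bar>x\<bar>"
proof -
  have "cos (pi / K * x) = cos (pi / K * \<bar>x\<bar>)"
    by (cases "0 \<le> x") auto
  moreover have "pi / K * \<bar>x\<bar> \<le> pi"
    using assms by (simp add: field_simps)
  ultimately show ?thesis
    using assms by (simp add: arccos_cos)
qed

lemma integral_cos_eq_Re:
  assumes "prob_space M" and [measurable]: "X \<in> borel_measurable M"
  shows "(\<integral>\<omega>. cos (X \<omega>) \<partial>M) = Re (\<integral>\<omega>. iexp (X \<omega>) \<partial>M)"
proof -
  interpret prob_space M by fact
  have "integrable M (\<lambda>\<omega>. iexp (X \<omega>))"
    by (rule integrable_const_bound[where B=1]) auto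
  from integral_Re[OF this] show ?thesis
    by (simp add: Re_exp)
qed

lemma (in prob_space) expectation_indicator:
  assumes "A \<in> sets M"
  shows "integrable M (\<lambda>\<omega>. indicator A \<omega> :: real)"
    and "(\<integral>\<omega>. (indicator A \<omega> :: real) \<partial>M) = prob A"
  using assms by (auto simp: emeasure_eq_measure intro!: integrable_real_indicator)

lemma (in prob_space) expectation_sum_indicator:
  assumes "finite I" "\<And>i. i \<in> I \<Longrightarrow> A i \<in> sets M"
  shows "integrable M (\<lambda>\<omega>. \<Sum>i\<in>I. indicator (A i) \<omega> :: real)"
    and "(\<integral>\<omega>. (\<Sum>i\<in>I. indicator (A i) \<omega> :: real) \<partial>M) = (\<Sum>i\<in>I. prob (A i))"
proof -
  have int: "integrable M (indicator (A i) :: _ \<Rightarrow> real)" if "i \<in> I" for i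
    using assms(2)[OF that] by (intro integrable_real_indicator) (auto simp: emeasure_eq_measure)
  then show "integrable M (\<lambda>\<omega>. \<Sum>i\<in>I. indicator (A i) \<omega> :: real)"
    by (intro Bochner_Integration.integrable_sum)
  show "(\<integral>\<omega>. (\<Sum>i\<in>I. indicator (A i) \<omega> :: real) \<partial>M) = (\<Sum>i\<in>I. prob (A i))"
    using assms(2) int by (subst Bochner_Integration.integral_sum) (auto intro!: sum.cong)
qed

lemma sets_top_row_event:
  fixes S :: "nat \<Rightarrow> 'l \<Rightarrow> 'a \<Rightarrow> real"
  assumes "finite N" "0 < w" and meas: "\<And>k l. k < w \<Longrightarrow> l \<in> N \<Longrightarrow> S k l \<in> borel_measurable M"
  shows "{\<omega> \<in> space M. c \<le> card {k \<in> {..<w}. Max ((\<lambda>l. \<bar>S k l \<omega>\<bar>) ` N) < Max ((\<lambda>l. \<bar>S 0 l \<omega>\<bar>) ` N)}} \<in> sets M"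
proof -
  let ?T = "\<lambda>\<omega> k. Max ((\<lambda>l. \<bar>S k l \<omega>\<bar>) ` N)"
  have [measurable]: "(\<lambda>\<omega>. ?T \<omega> k) \<in> borel_measurable M" if "k < w" for k
    using meas[OF that] assms(1) by (intro borel_measurable_Max borel_measurable_abs) auto
  have "{\<omega> \<in> space M. c \<le> card {k \<in> {..<w}. ?T \<omega> k < ?T \<omega> 0}}
      = {\<omega> \<in> space M. real c \<le> (\<Sum>k<w. of_bool (?T \<omega> k < ?T \<omega> 0))}"
    by (simp add: of_bool_def sum.If_cases Int_def)
  moreover have "{\<omega> \<in> space M. real c \<le> (\<Sum>k<w. of_bool (?T \<omega> k < ?T \<omega> 0))} \<in> sets M"
    unfolding of_bool_def
    by (intro borel_measurable_le borel_measurable_sum measurable_If borel_measurable_const borel_measurable_pred_less)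
      (use assms(2) in auto)
  ultimately show ?thesis by (simp only:)
qed

text \<open>
  The quadratic form whose matrix is the Kronecker product of the \<open>w \<times> w\<close> identity with \<open>L\<close>: the
  variance of a linear form in a matrix that has uncorrelated rows with covariance matrix \<open>L\<close>.
\<close>

definition row_quad :: "nat \<Rightarrow> 'l set \<Rightarrow> ('l \<Rightarrow> 'l \<Rightarrow> real) \<Rightarrow> (nat \<Rightarrow> 'l \<Rightarrow> real) \<Rightarrow> real" where
  "row_quad w N L t = (\<Sum>j<w. \<Sum>l\<in>N. \<Sum>l'\<in>N. t j l * t j l' * L l l')"

text \<open>
  The limit of the characteristic functions is that of a Gaussian matrix with independent rows of
  the same law. Its invariance under permutations of the rows yields the level of the test, and
  \<open>L_pos\<close> makes the linear forms that express ties nondegenerate.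
\<close>

locale asymptotically_exchangeable_rows =
  fixes M :: "nat \<Rightarrow> 'a measure" and w :: nat and N :: "nat set"
    and S :: "nat \<Rightarrow> nat \<Rightarrow> nat \<Rightarrow> 'a \<Rightarrow> real" and L :: "nat \<Rightarrow> nat \<Rightarrow> real"
  assumes prob: "\<And>n. prob_space (M n)"
    and finite_N: "finite N" and N_nonempty: "N \<noteq> {}" and w_pos: "0 < w"
    and meas: "\<And>n j l. j < w \<Longrightarrow> l \<in> N \<Longrightarrow> S n j l \<in> borel_measurable (M n)"
    and L_pos: "\<And>l. l \<in> N \<Longrightarrow> 0 < L l l"
    and char_limit: "\<And>t. (\<lambda>n. \<integral>\<omega>. iexp (\<Sum>j<w. \<Sum>l\<in>N. t j l * S n j l \<omega>) \<partial>M n)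
                       \<longlonglongrightarrow> complex_of_real (exp (- row_quad w N L t / 2))"
begin

lemma linear_form_interval:
  assumes "0 < row_quad w N L t"
  shows "(\<lambda>n. measure (M n) {\<omega> \<in> space (M n). \<bar>\<Sum>j<w. \<Sum>l\<in>N. t j l * S n j l \<omega>\<bar> \<le> K})
    \<longlonglongrightarrow> measure std_normal_distribution {- K / sqrt (row_quad w N L t)..K / sqrt (row_quad w N L t)}"
proof (rule char_tendsto_normal_imp_interval[OF prob _ assms])
  show "(\<lambda>\<omega>. \<Sum>j<w. \<Sum>l\<in>N. t j l * S n j l \<omega>) \<in> borel_measurable (M n)" for n
    using meas by (intro borel_measurable_sum borel_measurable_times) auto
  fix s :: real
  have "row_quad w N L (\<lambda>j l. s * t j l) = s\<^sup>2 * row_quad w N L t"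
    by (simp add: row_quad_def sum_distrib_left power2_eq_square mult_ac)
  then show "(\<lambda>n. \<integral>\<omega>. iexp (s * (\<Sum>j<w. \<Sum>l\<in>N. t j l * S n j l \<omega>)) \<partial>M n)
      \<longlonglongrightarrow> complex_of_real (exp (- (s\<^sup>2 * row_quad w N L t) / 2))"
    using char_limit[of "\<lambda>j l. s * t j l"] by (simp only: sum_distrib_left mult.assoc)
qed

lemma sum_single:
  assumes "j < w" "l \<in> N"
  shows "(\<Sum>j'<w. \<Sum>l'\<in>N. (if j' = j \<and> l' = l then a else 0) * x j' l') = (a * x j l :: real)"
proof -
  have "(\<Sum>l'\<in>N. (if j' = j \<and> l' = l then a else 0) * x j' l') = (if j' = j then a * x j l else 0)" for j'
    using assms finite_N by (cases "j' = j") (auto simp: if_distrib[of "\<lambda>z. z * _"] cong: if_cong)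
  then show ?thesis using assms by simp
qed

lemma entry_tight:
  assumes "j < w" "l \<in> N" "0 < e"
  shows "\<exists>\<delta>>0. \<forall>\<^sub>F n in sequentially. measure (M n) {\<omega> \<in> space (M n). \<bar>S n j l \<omega>\<bar> > 1 / \<delta>} < e"
proof -
  let ?t = "\<lambda>j' l'. if j' = j \<and> l' = l then 1 else 0 :: real"
  have q: "row_quad w N L ?t = L l l"
  proof -
    have "(\<Sum>l'\<in>N. ?t j' l'' * ?t j' l' * L l'' l') = ?t j' l'' * L l'' l" for j' l''
      using assms finite_N by (auto simp: if_distrib[of "\<lambda>z. z * _"] cong: if_cong)
    then show ?thesis
      using sum_single[OF assms(1,2), of 1 "\<lambda>j' l'. L l' l"] by (simp add: row_quad_def)
  qed
  have s: "(\<Sum>j'<w. \<Sum>l'\<in>N. ?t j' l' * S n j' l' \<omega>) = S n j l \<omega>" for n \<omega>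
    using sum_single[OF assms(1,2), of 1 "\<lambda>j' l'. S n j' l' \<omega>"] by simp
  have "\<forall>\<^sub>F K in sequentially. measure std_normal_distribution {- real K..real K} > 1 - e"
    by (rule order_tendstoD(1)[OF std_normal_interval_tendsto_1]) (use assms in simp)
  then obtain K :: nat where K: "K > 0" "measure std_normal_distribution {- real K..real K} > 1 - e"
    by (metis (mono_tags, lifting) eventually_sequentially eventually_gt_at_top eventually_conj eventually_happens trivial_limit_sequentially)
  let ?\<delta> = "1 / (real K * sqrt (L l l))"
  have Lp: "0 < L l l" using L_pos assms by simp
  have "(\<lambda>n. measure (M n) {\<omega> \<in> space (M n). \<bar>S n j l \<omega>\<bar> \<le> 1 / ?\<delta>})
      \<longlonglongrightarrow> measure std_normal_distribution {- real K..real K}"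
    using linear_form_interval[of ?t "real K * sqrt (L l l)"] Lp unfolding q s by simp
  then have "\<forall>\<^sub>F n in sequentially. measure (M n) {\<omega> \<in> space (M n). \<bar>S n j l \<omega>\<bar> \<le> 1 / ?\<delta>} > 1 - e"
    using K(2) by (rule order_tendstoD(1))
  then have "\<forall>\<^sub>F n in sequentially. measure (M n) {\<omega> \<in> space (M n). \<bar>S n j l \<omega>\<bar> > 1 / ?\<delta>} < e"
  proof eventually_elim
    case (elim n)
    interpret prob_space "M n" by (rule prob)
    have [measurable]: "S n j l \<in> borel_measurable (M n)" using meas assms by simp
    have "prob {\<omega> \<in> space (M n). \<bar>S n j l \<omega>\<bar> > 1 / ?\<delta>} = 1 - prob {\<omega> \<in> space (M n). \<bar>S n j l \<omega>\<bar> \<le> 1 / ?\<delta>}"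
      by (subst prob_compl[symmetric]) (auto intro!: arg_cong[where f=prob])
    with elim show ?case by simp
  qed
  moreover have "0 < ?\<delta>" using K Lp by simp
  ultimately show ?thesis by blast
qed

text \<open>
  A near tie of two absolute values makes the sum or the difference of the entries small. Both have
  limiting variance \<open>L l l + L l' l' > 0\<close>, because the entries lie in different rows, and the
  normal density is at most \<open>1\<close>.
\<close>

lemma pair_no_ties:
  assumes "k < w" "0 < k" "l \<in> N" "l' \<in> N" "0 < e"
  shows "\<exists>\<delta>>0. \<forall>\<^sub>F n in sequentially.
    measure (M n) {\<omega> \<in> space (M n). \<bar>\<bar>S n 0 l \<omega>\<bar> - \<bar>S n k l' \<omega>\<bar>\<bar> \<le> 3 * \<delta>} < e"
proof -
  let ?q = "L l l + L l' l'"
  have qp: "0 < ?q" using L_pos assms by (simp add: add_pos_pos)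
  \<comment> \<open>the limiting probability for the sum and for the difference is at most
    \<open>2 * (3 * \<delta> / sqrt ?q) = e / 3 < e / 2\<close>\<close>
  define \<delta> where "\<delta> = e * sqrt ?q / 18"
  have \<delta>: "0 < \<delta>" using qp assms by (simp add: \<delta>_def)
  let ?D = "\<lambda>a n. {\<omega> \<in> space (M n). \<bar>S n 0 l \<omega> + a * S n k l' \<omega>\<bar> \<le> 3 * \<delta>}"
  have ev: "\<forall>\<^sub>F n in sequentially. measure (M n) (?D a n) < e / 2" if a: "a = 1 \<or> a = -1" for a :: real
  proof -
    let ?t = "\<lambda>i p. (if i = 0 \<and> p = l then 1 else 0) + (if i = k \<and> p = l' then a else 0)"
    have s: "(\<Sum>j<w. \<Sum>p\<in>N. ?t j p * x j p) = x 0 l + a * x k l'" for x :: "nat \<Rightarrow> nat \<Rightarrow> real"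
      using sum_single[of 0 l 1 x] sum_single[of k l' a x] assms w_pos
      by (simp add: distrib_right sum.distrib)
    have q: "row_quad w N L ?t = ?q"
    proof -
      have "row_quad w N L ?t = (\<Sum>j<w. \<Sum>p\<in>N. ?t j p * (\<Sum>p'\<in>N. ?t j p' * L p p'))"
        by (simp add: row_quad_def sum_distrib_left mult.assoc)
      also have "\<dots> = (\<Sum>p'\<in>N. ?t 0 p' * L l p') + a * (\<Sum>p'\<in>N. ?t k p' * L l' p')"
        by (rule s)
      also have "(\<Sum>p'\<in>N. ?t 0 p' * L l p') = L l l"
        using assms finite_N by (simp add: if_distrib[of "\<lambda>z. z * _"] cong: if_cong)
      also have "(\<Sum>p'\<in>N. ?t k p' * L l' p') = a * L l' l'"
        using assms finite_N by (simp add: if_distrib[of "\<lambda>z. z * _"] cong: if_cong)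
      finally show ?thesis using a by auto
    qed
    have "(\<lambda>n. measure (M n) (?D a n))
        \<longlonglongrightarrow> measure std_normal_distribution {- (3 * \<delta>) / sqrt ?q..(3 * \<delta>) / sqrt ?q}"
      using linear_form_interval[of ?t "3 * \<delta>"] qp unfolding q s by simp
    moreover have "measure std_normal_distribution {- (3 * \<delta>) / sqrt ?q..(3 * \<delta>) / sqrt ?q} < e / 2"
    proof -
      have "measure std_normal_distribution {- ((3 * \<delta>) / sqrt ?q)..(3 * \<delta>) / sqrt ?q} \<le> 2 * ((3 * \<delta>) / sqrt ?q)"
        using \<delta> qp by (intro std_normal_interval_le) simp
      also have "\<dots> = e / 3" using qp by (simp add: \<delta>_def)
      finally show ?thesis using assms by simp
    qed
    ultimately show ?thesis by (rule order_tendstoD(2))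
  qed
  have "\<forall>\<^sub>F n in sequentially.
      measure (M n) {\<omega> \<in> space (M n). \<bar>\<bar>S n 0 l \<omega>\<bar> - \<bar>S n k l' \<omega>\<bar>\<bar> \<le> 3 * \<delta>} < e"
    using ev[of 1, simplified] ev[of "-1", simplified]
  proof eventually_elim
    case (elim n)
    interpret prob_space "M n" by (rule prob)
    have [measurable]: "S n 0 l \<in> borel_measurable (M n)" "S n k l' \<in> borel_measurable (M n)"
      using meas assms w_pos by auto
    have "prob {\<omega> \<in> space (M n). \<bar>\<bar>S n 0 l \<omega>\<bar> - \<bar>S n k l' \<omega>\<bar>\<bar> \<le> 3 * \<delta>} \<le>
      prob ({\<omega> \<in> space (M n). \<bar>S n 0 l \<omega> + S n k l' \<omega>\<bar> \<le> 3 * \<delta>} \<union> {\<omega> \<in> space (M n). \<bar>S n 0 l \<omega> - S n k l' \<omega>\<bar> \<le> 3 * \<delta>})"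
      by (intro finite_measure_mono) auto
    also have "\<dots> \<le> prob {\<omega> \<in> space (M n). \<bar>S n 0 l \<omega> + S n k l' \<omega>\<bar> \<le> 3 * \<delta>} + prob {\<omega> \<in> space (M n). \<bar>S n 0 l \<omega> - S n k l' \<omega>\<bar> \<le> 3 * \<delta>}"
      by (intro measure_Un_le) auto
    finally show ?case using elim by linarith
  qed
  with \<delta> show ?thesis by blast
qed

text \<open>
  The row maximum of \<open>\<bar>x\<bar>\<close>, expressed through \<open>u = cos (\<pi> x / K)\<close>; the two agree as long as the
  row stays in the box.
\<close>

definition folded_max :: "real \<Rightarrow> (nat \<times> nat \<Rightarrow> real) \<Rightarrow> nat \<Rightarrow> real" where
  "folded_max K u k = Max ((\<lambda>l. arccos (u (k, l)) / (pi / K)) ` N)"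

definition soft_reject :: "real \<Rightarrow> real \<Rightarrow> nat \<Rightarrow> nat \<Rightarrow> (nat \<times> nat \<Rightarrow> real) \<Rightarrow> real" where
  "soft_reject K \<delta> c j u = soft_top \<delta> w c (folded_max K u) j"

abbreviation entries :: "nat \<Rightarrow> 'a \<Rightarrow> nat \<times> nat \<Rightarrow> real" where
  "entries n \<omega> \<equiv> \<lambda>p. S n (fst p) (snd p) \<omega>"

abbreviation idx :: "(nat \<times> nat) set" where
  "idx \<equiv> {..<w} \<times> N"

lemma continuous_soft_reject:
  assumes "0 < K" "0 < \<delta>" "j < w"
  shows "continuous_on (cos_box idx) (soft_reject K \<delta> c j)"
  unfolding soft_reject_def folded_max_def
proof (intro continuous_on_soft_top continuous_on_Max finite_N N_nonempty assms)
  fix k l assume kl: "k < w" "l \<in> N"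
  show "continuous_on (cos_box idx) (\<lambda>u. arccos (u (k, l)) / (pi / K))"
  proof (intro continuous_intros)
    show "continuous_on (cos_box idx) (\<lambda>u. u (k, l))"
      by (rule continuous_on_subset[OF continuous_on_product_coordinates]) simp
    have "u (k, l) \<in> {-1..1}" if "u \<in> cos_box idx" for u
      using PiE_mem[OF that[unfolded cos_box_def], of "(k, l)"] kl by simp
    then show "\<forall>u\<in>cos_box idx. - 1 \<le> u (k, l) \<and> u (k, l) \<le> 1" by simp
  qed (use assms in auto)
qed

text \<open>
  Swapping rows \<open>0\<close> and \<open>j\<close> leaves the limiting characteristic function unchanged and turns the
  test function of row \<open>0\<close> into that of row \<open>j\<close>.
\<close>

lemma soft_reject_exchangeable:
  assumes "0 < K" "0 < \<delta>" "j < w"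
  shows "(\<lambda>n. (\<integral>\<omega>. soft_reject K \<delta> c 0 (cos_vec (pi / K) idx (entries n \<omega>)) \<partial>M n)
            - (\<integral>\<omega>. soft_reject K \<delta> c j (cos_vec (pi / K) idx (entries n \<omega>)) \<partial>M n)) \<longlonglongrightarrow> 0"
proof -
  define \<tau> where "\<tau> k = (if k = 0 then j else if k = j then 0 else k)" for k
  have bij: "bij_betw \<tau> {..<w} {..<w}"
    by (rule bij_betw_byWitness[where f'=\<tau>]) (use assms w_pos in \<open>auto simp: \<tau>_def\<close>)
  have \<tau>_inv: "\<tau> (\<tau> k) = k" for k by (simp add: \<tau>_def)
  have \<tau>_less: "\<tau> k < w \<longleftrightarrow> k < w" for k using assms w_pos by (auto simp: \<tau>_def)
  let ?y = "\<lambda>n p \<omega>. S n (\<tau> (fst p)) (snd p) \<omega>"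
  have dbl: "(\<Sum>p\<in>idx. t p * S n (fst p) (snd p) \<omega>) = (\<Sum>j<w. \<Sum>l\<in>N. t (j, l) * S n j l \<omega>)" for t n \<omega>
    by (simp add: sum.cartesian_product split_beta)
  have dbly: "(\<Sum>p\<in>idx. t p * ?y n p \<omega>) = (\<Sum>j<w. \<Sum>l\<in>N. t (\<tau> j, l) * S n j l \<omega>)" for t n \<omega>
    using sum.reindex_bij_betw[OF bij, of "\<lambda>j. \<Sum>l\<in>N. t (\<tau> j, l) * S n j l \<omega>"]
    by (simp add: sum.cartesian_product split_beta \<tau>_inv)
  have quad: "row_quad w N L (\<lambda>j l. t (\<tau> j, l)) = row_quad w N L (\<lambda>j l. t (j, l))" for t
    unfolding row_quad_def
    using sum.reindex_bij_betw[OF bij, of "\<lambda>j. \<Sum>l\<in>N. \<Sum>l'\<in>N. t (j, l) * t (j, l') * L l l'"] .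
  have re: "(\<lambda>n. \<integral>\<omega>. cos (\<Sum>j<w. \<Sum>l\<in>N. t j l * S n j l \<omega>) \<partial>M n) \<longlonglongrightarrow> exp (- row_quad w N L t / 2)" for t
  proof -
    have "(\<integral>\<omega>. cos (\<Sum>j<w. \<Sum>l\<in>N. t j l * S n j l \<omega>) \<partial>M n) = Re (\<integral>\<omega>. iexp (\<Sum>j<w. \<Sum>l\<in>N. t j l * S n j l \<omega>) \<partial>M n)" for n
      by (rule integral_cos_eq_Re[OF prob])
        (use meas in \<open>auto intro!: borel_measurable_sum borel_measurable_times\<close>)
    then show ?thesis
      using tendsto_Re[OF char_limit[of t]] by (simp del: of_real_exp)
  qed
  have "(\<lambda>n. (\<integral>\<omega>. soft_reject K \<delta> c 0 (cos_vec (pi / K) idx (\<lambda>p. S n (fst p) (snd p) \<omega>)) \<partial>M n)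
            - (\<integral>\<omega>. soft_reject K \<delta> c 0 (cos_vec (pi / K) idx (\<lambda>p. ?y n p \<omega>)) \<partial>M n)) \<longlonglongrightarrow> 0"
  proof (rule char_convergence_imp_cos_vec_convergence[where x="\<lambda>n p. S n (fst p) (snd p)" and y="?y", OF _ prob])
    show "finite idx" using finite_N by simp
    show "continuous_on (cos_box idx) (soft_reject K \<delta> c 0)"
      using assms w_pos by (intro continuous_soft_reject)
    fix t :: "nat \<times> nat \<Rightarrow> real"
    show "(\<lambda>n. (\<integral>\<omega>. cos (\<Sum>i\<in>idx. t i * S n (fst i) (snd i) \<omega>) \<partial>M n) - (\<integral>\<omega>. cos (\<Sum>i\<in>idx. t i * ?y n i \<omega>) \<partial>M n)) \<longlonglongrightarrow> 0"
      using tendsto_diff[OF re[of "\<lambda>j l. t (j, l)"] re[of "\<lambda>j l. t (\<tau> j, l)"]]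
      unfolding dbl dbly quad by simp
  qed (auto simp: meas \<tau>_less)
  moreover have "soft_reject K \<delta> c 0 (cos_vec (pi / K) idx (\<lambda>p. ?y n p \<omega>))
      = soft_reject K \<delta> c j (cos_vec (pi / K) idx (entries n \<omega>))" for n \<omega>
  proof -
    have "folded_max K (cos_vec (pi / K) idx (\<lambda>p. ?y n p \<omega>))
        = (\<lambda>k. folded_max K (cos_vec (pi / K) idx (entries n \<omega>)) (\<tau> k))"
      unfolding folded_max_def
      by (intro ext arg_cong[where f=Max] image_cong) (auto simp: cos_vec_def \<tau>_less)
    then show ?thesis
      unfolding soft_reject_def by (simp add: soft_top_permute[OF bij]) (simp add: \<tau>_def)
  qed
  ultimately show ?thesis by simp
qed

lemma soft_reject_integrable:
  assumes "0 < K" "0 < \<delta>" "j < w"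
  shows "integrable (M n) (\<lambda>\<omega>. soft_reject K \<delta> c j (cos_vec (pi / K) idx (entries n \<omega>)))"
  by (rule cos_vec_integrable[where x="\<lambda>p. S n (fst p) (snd p)", OF _ continuous_soft_reject[OF assms] prob])
    (use finite_N meas in auto)

text \<open>
  Averaging the test functions over all rows turns the deterministic counting bound into a bound for
  the expectation of the first one.
\<close>

lemma soft_reject_level:
  assumes "0 < K" "0 < \<delta>" "0 < e"
  shows "\<forall>\<^sub>F n in sequentially.
    (\<integral>\<omega>. soft_reject K \<delta> c 0 (cos_vec (pi / K) idx (entries n \<omega>)) \<partial>M n) < real (w - c) / real w + e"
proof -
  let ?E = "\<lambda>j n. \<integral>\<omega>. soft_reject K \<delta> c j (cos_vec (pi / K) idx (entries n \<omega>)) \<partial>M n"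
  have "(\<lambda>n. \<Sum>j<w. ?E 0 n - ?E j n) \<longlonglongrightarrow> (\<Sum>j<w. 0)"
    using soft_reject_exchangeable[OF assms(1,2)] by (intro tendsto_sum) auto
  then have "\<forall>\<^sub>F n in sequentially. (\<Sum>j<w. ?E 0 n - ?E j n) < real w * e"
    using w_pos assms by (intro order_tendstoD(2)) auto
  then show ?thesis
  proof eventually_elim
    case (elim n)
    interpret prob_space "M n" by (rule prob)
    have "(\<Sum>j<w. ?E j n) = (\<integral>\<omega>. (\<Sum>j<w. soft_reject K \<delta> c j (cos_vec (pi / K) idx (entries n \<omega>))) \<partial>M n)"
      using soft_reject_integrable[OF assms(1,2)] by (intro Bochner_Integration.integral_sum[symmetric]) auto
    also have "\<dots> \<le> (\<integral>\<omega>. real (w - c) \<partial>M n)"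
      using soft_reject_integrable[OF assms(1,2)] sum_soft_top[OF assms(2)]
      by (intro integral_mono Bochner_Integration.integrable_sum) (auto simp: soft_reject_def)
    also have "\<dots> = real (w - c)" by (simp add: prob_space)
    finally have "real w * ?E 0 n < real (w - c) + real w * e"
      using elim by (simp add: sum_subtractf)
    then show ?case
      using w_pos by (simp add: field_simps)
  qed
qed

text \<open>
  The event can occur while the soft test function is below \<open>1\<close> only if an entry leaves the box, if a
  row nearly ties with the first one, or if the perturbation from \<open>S\<close> to \<open>S'\<close> is large. The tolerance for ties
  is \<open>3 \<delta>\<close>: a perturbation of at most \<open>\<delta>\<close> changes the difference of two maxima by at most
  \<open>2 \<delta>\<close>, so a strict inequality between perturbed maxima becomes one by at least \<open>\<delta>\<close> between
  the original ones when near ties are excluded.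
\<close>

theorem top_row_probability:
  assumes meas': "\<And>n j l. j < w \<Longrightarrow> l \<in> N \<Longrightarrow> S' n j l \<in> borel_measurable (M n)"
    and close: "\<And>j l \<epsilon>. j < w \<Longrightarrow> l \<in> N \<Longrightarrow> 0 < \<epsilon> \<Longrightarrow>
      (\<lambda>n. measure (M n) {\<omega> \<in> space (M n). \<bar>S' n j l \<omega> - S n j l \<omega>\<bar> > \<epsilon>}) \<longlonglongrightarrow> 0"
    and "0 < e"
  shows "\<forall>\<^sub>F n in sequentially. measure (M n) {\<omega> \<in> space (M n).
      c \<le> card {k \<in> {..<w}. Max ((\<lambda>l. \<bar>S' n k l \<omega>\<bar>) ` N) < Max ((\<lambda>l. \<bar>S' n 0 l \<omega>\<bar>) ` N)}}
    \<le> real (w - c) / real w + e"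
proof -
  \<comment> \<open>\<open>1 / \<delta>\<close> instead of \<open>K\<close> makes the event shrink with \<open>\<delta>\<close>, like the ties\<close>
  let ?big = "\<lambda>p \<delta> n. {\<omega> \<in> space (M n). \<bar>S n (fst p) (snd p) \<omega>\<bar> > 1 / \<delta>}"
  let ?tie = "\<lambda>(k, l, l') \<delta> n. {\<omega> \<in> space (M n). \<bar>\<bar>S n 0 l \<omega>\<bar> - \<bar>S n k l' \<omega>\<bar>\<bar> \<le> 3 * \<delta>}"
  let ?far = "\<lambda>p \<delta> n. {\<omega> \<in> space (M n). \<bar>S' n (fst p) (snd p) \<omega> - S n (fst p) (snd p) \<omega>\<bar> > \<delta>}"
  let ?J = "{0<..<w} \<times> N \<times> N"
  have sets: "?big p \<delta> n \<in> sets (M n)" "?far p \<delta> n \<in> sets (M n)" if "p \<in> idx" for p \<delta> n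
  proof -
    have [measurable]: "S n (fst p) (snd p) \<in> borel_measurable (M n)" "S' n (fst p) (snd p) \<in> borel_measurable (M n)"
      using that meas meas' by auto
    show "?big p \<delta> n \<in> sets (M n)" "?far p \<delta> n \<in> sets (M n)" by measurable
  qed
  have sets_tie: "?tie q \<delta> n \<in> sets (M n)" if qJ: "q \<in> ?J" for q \<delta> n
  proof -
    obtain k l l' where q: "q = (k, l, l')" "k < w" "l \<in> N" "l' \<in> N" using qJ by (cases q) auto
    then have [measurable]: "S n 0 l \<in> borel_measurable (M n)" "S n k l' \<in> borel_measurable (M n)"
      using meas w_pos by auto
    show ?thesis unfolding q(1) prod.case by measurable
  qed
  have "\<exists>\<delta>>0. \<forall>\<^sub>F n in sequentially. (\<Sum>p\<in>idx. measure (M n) (?big p \<delta> n)) < e / 4"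
  proof (rule eventually_small_sum)
    fix p :: "nat \<times> nat" and \<delta> \<delta>' :: real and n
    assume a: "p \<in> idx" "0 < \<delta>" "\<delta> \<le> \<delta>'"
    interpret prob_space "M n" by (rule prob)
    have "1 / \<delta>' \<le> 1 / \<delta>" using a by (intro divide_left_mono) auto
    then show "prob (?big p \<delta> n) \<le> prob (?big p \<delta>' n)"
      using sets a by (intro finite_measure_mono) auto
  qed (use finite_N entry_tight \<open>0 < e\<close> in auto)
  then obtain \<delta>0 where \<delta>0: "0 < \<delta>0" "\<forall>\<^sub>F n in sequentially. (\<Sum>p\<in>idx. measure (M n) (?big p \<delta>0 n)) < e / 4"
    by auto
  have "\<exists>\<delta>>0. \<forall>\<^sub>F n in sequentially. (\<Sum>q\<in>?J. measure (M n) (?tie q \<delta> n)) < e / 4"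
  proof (rule eventually_small_sum)
    fix q :: "nat \<times> nat \<times> nat" and \<delta> \<delta>' :: real and n
    assume a: "q \<in> ?J" "0 < \<delta>" "\<delta> \<le> \<delta>'"
    interpret prob_space "M n" by (rule prob)
    show "prob (?tie q \<delta> n) \<le> prob (?tie q \<delta>' n)"
      using sets_tie[OF a(1)] a by (intro finite_measure_mono) auto
  qed (use finite_N pair_no_ties \<open>0 < e\<close> in auto)
  then obtain \<delta> where \<delta>: "0 < \<delta>" "\<forall>\<^sub>F n in sequentially. (\<Sum>q\<in>?J. measure (M n) (?tie q \<delta> n)) < e / 4"
    by auto
  have "(\<lambda>n. \<Sum>p\<in>idx. measure (M n) (?far p \<delta> n)) \<longlonglongrightarrow> (\<Sum>p\<in>idx. 0)"
    using close \<delta>(1) by (intro tendsto_sum) auto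
  then have far: "\<forall>\<^sub>F n in sequentially. (\<Sum>p\<in>idx. measure (M n) (?far p \<delta> n)) < e / 4"
    using \<open>0 < e\<close> by (intro order_tendstoD(2)) auto
  define K where "K = 1 / \<delta>0"
  have K: "0 < K" using \<delta>0 by (simp add: K_def)
  have "\<forall>\<^sub>F n in sequentially.
      (\<integral>\<omega>. soft_reject K \<delta> c 0 (cos_vec (pi / K) idx (entries n \<omega>)) \<partial>M n) < real (w - c) / real w + e / 4"
    using K \<delta> \<open>0 < e\<close> by (intro soft_reject_level) auto
  then show ?thesis
    using \<delta>0(2) \<delta>(2) far
  proof eventually_elim
    case (elim n)
    interpret prob_space "M n" by (rule prob)
    let ?T' = "\<lambda>\<omega> k. Max ((\<lambda>l. \<bar>S' n k l \<omega>\<bar>) ` N)"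
    let ?T = "\<lambda>\<omega> k. Max ((\<lambda>l. \<bar>S n k l \<omega>\<bar>) ` N)"
    let ?ev = "{\<omega> \<in> space (M n). c \<le> card {k \<in> {..<w}. ?T' \<omega> k < ?T' \<omega> 0}}"
    let ?soft = "\<lambda>\<omega>. soft_reject K \<delta> c 0 (cos_vec (pi / K) idx (entries n \<omega>))"
    let ?ub = "\<lambda>\<omega>. (\<Sum>p\<in>idx. indicator (?big p \<delta>0 n) \<omega>) + (\<Sum>q\<in>?J. indicator (?tie q \<delta> n) \<omega>)
      + (\<Sum>p\<in>idx. indicator (?far p \<delta> n) \<omega>) + ?soft \<omega>"
    have soft_nonneg: "0 \<le> ?soft \<omega>" for \<omega>
      by (simp add: soft_reject_def soft_top_bounds)
    have bound: "indicator ?ev \<omega> \<le> ?ub \<omega>" for \<omega>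
    proof (cases "\<omega> \<in> ?ev \<and> (\<forall>p\<in>idx. \<omega> \<notin> ?big p \<delta>0 n \<and> \<omega> \<notin> ?far p \<delta> n) \<and> (\<forall>q\<in>?J. \<omega> \<notin> ?tie q \<delta> n)")
      case False
      consider "\<omega> \<notin> ?ev" | p where "p \<in> idx" "\<omega> \<in> ?big p \<delta>0 n" | p where "p \<in> idx" "\<omega> \<in> ?far p \<delta> n"
        | q where "q \<in> ?J" "\<omega> \<in> ?tie q \<delta> n"
        using False by blast
      then show ?thesis
      proof cases
        case 1
        then have "indicator ?ev \<omega> = (0::real)" by (rule indicator_simps(2))
        then show ?thesis using soft_nonneg by (simp add: sum_nonneg add_nonneg_nonneg)
      next
        case (2 p)
        have "1 \<le> (\<Sum>p\<in>idx. indicator (?big p \<delta>0 n) \<omega> :: real)"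
          using 2 finite_N member_le_sum[of p idx "\<lambda>p. indicator (?big p \<delta>0 n) \<omega> :: real"] by simp
        moreover have "indicator ?ev \<omega> \<le> (1::real)" by (simp add: indicator_def)
        moreover have "0 \<le> (\<Sum>q\<in>?J. indicator (?tie q \<delta> n) \<omega> :: real)" "0 \<le> (\<Sum>p\<in>idx. indicator (?far p \<delta> n) \<omega> :: real)"
          by (auto intro!: sum_nonneg)
        ultimately show ?thesis using soft_nonneg[of \<omega>] by linarith
      next
        case (3 p)
        have "1 \<le> (\<Sum>p\<in>idx. indicator (?far p \<delta> n) \<omega> :: real)"
          using 3 finite_N member_le_sum[of p idx "\<lambda>p. indicator (?far p \<delta> n) \<omega> :: real"] by simp
        moreover have "indicator ?ev \<omega> \<le> (1::real)" by (simp add: indicator_def)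
        moreover have "0 \<le> (\<Sum>q\<in>?J. indicator (?tie q \<delta> n) \<omega> :: real)" "0 \<le> (\<Sum>p\<in>idx. indicator (?big p \<delta>0 n) \<omega> :: real)"
          by (auto intro!: sum_nonneg)
        ultimately show ?thesis using soft_nonneg[of \<omega>] by linarith
      next
        case (4 q)
        have "indicator (?tie q \<delta> n) \<omega> = (1::real)"
          using 4(2) by (rule indicator_simps(1))
        then have "1 \<le> (\<Sum>q\<in>?J. indicator (?tie q \<delta> n) \<omega> :: real)"
          using 4(1) finite_N member_le_sum[of q ?J "\<lambda>q. indicator (?tie q \<delta> n) \<omega> :: real"] by simp
        moreover have "indicator ?ev \<omega> \<le> (1::real)" by (simp add: indicator_def)
        moreover have "0 \<le> (\<Sum>p\<in>idx. indicator (?far p \<delta> n) \<omega> :: real)" "0 \<le> (\<Sum>p\<in>idx. indicator (?big p \<delta>0 n) \<omega> :: real)"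
          by (auto intro!: sum_nonneg)
        ultimately show ?thesis using soft_nonneg[of \<omega>] by linarith
      qed
    next
      case True
      then have \<omega>: "\<omega> \<in> space (M n)" and cnt: "c \<le> card {k \<in> {..<w}. ?T' \<omega> k < ?T' \<omega> 0}"
        and big: "\<And>k l. k < w \<Longrightarrow> l \<in> N \<Longrightarrow> \<bar>S n k l \<omega>\<bar> \<le> K"
        and near: "\<And>k l. k < w \<Longrightarrow> l \<in> N \<Longrightarrow> \<bar>S' n k l \<omega> - S n k l \<omega>\<bar> \<le> \<delta>"
        and notie: "\<And>k l l'. 0 < k \<Longrightarrow> k < w \<Longrightarrow> l \<in> N \<Longrightarrow> l' \<in> N \<Longrightarrow> \<bar>\<bar>S n 0 l \<omega>\<bar> - \<bar>S n k l' \<omega>\<bar>\<bar> > 3 * \<delta>"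
        by (force simp: K_def not_le not_less)+
      have folded: "folded_max K (cos_vec (pi / K) idx (entries n \<omega>)) k = ?T \<omega> k" if "k < w" for k
        unfolding folded_max_def
      proof (intro arg_cong[where f=Max] image_cong refl)
        fix l assume "l \<in> N"
        then show "arccos (cos_vec (pi / K) idx (entries n \<omega>) (k, l)) / (pi / K) = \<bar>S n k l \<omega>\<bar>"
          using arccos_cos_scaled[OF K big[OF that]] that by (simp add: cos_vec_def)
      qed
      have sub: "?T \<omega> k \<le> ?T \<omega> 0 - \<delta>" if k: "k < w" "?T' \<omega> k < ?T' \<omega> 0" for k
      proof -
        have "0 < k" using k by (cases k) auto
        have "\<bar>?T' \<omega> i - ?T \<omega> i\<bar> \<le> \<delta>" if "i < w" for i
          using near[OF that] by (intro Max_image_close finite_N N_nonempty) (smt (verit))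
        from this[OF k(1)] this[OF w_pos] k(2) have "?T \<omega> k < ?T \<omega> 0 + 2 * \<delta>" by linarith
        moreover obtain l where "l \<in> N" "?T \<omega> 0 = \<bar>S n 0 l \<omega>\<bar>"
          using Max_image_attained[OF finite_N N_nonempty, of "\<lambda>l. \<bar>S n 0 l \<omega>\<bar>"] by blast
        moreover obtain l' where "l' \<in> N" "?T \<omega> k = \<bar>S n k l' \<omega>\<bar>"
          using Max_image_attained[OF finite_N N_nonempty, of "\<lambda>l. \<bar>S n k l \<omega>\<bar>"] by blast
        ultimately show ?thesis
          using notie[OF \<open>0 < k\<close> k(1), of l l'] \<delta>(1) by linarith
      qed
      have "?soft \<omega> = 1"
        unfolding soft_reject_def
      proof (rule soft_top_eq_1[OF \<delta>(1)])
        have "{k \<in> {..<w}. ?T' \<omega> k < ?T' \<omega> 0} \<subseteq> {k \<in> {..<w}. folded_max K (cos_vec (pi / K) idx (entries n \<omega>)) k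
            \<le> folded_max K (cos_vec (pi / K) idx (entries n \<omega>)) 0 - \<delta>}"
          using sub folded w_pos by auto
        then show "c \<le> card {k \<in> {..<w}. folded_max K (cos_vec (pi / K) idx (entries n \<omega>)) k
            \<le> folded_max K (cos_vec (pi / K) idx (entries n \<omega>)) 0 - \<delta>}"
          by (intro order_trans[OF cnt] card_mono) auto
      qed
      moreover have "indicator ?ev \<omega> \<le> (1::real)" by (simp add: indicator_def)
      moreover have "0 \<le> (\<Sum>p\<in>idx. indicator (?far p \<delta> n) \<omega> :: real)" "0 \<le> (\<Sum>p\<in>idx. indicator (?big p \<delta>0 n) \<omega> :: real)"
        "0 \<le> (\<Sum>q\<in>?J. indicator (?tie q \<delta> n) \<omega> :: real)"
        by (auto intro!: sum_nonneg)
      ultimately show ?thesis by linarith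
    qed
    note big_sum = expectation_sum_indicator[of idx "\<lambda>p. ?big p \<delta>0 n", OF _ sets(1)]
    note tie_sum = expectation_sum_indicator[of ?J "\<lambda>q. ?tie q \<delta> n", OF _ sets_tie]
    note far_sum = expectation_sum_indicator[of idx "\<lambda>p. ?far p \<delta> n", OF _ sets(2)]
    have fin: "finite idx" "finite ?J"
      using finite_N by simp_all
    note int = big_sum(1)[OF fin(1)] tie_sum(1)[OF fin(2)] far_sum(1)[OF fin(1)]
      soft_reject_integrable[OF K \<delta>(1) w_pos, of n c]
    have ev: "?ev \<in> sets (M n)"
      using meas' by (intro sets_top_row_event finite_N w_pos) auto
    note ev_sum = expectation_indicator[OF ev]
    have "measure (M n) ?ev = (\<integral>\<omega>. indicator ?ev \<omega> \<partial>M n)"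
      by (rule ev_sum(2)[symmetric])
    also have "\<dots> \<le> (\<integral>\<omega>. ?ub \<omega> \<partial>M n)"
      by (intro integral_mono Bochner_Integration.integrable_add bound int ev_sum(1))
    also have "\<dots> = (\<integral>\<omega>. (\<Sum>p\<in>idx. indicator (?big p \<delta>0 n) \<omega>) \<partial>M n) + (\<integral>\<omega>. (\<Sum>q\<in>?J. indicator (?tie q \<delta> n) \<omega>) \<partial>M n)
        + (\<integral>\<omega>. (\<Sum>p\<in>idx. indicator (?far p \<delta> n) \<omega>) \<partial>M n) + (\<integral>\<omega>. ?soft \<omega> \<partial>M n)"
      by (intro trans[OF Bochner_Integration.integral_add] arg_cong2[where f="(+)"] refl Bochner_Integration.integrable_add int)
    also have "\<dots> = (\<Sum>p\<in>idx. measure (M n) (?big p \<delta>0 n)) + (\<Sum>q\<in>?J. measure (M n) (?tie q \<delta> n))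
        + (\<Sum>p\<in>idx. measure (M n) (?far p \<delta> n)) + (\<integral>\<omega>. ?soft \<omega> \<partial>M n)"
      by (simp only: big_sum(2)[OF fin(1)] tie_sum(2)[OF fin(2)] far_sum(2)[OF fin(1)])
    finally show ?case using elim by linarith
  qed
qed

end

section \<open>Averages over sign patterns\<close>

text \<open>
  The signs that one unit can receive in the \<open>w\<close> flips; the first one is always \<open>1\<close>. Random flips
  give every unit an independent pattern, uniform on this set.
\<close>

definition sign_patterns :: "nat \<Rightarrow> (nat \<Rightarrow> real) set" where
  "sign_patterns w = (\<Pi>\<^sub>E j\<in>{..<w}. if j = 0 then {1} else {-1, 1})"

lemma finite_sign_patterns: "finite (sign_patterns w)"
  unfolding sign_patterns_def by (intro finite_PiE) auto

lemma card_sign_patterns: "card (sign_patterns w) = 2 ^ (w - 1)"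
proof -
  have "card (sign_patterns w) = (\<Prod>j<w. if j = 0 then 1 else 2)"
    unfolding sign_patterns_def by (subst card_PiE) (auto intro!: prod.cong)
  also have "\<dots> = (\<Prod>j\<in>{1..<w}. 2)"
    by (rule prod.mono_neutral_cong_right) auto
  finally show ?thesis by simp
qed

lemma sign_patterns_values:
  assumes "s \<in> sign_patterns w" "j < w"
  shows "s j = 1 \<or> s j = -1"
  using PiE_mem[OF assms(1)[unfolded sign_patterns_def], of j] assms(2) by (auto split: if_splits)

text \<open>
  Of two different flips at least one is random. Reversing its sign permutes the patterns and negates
  the product, so the sum vanishes; this is why different rows of flipped scores are uncorrelated.
\<close>

lemma sum_sign_patterns_orthogonal:
  assumes "j < w" "j' < w"
  shows "(\<Sum>s\<in>sign_patterns w. s j * s j') = (if j = j' then card (sign_patterns w) else 0)"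
proof -
  have zero: "(\<Sum>s\<in>sign_patterns w. s i * s i') = 0" if "i < w" "i \<noteq> 0" "i \<noteq> i'" for i i'
  proof -
    let ?\<sigma> = "\<lambda>s::nat \<Rightarrow> real. s(i := - s i)"
    have "bij_betw ?\<sigma> (sign_patterns w) (sign_patterns w)"
    proof (rule bij_betw_byWitness[where f'="?\<sigma>"])
      have "s(i := - s i) \<in> sign_patterns w" if "s \<in> sign_patterns w" for s
        unfolding sign_patterns_def PiE_iff
      proof (intro conjI ballI)
        fix k assume "k \<in> {..<w}"
        then show "(s(i := - s i)) k \<in> (if k = 0 then {1} else {- 1, 1})"
          using sign_patterns_values[OF that \<open>i < w\<close>] \<open>i \<noteq> 0\<close>
            PiE_mem[OF that[unfolded sign_patterns_def], of k] by (cases "k = i") auto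
      next
        show "s(i := - s i) \<in> extensional {..<w}"
          using that \<open>i < w\<close> unfolding sign_patterns_def PiE_iff by (auto simp: extensional_def)
      qed
      then show "?\<sigma> ` sign_patterns w \<subseteq> sign_patterns w" "?\<sigma> ` sign_patterns w \<subseteq> sign_patterns w"
        by auto
    qed auto
    from sum.reindex_bij_betw[OF this, of "\<lambda>s. s i * s i'"]
    have "(\<Sum>s\<in>sign_patterns w. s i * s i') = (\<Sum>s\<in>sign_patterns w. - (s i * s i'))"
      using that by simp
    then show ?thesis by (simp add: sum_negf)
  qed
  show ?thesis
  proof (cases "j = j'")
    case True
    have "(\<Sum>s\<in>sign_patterns w. s j * s j') = (\<Sum>s\<in>sign_patterns w. 1)"
      using sign_patterns_values[of _ w j] assms True by (intro sum.cong) fastforce+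
    then show ?thesis using True by simp
  next
    case False
    then show ?thesis
      using zero[of j j'] zero[of j' j] assms by (cases "j = 0") (auto simp: mult.commute)
  qed
qed

lemma integrable_mult_of_squares:
  fixes f g :: "'a \<Rightarrow> real"
  assumes [measurable]: "f \<in> borel_measurable M" "g \<in> borel_measurable M"
    and "integrable M (\<lambda>x. (f x)\<^sup>2)" "integrable M (\<lambda>x. (g x)\<^sup>2)"
  shows "integrable M (\<lambda>x. f x * g x)"
proof (rule Bochner_Integration.integrable_bound)
  show "integrable M (\<lambda>x. (f x)\<^sup>2 + (g x)\<^sup>2)"
    using assms by simp
  have "\<bar>a * b\<bar> \<le> a\<^sup>2 + b\<^sup>2" for a b :: real
    using sum_squares_bound[of "\<bar>a\<bar>" "\<bar>b\<bar>"] mult_nonneg_nonneg[of "\<bar>a\<bar>" "\<bar>b\<bar>"]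
    unfolding power2_abs abs_mult by linarith
  then show "AE x in M. norm (f x * g x) \<le> norm ((f x)\<^sup>2 + (g x)\<^sup>2)"
    by simp
qed auto

lemma (in prob_space) linear_combination_moments:
  fixes \<nu> :: "'i \<Rightarrow> 'a \<Rightarrow> real"
  assumes "finite N"
    and [measurable]: "\<And>l. l \<in> N \<Longrightarrow> \<nu> l \<in> borel_measurable M"
    and sq: "\<And>l. l \<in> N \<Longrightarrow> integrable M (\<lambda>\<omega>. (\<nu> l \<omega>)\<^sup>2)"
    and mean: "\<And>l. l \<in> N \<Longrightarrow> expectation (\<nu> l) = 0"
  shows "integrable M (\<lambda>\<omega>. \<Sum>l\<in>N. a l * \<nu> l \<omega>)"
    and "integrable M (\<lambda>\<omega>. (\<Sum>l\<in>N. a l * \<nu> l \<omega>)\<^sup>2)"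
    and "expectation (\<lambda>\<omega>. \<Sum>l\<in>N. a l * \<nu> l \<omega>) = 0"
    and "expectation (\<lambda>\<omega>. (\<Sum>l\<in>N. a l * \<nu> l \<omega>)\<^sup>2)
      = (\<Sum>l\<in>N. \<Sum>l'\<in>N. a l * a l' * expectation (\<lambda>\<omega>. \<nu> l \<omega> * \<nu> l' \<omega>))"
proof -
  have int: "integrable M (\<nu> l)" if "l \<in> N" for l
    using square_integrable_imp_integrable[OF assms(2) sq] that by simp
  have int2: "integrable M (\<lambda>\<omega>. \<nu> l \<omega> * \<nu> l' \<omega>)" if "l \<in> N" "l' \<in> N" for l l'
    using that assms by (intro integrable_mult_of_squares) auto
  have sq_eq: "(\<Sum>l\<in>N. a l * \<nu> l \<omega>)\<^sup>2 = (\<Sum>l\<in>N. \<Sum>l'\<in>N. a l * a l' * (\<nu> l \<omega> * \<nu> l' \<omega>))" for \<omega>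
    by (simp add: power2_eq_square sum_product mult_ac)
  show "integrable M (\<lambda>\<omega>. \<Sum>l\<in>N. a l * \<nu> l \<omega>)"
    using int by auto
  show "integrable M (\<lambda>\<omega>. (\<Sum>l\<in>N. a l * \<nu> l \<omega>)\<^sup>2)"
    unfolding sq_eq using int2 by (intro Bochner_Integration.integrable_sum integrable_mult_right) auto
  show "expectation (\<lambda>\<omega>. \<Sum>l\<in>N. a l * \<nu> l \<omega>) = 0"
    using int mean by (subst Bochner_Integration.integral_sum) auto
  have "expectation (\<lambda>\<omega>. \<Sum>l'\<in>N. a l * a l' * (\<nu> l \<omega> * \<nu> l' \<omega>)) = (\<Sum>l'\<in>N. a l * a l' * expectation (\<lambda>\<omega>. \<nu> l \<omega> * \<nu> l' \<omega>))"
    if "l \<in> N" for l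
    using int2 that by (subst Bochner_Integration.integral_sum) (auto intro: integrable_mult_right)
  then show "expectation (\<lambda>\<omega>. (\<Sum>l\<in>N. a l * \<nu> l \<omega>)\<^sup>2)
      = (\<Sum>l\<in>N. \<Sum>l'\<in>N. a l * a l' * expectation (\<lambda>\<omega>. \<nu> l \<omega> * \<nu> l' \<omega>))"
    unfolding sq_eq using int2
    by (subst Bochner_Integration.integral_sum)
      (auto intro!: Bochner_Integration.integrable_sum integrable_mult_right)
qed

lemma (in prob_space) integrable_trunc_cube:
  assumes [measurable]: "X \<in> borel_measurable M" and "integrable M (\<lambda>\<omega>. (X \<omega>)\<^sup>2)"
  shows "integrable M (\<lambda>\<omega>. trunc_cube (X \<omega>))"
  by (rule Bochner_Integration.integrable_bound[OF assms(2)])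
    (auto simp: trunc_cube_nonneg trunc_cube_le_square)

text \<open>
  The linear term of the expansion disappears because the mean is zero.
\<close>

lemma (in prob_space) char_quadratic_approx:
  assumes "integrable M X" and sq: "integrable M (\<lambda>\<omega>. (X \<omega>)\<^sup>2)" and "expectation X = 0"
  shows "cmod ((\<integral>\<omega>. iexp (X \<omega>) \<partial>M) - (1 - complex_of_real (expectation (\<lambda>\<omega>. (X \<omega>)\<^sup>2)) / 2))
    \<le> expectation (\<lambda>\<omega>. trunc_cube (X \<omega>))"
proof -
  have [measurable]: "X \<in> borel_measurable M" using assms(1) by auto
  have int_exp: "integrable M (\<lambda>\<omega>. iexp (X \<omega>))"
    by (rule integrable_const_bound[where B=1]) auto
  have int_X: "integrable M (\<lambda>\<omega>. complex_of_real (X \<omega>))"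
    using assms(1) by (rule integrable_of_real)
  have int_sq: "integrable M (\<lambda>\<omega>. complex_of_real ((X \<omega>)\<^sup>2))"
    using sq by (rule integrable_of_real)
  have int_quad: "integrable M (\<lambda>\<omega>. 1 + \<i> * complex_of_real (X \<omega>) - complex_of_real ((X \<omega>)\<^sup>2) / 2)"
    using int_X int_sq by auto
  have approx: "cmod (iexp (X \<omega>) - (1 + \<i> * complex_of_real (X \<omega>) - complex_of_real ((X \<omega>)\<^sup>2) / 2)) \<le> trunc_cube (X \<omega>)" for \<omega>
    using iexp_quadratic_approx[of "X \<omega>"] by simp
  have "(\<integral>\<omega>. 1 + \<i> * complex_of_real (X \<omega>) - complex_of_real ((X \<omega>)\<^sup>2) / 2 \<partial>M)
      = 1 + \<i> * complex_of_real (expectation X) - complex_of_real (expectation (\<lambda>\<omega>. (X \<omega>)\<^sup>2)) / 2"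
    using int_X int_sq by (simp add: prob_space del: of_real_power)
  then have "(\<integral>\<omega>. iexp (X \<omega>) \<partial>M) - (1 - complex_of_real (expectation (\<lambda>\<omega>. (X \<omega>)\<^sup>2)) / 2)
      = (\<integral>\<omega>. iexp (X \<omega>) - (1 + \<i> * complex_of_real (X \<omega>) - complex_of_real ((X \<omega>)\<^sup>2) / 2) \<partial>M)"
    using int_exp int_quad assms(3) by (simp del: of_real_power)
  also have "cmod \<dots> \<le> (\<integral>\<omega>. cmod (iexp (X \<omega>) - (1 + \<i> * complex_of_real (X \<omega>) - complex_of_real ((X \<omega>)\<^sup>2) / 2)) \<partial>M)"
    by (rule integral_norm_bound)
  also have "\<dots> \<le> expectation (\<lambda>\<omega>. trunc_cube (X \<omega>))"
    by (intro integral_mono integrable_norm Bochner_Integration.integrable_diff[OF int_exp int_quad]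
      integrable_trunc_cube sq approx) measurable
  finally show ?thesis .
qed

lemma lindeberg_imp_trunc_cube_sum:
  fixes U :: "nat \<Rightarrow> nat \<Rightarrow> 'a \<Rightarrow> real"
  assumes M: "\<And>n. prob_space (M n)"
    and meas: "\<And>n i. i < n \<Longrightarrow> U n i \<in> borel_measurable (M n)"
    and sq: "\<And>n i. i < n \<Longrightarrow> integrable (M n) (\<lambda>\<omega>. (U n i \<omega>)\<^sup>2)"
    and var: "(\<lambda>n. 1 / real n * (\<Sum>i<n. \<integral>\<omega>. (U n i \<omega>)\<^sup>2 \<partial>M n)) \<longlonglongrightarrow> l"
    and lind: "\<And>\<epsilon>. 0 < \<epsilon> \<Longrightarrow> (\<lambda>n. 1 / real n * (\<Sum>i<n. \<integral>\<omega>. (U n i \<omega>)\<^sup>2 *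
      indicator {\<omega>. \<bar>U n i \<omega>\<bar> > \<epsilon> * sqrt (real n)} \<omega> \<partial>M n)) \<longlonglongrightarrow> 0"
  shows "(\<lambda>n. \<Sum>i<n. \<integral>\<omega>. trunc_cube (U n i \<omega> / sqrt (real n)) \<partial>M n) \<longlonglongrightarrow> 0"
proof (rule tendstoI)
  fix e :: real assume "0 < e"
  define C where "C = \<bar>l\<bar> + 1"
  have "0 < C" by (simp add: C_def add_nonneg_pos)
  define \<epsilon> where "\<epsilon> = e / (2 * C)"
  have "0 < \<epsilon>" using \<open>0 < e\<close> \<open>0 < C\<close> by (simp add: \<epsilon>_def)
  have "\<forall>\<^sub>F n in sequentially. 1 / real n * (\<Sum>i<n. \<integral>\<omega>. (U n i \<omega>)\<^sup>2 \<partial>M n) < C"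
    by (rule order_tendstoD(2)[OF var]) (simp add: C_def)
  moreover have "\<forall>\<^sub>F n in sequentially. 1 / real n * (\<Sum>i<n. \<integral>\<omega>. (U n i \<omega>)\<^sup>2 *
      indicator {\<omega>. \<bar>U n i \<omega>\<bar> > \<epsilon> * sqrt (real n)} \<omega> \<partial>M n) < e / 2"
    by (rule order_tendstoD(2)[OF lind[OF \<open>0 < \<epsilon>\<close>]]) (use \<open>0 < e\<close> in simp)
  moreover have "\<forall>\<^sub>F n in sequentially. 0 < n" by (rule eventually_gt_at_top)
  ultimately show "\<forall>\<^sub>F n in sequentially.
      dist (\<Sum>i<n. \<integral>\<omega>. trunc_cube (U n i \<omega> / sqrt (real n)) \<partial>M n) 0 < e"
  proof eventually_elim
    case (elim n)
    interpret prob_space "M n" by (rule M)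
    let ?I = "\<lambda>i \<omega>. indicator {\<omega>. \<bar>U n i \<omega>\<bar> > \<epsilon> * sqrt (real n)} \<omega> :: real"
    have "expectation (\<lambda>\<omega>. trunc_cube (U n i \<omega> / sqrt (real n)))
        \<le> \<epsilon> / n * expectation (\<lambda>\<omega>. (U n i \<omega>)\<^sup>2) + 1 / n * expectation (\<lambda>\<omega>. (U n i \<omega>)\<^sup>2 * ?I i \<omega>)"
      if "i < n" for i
    proof -
      have [measurable]: "U n i \<in> borel_measurable (M n)" using meas that by simp
      have int_ind: "integrable (M n) (\<lambda>\<omega>. (U n i \<omega>)\<^sup>2 * ?I i \<omega>)"
        by (rule Bochner_Integration.integrable_bound[OF sq[OF that]]) (auto simp: indicator_def)
      have "trunc_cube (U n i \<omega> / sqrt (real n)) \<le> \<epsilon> / n * (U n i \<omega>)\<^sup>2 + 1 / n * ((U n i \<omega>)\<^sup>2 * ?I i \<omega>)" for \<omega>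
        using trunc_cube_lindeberg[OF \<open>0 < \<epsilon>\<close>, of "U n i \<omega> / sqrt (real n)"] elim(3)
        by (simp add: power_divide indicator_def field_simps)
      then have "expectation (\<lambda>\<omega>. trunc_cube (U n i \<omega> / sqrt (real n)))
          \<le> expectation (\<lambda>\<omega>. \<epsilon> / n * (U n i \<omega>)\<^sup>2 + 1 / n * ((U n i \<omega>)\<^sup>2 * ?I i \<omega>))"
        using sq[OF that] int_ind
        by (intro integral_mono integrable_trunc_cube Bochner_Integration.integrable_add integrable_mult_right)
          (auto simp: power_divide)
      then show ?thesis
        using sq[OF that] int_ind by simp
    qed
    then have "(\<Sum>i<n. expectation (\<lambda>\<omega>. trunc_cube (U n i \<omega> / sqrt (real n))))
        \<le> (\<Sum>i<n. \<epsilon> / n * expectation (\<lambda>\<omega>. (U n i \<omega>)\<^sup>2) + 1 / n * expectation (\<lambda>\<omega>. (U n i \<omega>)\<^sup>2 * ?I i \<omega>))"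
      by (intro sum_mono) auto
    also have "\<dots> = \<epsilon> * (1 / n * (\<Sum>i<n. expectation (\<lambda>\<omega>. (U n i \<omega>)\<^sup>2)))
        + 1 / n * (\<Sum>i<n. expectation (\<lambda>\<omega>. (U n i \<omega>)\<^sup>2 * ?I i \<omega>))"
      by (simp add: sum.distrib sum_distrib_left)
    also have "\<dots> < \<epsilon> * C + e / 2"
      using elim \<open>0 < \<epsilon>\<close> by (intro add_strict_mono mult_strict_left_mono)
    also have "\<dots> = e" using \<open>0 < C\<close> by (simp add: \<epsilon>_def)
    finally show ?case
      by (simp add: sum_nonneg trunc_cube_nonneg)
  qed
qed

text \<open>
  Each factor is the characteristic function of the contribution of unit \<open>i\<close> to a linear form in the
  flipped scores, averaged over its sign pattern. By orthogonality of the signs that contribution has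
  variance \<open>row_quad w N C t / n\<close>, where \<open>C\<close> is the covariance matrix of \<open>\<nu> n l i\<close> over \<open>l\<close>;
  summed over the units this converges to \<open>row_quad w N L t\<close>.
\<close>

theorem averaged_char_product_limit:
  fixes \<nu> :: "nat \<Rightarrow> 'l \<Rightarrow> nat \<Rightarrow> 'a \<Rightarrow> real" and t :: "nat \<Rightarrow> 'l \<Rightarrow> real"
  assumes M: "\<And>n. prob_space (M n)" and N: "finite N"
    and meas: "\<And>n l i. l \<in> N \<Longrightarrow> i < n \<Longrightarrow> \<nu> n l i \<in> borel_measurable (M n)"
    and sq: "\<And>n l i. l \<in> N \<Longrightarrow> i < n \<Longrightarrow> integrable (M n) (\<lambda>\<omega>. (\<nu> n l i \<omega>)\<^sup>2)"
    and mean: "\<And>n l i. l \<in> N \<Longrightarrow> i < n \<Longrightarrow> (\<integral>\<omega>. \<nu> n l i \<omega> \<partial>M n) = 0"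
    and cov: "\<And>l l'. l \<in> N \<Longrightarrow> l' \<in> N \<Longrightarrow>
      (\<lambda>n. 1 / real n * (\<Sum>i<n. \<integral>\<omega>. \<nu> n l i \<omega> * \<nu> n l' i \<omega> \<partial>M n)) \<longlonglongrightarrow> L l l'"
    and lind: "\<And>l \<epsilon>. l \<in> N \<Longrightarrow> 0 < \<epsilon> \<Longrightarrow> (\<lambda>n. 1 / real n * (\<Sum>i<n. \<integral>\<omega>. (\<nu> n l i \<omega>)\<^sup>2 *
      indicator {\<omega>. \<bar>\<nu> n l i \<omega>\<bar> > \<epsilon> * sqrt (real n)} \<omega> \<partial>M n)) \<longlonglongrightarrow> 0"
  shows "(\<lambda>n. \<Prod>i<n. (\<Sum>s\<in>sign_patterns w. \<integral>\<omega>. iexp (\<Sum>l\<in>N. (\<Sum>j<w. t j l * s j) * (\<nu> n l i \<omega> / sqrt (real n))) \<partial>M n)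
      / card (sign_patterns w)) \<longlonglongrightarrow> complex_of_real (exp (- row_quad w N L t / 2))"
proof -
  define C where "C = real (card (sign_patterns w))"
  have C: "0 < C" by (simp add: C_def card_sign_patterns)
  define a where "a s l = (\<Sum>j<w. t j l * s j)" for s l
  define x where "x n i s \<omega> = (\<Sum>l\<in>N. a s l * (\<nu> n l i \<omega> / sqrt (real n)))" for n i s \<omega>
  define f where "f n i = (\<Sum>s\<in>sign_patterns w. \<integral>\<omega>. iexp (x n i s \<omega>) \<partial>M n) / C" for n i
  define v where "v n i = (\<Sum>s\<in>sign_patterns w. \<integral>\<omega>. (x n i s \<omega>)\<^sup>2 \<partial>M n) / C" for n i
  define \<rho> where "\<rho> n i = (\<Sum>s\<in>sign_patterns w. \<integral>\<omega>. trunc_cube (x n i s \<omega>) \<partial>M n) / C" for n i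
  have avg: "(\<Sum>s\<in>sign_patterns w. c) / C = (c :: real)" for c
    using C by (simp add: C_def)
  have x_int: "integrable (M n) (x n i s)" and x_sq: "integrable (M n) (\<lambda>\<omega>. (x n i s \<omega>)\<^sup>2)"
    and x_mean: "(\<integral>\<omega>. x n i s \<omega> \<partial>M n) = 0"
    and x_var: "(\<integral>\<omega>. (x n i s \<omega>)\<^sup>2 \<partial>M n)
      = (\<Sum>l\<in>N. \<Sum>l'\<in>N. a s l * a s l' * (1 / real n * (\<integral>\<omega>. \<nu> n l i \<omega> * \<nu> n l' i \<omega> \<partial>M n)))"
    if i: "i < n" for n i s
  proof -
    interpret prob_space "M n" by (rule M)
    have 1: "\<And>l. l \<in> N \<Longrightarrow> (\<lambda>\<omega>. \<nu> n l i \<omega> / sqrt (real n)) \<in> borel_measurable (M n)"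
      using meas i by simp
    have 2: "\<And>l. l \<in> N \<Longrightarrow> integrable (M n) (\<lambda>\<omega>. (\<nu> n l i \<omega> / sqrt (real n))\<^sup>2)"
      using sq i by (simp add: power_divide)
    have 3: "\<And>l. l \<in> N \<Longrightarrow> expectation (\<lambda>\<omega>. \<nu> n l i \<omega> / sqrt (real n)) = 0"
      using mean i by simp
    note mom = linear_combination_moments[where \<nu>="\<lambda>l \<omega>. \<nu> n l i \<omega> / sqrt (real n)" and a="a s", OF N 1 2 3]
    show "integrable (M n) (x n i s)"
      unfolding x_def[abs_def] by (rule mom(1))
    show "integrable (M n) (\<lambda>\<omega>. (x n i s \<omega>)\<^sup>2)"
      unfolding x_def by (rule mom(2))
    show "(\<integral>\<omega>. x n i s \<omega> \<partial>M n) = 0"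
      unfolding x_def by (rule mom(3))
    have "\<nu> n l i \<omega> / sqrt (real n) * (\<nu> n l' i \<omega> / sqrt (real n)) = 1 / real n * (\<nu> n l i \<omega> * \<nu> n l' i \<omega>)" for l l' \<omega>
      by simp
    then have e: "expectation (\<lambda>\<omega>. \<nu> n l i \<omega> / sqrt (real n) * (\<nu> n l' i \<omega> / sqrt (real n)))
        = 1 / real n * expectation (\<lambda>\<omega>. \<nu> n l i \<omega> * \<nu> n l' i \<omega>)" for l l'
      by (simp only: integral_mult_right_zero)
    show "(\<integral>\<omega>. (x n i s \<omega>)\<^sup>2 \<partial>M n)
      = (\<Sum>l\<in>N. \<Sum>l'\<in>N. a s l * a s l' * (1 / real n * (\<integral>\<omega>. \<nu> n l i \<omega> * \<nu> n l' i \<omega> \<partial>M n)))"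
      unfolding x_def e[symmetric] by (rule mom(4))
  qed
  have x_trunc: "integrable (M n) (\<lambda>\<omega>. trunc_cube (x n i s \<omega>))" if "i < n" for n i s
    using x_int[OF that] x_sq[OF that] by (intro prob_space.integrable_trunc_cube M) auto
  have "(\<lambda>n. \<Prod>i<n. f n i) \<longlonglongrightarrow> complex_of_real (exp (- row_quad w N L t / 2))"
  proof (rule prod_tendsto_exp[where v=v and \<rho>=\<rho>])
    fix n i :: nat assume i: "i < n"
    interpret prob_space "M n" by (rule M)
    have [measurable]: "x n i s \<in> borel_measurable (M n)" for s
      using x_int[OF i] by auto
    show "cmod (f n i) \<le> 1"
    proof -
      have "cmod (\<Sum>s\<in>sign_patterns w. \<integral>\<omega>. iexp (x n i s \<omega>) \<partial>M n) \<le> (\<Sum>s\<in>sign_patterns w. 1)"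
      proof (rule sum_norm_le)
        fix s
        have "cmod (\<integral>\<omega>. iexp (x n i s \<omega>) \<partial>M n) \<le> (\<integral>\<omega>. cmod (iexp (x n i s \<omega>)) \<partial>M n)"
          by (rule integral_norm_bound)
        then show "cmod (\<integral>\<omega>. iexp (x n i s \<omega>) \<partial>M n) \<le> 1"
          by (simp add: prob_space)
      qed
      then show ?thesis using C by (simp add: f_def norm_divide C_def)
    qed
    show "cmod (f n i - (1 - v n i / 2)) \<le> \<rho> n i"
    proof -
      have "f n i - (1 - complex_of_real (v n i) / 2) = (\<Sum>s\<in>sign_patterns w. (\<integral>\<omega>. iexp (x n i s \<omega>) \<partial>M n)
          - (1 - complex_of_real (\<integral>\<omega>. (x n i s \<omega>)\<^sup>2 \<partial>M n) / 2)) / C"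
        using C by (simp add: f_def v_def C_def sum_subtractf sum_divide_distrib[symmetric] sum.distrib sum_distrib_left[symmetric] field_simps)
      also have "cmod \<dots> = cmod (\<Sum>s\<in>sign_patterns w. (\<integral>\<omega>. iexp (x n i s \<omega>) \<partial>M n)
          - (1 - complex_of_real (\<integral>\<omega>. (x n i s \<omega>)\<^sup>2 \<partial>M n) / 2)) / C"
        using C by (simp add: norm_divide)
      also have "\<dots> \<le> \<rho> n i"
        unfolding \<rho>_def using C
        by (intro divide_right_mono sum_norm_le char_quadratic_approx x_int x_sq x_mean i) auto
      finally show ?thesis by simp
    qed
    show "0 \<le> v n i"
      using C by (auto simp: v_def intro!: divide_nonneg_nonneg sum_nonneg)
    fix \<delta> :: real assume \<delta>: "0 < \<delta>" "\<delta> \<le> 1"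
    have "v n i \<le> (\<Sum>s\<in>sign_patterns w. \<delta>\<^sup>2 + (\<integral>\<omega>. trunc_cube (x n i s \<omega>) \<partial>M n) / \<delta>) / C"
      unfolding v_def
    proof (intro divide_right_mono sum_mono)
      fix s
      have "(\<integral>\<omega>. (x n i s \<omega>)\<^sup>2 \<partial>M n) \<le> (\<integral>\<omega>. \<delta>\<^sup>2 + trunc_cube (x n i s \<omega>) / \<delta> \<partial>M n)"
        using x_sq[OF i] x_trunc[OF i] square_le_trunc_cube[OF \<delta>]
        by (intro integral_mono Bochner_Integration.integrable_add) auto
      also have "\<dots> = \<delta>\<^sup>2 + (\<integral>\<omega>. trunc_cube (x n i s \<omega>) \<partial>M n) / \<delta>"
        using x_trunc[OF i] by (simp add: prob_space)
      finally show "(\<integral>\<omega>. (x n i s \<omega>)\<^sup>2 \<partial>M n) \<le> \<delta>\<^sup>2 + (\<integral>\<omega>. trunc_cube (x n i s \<omega>) \<partial>M n) / \<delta>" .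
    qed (use C in simp)
    also have "\<dots> = \<delta>\<^sup>2 + \<rho> n i / \<delta>"
      using avg[of "\<delta>\<^sup>2"] by (simp add: \<rho>_def sum.distrib add_divide_distrib sum_divide_distrib[symmetric])
    finally show "v n i \<le> \<delta>\<^sup>2 + \<rho> n i / \<delta>" .
  next
    have orth: "(\<Sum>s\<in>sign_patterns w. a s l * a s l') / C = (\<Sum>j<w. t j l * t j l')" for l l'
    proof -
      have "(\<Sum>s\<in>sign_patterns w. a s l * a s l')
          = (\<Sum>s\<in>sign_patterns w. \<Sum>j<w. \<Sum>j'<w. t j l * t j' l' * (s j * s j'))"
        unfolding a_def sum_product by (simp only: mult_ac)
      also have "\<dots> = (\<Sum>j<w. \<Sum>j'<w. t j l * t j' l' * (\<Sum>s\<in>sign_patterns w. s j * s j'))"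
        by (subst sum.swap, intro sum.cong refl, subst sum.swap) (simp add: sum_distrib_left)
      also have "\<dots> = (\<Sum>j<w. \<Sum>j'<w. if j' = j then t j l * t j' l' * C else 0)"
        by (intro sum.cong refl) (auto simp: sum_sign_patterns_orthogonal C_def)
      also have "\<dots> = (\<Sum>j<w. t j l * t j l') * C"
        by (simp add: sum_distrib_right)
      finally show ?thesis using C by simp
    qed
    have v_eq: "v n i = (\<Sum>l\<in>N. \<Sum>l'\<in>N. (\<Sum>j<w. t j l * t j l') * (1 / real n * (\<integral>\<omega>. \<nu> n l i \<omega> * \<nu> n l' i \<omega> \<partial>M n)))"
      if "i < n" for n i
    proof -
      let ?c = "\<lambda>l l'. 1 / real n * (\<integral>\<omega>. \<nu> n l i \<omega> * \<nu> n l' i \<omega> \<partial>M n)"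
      have "v n i = (\<Sum>s\<in>sign_patterns w. \<Sum>l\<in>N. \<Sum>l'\<in>N. a s l * a s l' * ?c l l') / C"
        unfolding v_def using x_var[OF that] by simp
      also have "(\<Sum>s\<in>sign_patterns w. \<Sum>l\<in>N. \<Sum>l'\<in>N. a s l * a s l' * ?c l l')
          = (\<Sum>l\<in>N. \<Sum>l'\<in>N. (\<Sum>s\<in>sign_patterns w. a s l * a s l') * ?c l l')"
        by (subst sum.swap, intro sum.cong refl, subst sum.swap) (simp only: sum_distrib_right)
      also have "\<dots> / C = (\<Sum>l\<in>N. \<Sum>l'\<in>N. (\<Sum>s\<in>sign_patterns w. a s l * a s l') / C * ?c l l')"
        by (simp only: sum_divide_distrib[where A=N] times_divide_eq_left)
      finally show ?thesis unfolding orth .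
    qed
    have "(\<Sum>i<n. v n i) = (\<Sum>l\<in>N. \<Sum>l'\<in>N. (\<Sum>j<w. t j l * t j l') * (1 / real n * (\<Sum>i<n. \<integral>\<omega>. \<nu> n l i \<omega> * \<nu> n l' i \<omega> \<partial>M n)))" for n
    proof -
      have "(\<Sum>i<n. v n i) = (\<Sum>i<n. \<Sum>l\<in>N. \<Sum>l'\<in>N. (\<Sum>j<w. t j l * t j l') * (1 / real n * (\<integral>\<omega>. \<nu> n l i \<omega> * \<nu> n l' i \<omega> \<partial>M n)))"
        by (intro sum.cong refl v_eq) simp
      also have "\<dots> = (\<Sum>l\<in>N. \<Sum>l'\<in>N. \<Sum>i<n. (\<Sum>j<w. t j l * t j l') * (1 / real n * (\<integral>\<omega>. \<nu> n l i \<omega> * \<nu> n l' i \<omega> \<partial>M n)))"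
        by (subst sum.swap, intro sum.cong refl, rule sum.swap)
      finally show ?thesis by (simp only: sum_distrib_left)
    qed
    moreover have "(\<lambda>n. \<Sum>l\<in>N. \<Sum>l'\<in>N. (\<Sum>j<w. t j l * t j l') * (1 / real n * (\<Sum>i<n. \<integral>\<omega>. \<nu> n l i \<omega> * \<nu> n l' i \<omega> \<partial>M n)))
        \<longlonglongrightarrow> (\<Sum>l\<in>N. \<Sum>l'\<in>N. (\<Sum>j<w. t j l * t j l') * L l l')"
      by (intro tendsto_sum tendsto_mult_left cov)
    moreover have "(\<Sum>l\<in>N. \<Sum>l'\<in>N. (\<Sum>j<w. t j l * t j l') * L l l') = row_quad w N L t"
      unfolding row_quad_def
      by (subst (2) sum.swap, intro sum.cong refl, subst sum.swap) (simp add: sum_distrib_right)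
    ultimately show "(\<lambda>n. \<Sum>i<n. v n i) \<longlonglongrightarrow> row_quad w N L t"
      by simp
    define b where "b = 1 + real (card N) + (\<Sum>l\<in>N. \<Sum>j<w. \<bar>t j l\<bar>)"
    have b: "1 \<le> b" "real (card N) \<le> b" "(\<Sum>l\<in>N. \<Sum>j<w. \<bar>t j l\<bar>) \<le> b"
      using sum_nonneg[of N "\<lambda>l. \<Sum>j<w. \<bar>t j l\<bar>"] by (auto simp: b_def sum_nonneg)
    have a_le: "\<bar>a s l\<bar> \<le> b" if "s \<in> sign_patterns w" "l \<in> N" for s l
    proof -
      have "\<bar>a s l\<bar> \<le> (\<Sum>j<w. \<bar>t j l\<bar>)"
        unfolding a_def
        by (rule order_trans[OF sum_abs], intro sum_mono)
          (use sign_patterns_values[OF that(1)] in \<open>fastforce simp: abs_mult\<close>)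
      also have "\<dots> \<le> (\<Sum>l\<in>N. \<Sum>j<w. \<bar>t j l\<bar>)"
        using that N by (intro member_le_sum[of l N "\<lambda>l. \<Sum>j<w. \<bar>t j l\<bar>"]) (auto simp: sum_nonneg)
      finally show ?thesis using b(3) by linarith
    qed
    have \<rho>_le: "\<rho> n i \<le> (b\<^sup>2) ^ 3 * (\<Sum>l\<in>N. \<integral>\<omega>. trunc_cube (\<nu> n l i \<omega> / sqrt (real n)) \<partial>M n)"
      if i: "i < n" for n i
    proof -
      interpret prob_space "M n" by (rule M)
      have int: "integrable (M n) (\<lambda>\<omega>. trunc_cube (\<nu> n l i \<omega> / sqrt (real n)))" if "l \<in> N" for l
        using meas[OF that i] sq[OF that i] by (intro integrable_trunc_cube) (auto simp: power_divide)
      have "(\<integral>\<omega>. trunc_cube (x n i s \<omega>) \<partial>M n) \<le> (b\<^sup>2) ^ 3 * (\<Sum>l\<in>N. \<integral>\<omega>. trunc_cube (\<nu> n l i \<omega> / sqrt (real n)) \<partial>M n)"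
        if s: "s \<in> sign_patterns w" for s
      proof -
        have "\<bar>x n i s \<omega>\<bar> \<le> b * (\<Sum>l\<in>N. \<bar>\<nu> n l i \<omega> / sqrt (real n)\<bar>)" for \<omega>
        proof -
          have "\<bar>x n i s \<omega>\<bar> \<le> (\<Sum>l\<in>N. \<bar>a s l\<bar> * \<bar>\<nu> n l i \<omega> / sqrt (real n)\<bar>)"
            unfolding x_def abs_mult[symmetric] by (rule sum_abs)
          also have "\<dots> \<le> (\<Sum>l\<in>N. b * \<bar>\<nu> n l i \<omega> / sqrt (real n)\<bar>)"
            by (intro sum_mono mult_right_mono a_le s) auto
          finally show ?thesis by (simp only: sum_distrib_left)
        qed
        then have "(\<integral>\<omega>. trunc_cube (x n i s \<omega>) \<partial>M n) \<le> (\<integral>\<omega>. (b\<^sup>2) ^ 3 * (\<Sum>l\<in>N. trunc_cube (\<nu> n l i \<omega> / sqrt (real n))) \<partial>M n)"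
          by (intro integral_mono x_trunc i trunc_cube_sum N b integrable_mult_right
            Bochner_Integration.integrable_sum int)
        also have "\<dots> = (b\<^sup>2) ^ 3 * (\<Sum>l\<in>N. \<integral>\<omega>. trunc_cube (\<nu> n l i \<omega> / sqrt (real n)) \<partial>M n)"
          using int by (simp add: Bochner_Integration.integral_sum)
        finally show ?thesis .
      qed
      then have "\<rho> n i \<le> (\<Sum>s\<in>sign_patterns w. (b\<^sup>2) ^ 3 * (\<Sum>l\<in>N. \<integral>\<omega>. trunc_cube (\<nu> n l i \<omega> / sqrt (real n)) \<partial>M n)) / C"
        unfolding \<rho>_def using C by (intro divide_right_mono sum_mono) auto
      then show ?thesis unfolding avg .
    qed
    have "(\<lambda>n. (b\<^sup>2) ^ 3 * (\<Sum>l\<in>N. \<Sum>i<n. \<integral>\<omega>. trunc_cube (\<nu> n l i \<omega> / sqrt (real n)) \<partial>M n)) \<longlonglongrightarrow> (b\<^sup>2) ^ 3 * (\<Sum>l\<in>N. 0)"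
    proof (intro tendsto_mult_left tendsto_sum)
      fix l assume l: "l \<in> N"
      show "(\<lambda>n. \<Sum>i<n. \<integral>\<omega>. trunc_cube (\<nu> n l i \<omega> / sqrt (real n)) \<partial>M n) \<longlonglongrightarrow> 0"
        using cov[OF l l]
        by (intro lindeberg_imp_trunc_cube_sum[OF M _ _ _ lind[OF l]] meas[OF l] sq[OF l])
          (simp_all add: power2_eq_square)
    qed
    then have lim: "(\<lambda>n. (b\<^sup>2) ^ 3 * (\<Sum>l\<in>N. \<Sum>i<n. \<integral>\<omega>. trunc_cube (\<nu> n l i \<omega> / sqrt (real n)) \<partial>M n)) \<longlonglongrightarrow> 0"
      by simp
    show "(\<lambda>n. \<Sum>i<n. \<rho> n i) \<longlonglongrightarrow> 0"
    proof (rule Lim_null_comparison[OF _ lim])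
      show "\<forall>\<^sub>F n in sequentially. norm (\<Sum>i<n. \<rho> n i) \<le> (b\<^sup>2) ^ 3 * (\<Sum>l\<in>N. \<Sum>i<n. \<integral>\<omega>. trunc_cube (\<nu> n l i \<omega> / sqrt (real n)) \<partial>M n)"
      proof (intro always_eventually allI)
        fix n
        have "(\<Sum>i<n. \<rho> n i) \<le> (\<Sum>i<n. (b\<^sup>2) ^ 3 * (\<Sum>l\<in>N. \<integral>\<omega>. trunc_cube (\<nu> n l i \<omega> / sqrt (real n)) \<partial>M n))"
          by (intro sum_mono \<rho>_le) simp
        also have "\<dots> = (b\<^sup>2) ^ 3 * (\<Sum>l\<in>N. \<Sum>i<n. \<integral>\<omega>. trunc_cube (\<nu> n l i \<omega> / sqrt (real n)) \<partial>M n)"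
          by (subst sum.swap) (simp only: sum_distrib_left)
        finally have "(\<Sum>i<n. \<rho> n i) \<le> (b\<^sup>2) ^ 3 * (\<Sum>l\<in>N. \<Sum>i<n. \<integral>\<omega>. trunc_cube (\<nu> n l i \<omega> / sqrt (real n)) \<partial>M n)" .
        moreover have "0 \<le> (\<Sum>i<n. \<rho> n i)"
          using C by (auto simp: \<rho>_def trunc_cube_nonneg intro!: sum_nonneg divide_nonneg_nonneg)
        ultimately show "norm (\<Sum>i<n. \<rho> n i) \<le> (b\<^sup>2) ^ 3 * (\<Sum>l\<in>N. \<Sum>i<n. \<integral>\<omega>. trunc_cube (\<nu> n l i \<omega> / sqrt (real n)) \<partial>M n)"
          by simp
      qed
    qed
  qed
  then show ?thesis
    by (simp add: f_def x_def a_def C_def)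
qed

section \<open>Factorisation over the units\<close>

lemma finite_card_sign_vecs: "finite (sign_vecs n)" "card (sign_vecs n) = 2 ^ n"
proof -
  have "bij_betw (\<lambda>f. vec n f) ({..<n} \<rightarrow>\<^sub>E {-1, 1::real}) (sign_vecs n)"
  proof (rule bij_betwI')
    fix f g assume fg: "f \<in> {..<n} \<rightarrow>\<^sub>E {-1, 1::real}" "g \<in> {..<n} \<rightarrow>\<^sub>E {-1, 1::real}"
    show "(vec n f = vec n g) = (f = g)"
    proof
      assume eq: "vec n f = vec n g"
      show "f = g"
      proof (rule PiE_ext[OF fg])
        fix i assume "i \<in> {..<n}"
        then show "f i = g i" using arg_cong[OF eq, of "\<lambda>v. v $ i"] by simp
      qed
    qed simp
  next
    fix f assume "f \<in> {..<n} \<rightarrow>\<^sub>E {-1, 1::real}"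
    then show "vec n f \<in> sign_vecs n"
      by (auto simp: sign_vecs_def PiE_iff)
  next
    fix v assume v: "v \<in> sign_vecs n"
    show "\<exists>f\<in>{..<n} \<rightarrow>\<^sub>E {-1, 1::real}. v = vec n f"
    proof
      show "(\<lambda>i\<in>{..<n}. v $ i) \<in> {..<n} \<rightarrow>\<^sub>E {-1, 1::real}"
        using v by (auto simp: sign_vecs_def)
      show "v = vec n (\<lambda>i\<in>{..<n}. v $ i)"
        using v by (auto simp: sign_vecs_def)
    qed
  qed
  moreover have "card ({..<n} \<rightarrow>\<^sub>E {-1, 1::real}) = 2 ^ n"
    by (subst card_PiE) (auto simp: numeral_2_eq_2)
  moreover have "finite ({..<n} \<rightarrow>\<^sub>E {-1, 1::real})"
    by (intro finite_PiE) auto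
  ultimately show "finite (sign_vecs n)" "card (sign_vecs n) = 2 ^ n"
    using bij_betw_same_card bij_betw_finite by metis+
qed

text \<open>
  Composing with \<open>f\<close> and \<open>h\<close> brings the two variables to a common value type, so that the product
  rule for independent variables of one type applies.
\<close>

lemma (in prob_space) indep_rvs_expectation_mult:
  fixes f :: "'b \<Rightarrow> complex" and h :: "'c \<Rightarrow> complex"
  assumes ind: "indep_rvs M S U T V"
    and f: "f \<in> borel_measurable S" and h: "h \<in> borel_measurable T"
    and "integrable M (\<lambda>\<omega>. f (U \<omega>))" "integrable M (\<lambda>\<omega>. h (V \<omega>))"
  shows "expectation (\<lambda>\<omega>. f (U \<omega>) * h (V \<omega>)) = expectation (\<lambda>\<omega>. f (U \<omega>)) * expectation (\<lambda>\<omega>. h (V \<omega>))"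
proof -
  have U: "U \<in> measurable M S" and V: "V \<in> measurable M T"
    and UV: "indep_set {U -` A \<inter> space M | A. A \<in> sets S} {V -` A \<inter> space M | A. A \<in> sets T}"
    using ind by (auto simp: indep_rvs_def)
  have vim: "(\<lambda>\<omega>. q (W \<omega>)) -` A \<inter> space M = W -` (q -` A \<inter> space R) \<inter> space M"
    if "W \<in> measurable M R" for W q A and R :: "'z measure"
    using measurable_space[OF that] by auto
  have stable: "Int_stable {W -` A \<inter> space M | A. A \<in> sets R}" for W and R :: "'z measure"
    by (auto intro!: Int_stableI) (metis (no_types, lifting) Int_assoc Int_left_commute inf.idem sets.Int vimage_Int)
  have "indep_var borel (\<lambda>\<omega>. f (U \<omega>)) borel (\<lambda>\<omega>. h (V \<omega>))"
    unfolding indep_var_eq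
  proof (intro conjI indep_set_sigma_sets stable)
    show "random_variable borel (\<lambda>\<omega>. f (U \<omega>))" "random_variable borel (\<lambda>\<omega>. h (V \<omega>))"
      using measurable_compose[OF U f] measurable_compose[OF V h] by simp_all
    show "indep_set {(\<lambda>\<omega>. f (U \<omega>)) -` A \<inter> space M |A. A \<in> sets borel}
        {(\<lambda>\<omega>. h (V \<omega>)) -` A \<inter> space M |A. A \<in> sets borel}"
      unfolding indep_sets2_eq
    proof (intro conjI ballI)
      show "{(\<lambda>\<omega>. f (U \<omega>)) -` A \<inter> space M |A. A \<in> sets borel} \<subseteq> events"
        using measurable_sets[OF measurable_compose[OF U f]] by auto
      show "{(\<lambda>\<omega>. h (V \<omega>)) -` A \<inter> space M |A. A \<in> sets borel} \<subseteq> events"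
        using measurable_sets[OF measurable_compose[OF V h]] by auto
      fix a b assume "a \<in> {(\<lambda>\<omega>. f (U \<omega>)) -` A \<inter> space M |A. A \<in> sets borel}"
        "b \<in> {(\<lambda>\<omega>. h (V \<omega>)) -` A \<inter> space M |A. A \<in> sets borel}"
      then obtain A B where AB: "a = (\<lambda>\<omega>. f (U \<omega>)) -` A \<inter> space M" "A \<in> sets borel"
        "b = (\<lambda>\<omega>. h (V \<omega>)) -` B \<inter> space M" "B \<in> sets borel"
        by blast
      have "a \<in> {U -` A \<inter> space M | A. A \<in> sets S}" "b \<in> {V -` A \<inter> space M | A. A \<in> sets T}"
        unfolding AB vim[OF U] vim[OF V]
        using measurable_sets[OF f AB(2)] measurable_sets[OF h AB(4)] by blast+
      then show "prob (a \<inter> b) = prob a * prob b"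
        by (rule indep_setD[OF UV])
    qed
  qed
  then show ?thesis
    using assms(4,5) by (rule indep_var_lebesgue_integral)
qed

text \<open>
  The flips amount to an assignment \<open>G\<close> of a sign pattern to every unit, uniformly distributed and
  independent of the data. Given \<open>G\<close> the expectation factorises over the independent units; summing
  the products over all assignments gives the product of the sums.
\<close>

lemma (in prob_space) flip_factorization:
  fixes g Y :: "nat \<Rightarrow> 'a \<Rightarrow> real vec" and n m w :: nat
    and h :: "nat \<Rightarrow> (nat \<Rightarrow> real) \<Rightarrow> (nat \<Rightarrow> real) \<Rightarrow> complex"
  assumes units: "indep_vars (\<lambda>_. PiM {..<m} (\<lambda>_. borel)) (\<lambda>i \<omega>. \<lambda>l\<in>{..<m}. Y l \<omega> $ i) {..<n}"
    and flip_id: "\<And>\<omega>. \<omega> \<in> space M \<Longrightarrow> g 0 \<omega> = vec n (\<lambda>_. 1)"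
    and flips_meas: "\<And>j. 1 \<le> j \<Longrightarrow> j < w \<Longrightarrow> g j \<in> measurable M (count_space (sign_vecs n))"
    and flips_uniform: "\<And>j. 1 \<le> j \<Longrightarrow> j < w \<Longrightarrow>
      distr M (count_space (sign_vecs n)) (g j) = uniform_count_measure (sign_vecs n)"
    and flips_indep: "indep_vars (\<lambda>_. count_space (sign_vecs n)) g {1..<w}"
    and flips_data: "indep_rvs M
      (PiM {..<n} (\<lambda>_. PiM {..<m} (\<lambda>_. borel))) (\<lambda>\<omega>. \<lambda>i\<in>{..<n}. \<lambda>l\<in>{..<m}. Y l \<omega> $ i)
      (PiM {1..<w} (\<lambda>_. count_space (sign_vecs n))) (\<lambda>\<omega>. \<lambda>j\<in>{1..<w}. g j \<omega>)"
    and h_meas: "\<And>i s. i < n \<Longrightarrow> s \<in> sign_patterns w \<Longrightarrow> h i s \<in> borel_measurable (PiM {..<m} (\<lambda>_. borel))"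
    and h_bound: "\<And>i s y. cmod (h i s y) \<le> 1"
  shows "expectation (\<lambda>\<omega>. \<Prod>i<n. h i (\<lambda>j\<in>{..<w}. g j \<omega> $ i) (\<lambda>l\<in>{..<m}. Y l \<omega> $ i))
    = (\<Prod>i<n. (\<Sum>s\<in>sign_patterns w. expectation (\<lambda>\<omega>. h i s (\<lambda>l\<in>{..<m}. Y l \<omega> $ i))) / card (sign_patterns w))"
proof -
  let ?A = "{..<n} \<rightarrow>\<^sub>E sign_patterns w"
  let ?y = "\<lambda>i \<omega>. \<lambda>l\<in>{..<m}. Y l \<omega> $ i"
  let ?pat = "\<lambda>\<omega>. \<lambda>i\<in>{..<n}. \<lambda>j\<in>{..<w}. g j \<omega> $ i"
  let ?flips = "\<lambda>\<omega>. \<lambda>j\<in>{1..<w}. g j \<omega>"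
  \<comment> \<open>the flip vectors that realise the assignment \<open>G\<close> of sign patterns\<close>
  define target where "target G = (\<lambda>j\<in>{1..<w}. vec n (\<lambda>i. G i j))" for G :: "nat \<Rightarrow> nat \<Rightarrow> real"
  have fin_A: "finite ?A" by (intro finite_PiE finite_sign_patterns) simp
  have g_vals: "g j \<omega> \<in> sign_vecs n" if "\<omega> \<in> space M" "1 \<le> j" "j < w" for j \<omega>
    using measurable_space[OF flips_meas[OF that(2,3)] that(1)] by simp
  have pat_in: "?pat \<omega> \<in> ?A" if "\<omega> \<in> space M" for \<omega>
  proof -
    have "g j \<omega> $ i \<in> (if j = 0 then {1} else {-1, 1})" if "i < n" "j < w" for i j
      using flip_id[OF \<open>\<omega> \<in> space M\<close>] g_vals[OF \<open>\<omega> \<in> space M\<close>, of j] that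
      by (auto simp: sign_vecs_def)
    then show ?thesis by (auto simp: sign_patterns_def)
  qed
  have pat_iff: "?pat \<omega> = G \<longleftrightarrow> ?flips \<omega> = target G" if \<omega>: "\<omega> \<in> space M" and G: "G \<in> ?A" for \<omega> G
  proof
    assume eq: "?pat \<omega> = G"
    show "?flips \<omega> = target G"
      unfolding target_def
    proof (rule restrict_ext)
      fix j assume j: "j \<in> {1..<w}"
      have "g j \<omega> \<in> carrier_vec n" using g_vals[OF \<omega>, of j] j by (simp add: sign_vecs_def)
      then show "g j \<omega> = vec n (\<lambda>i. G i j)"
        using j unfolding eq[symmetric] by (intro eq_vecI) auto
    qed
  next
    assume eq: "?flips \<omega> = target G"
    show "?pat \<omega> = G"
    proof (rule PiE_ext[OF pat_in[OF \<omega>] G])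
      fix i assume i: "i \<in> {..<n}"
      have Gi: "G i \<in> sign_patterns w" using G i by auto
      have "(\<lambda>j\<in>{..<w}. g j \<omega> $ i) = G i"
      proof (rule PiE_ext[OF _ Gi[unfolded sign_patterns_def]])
        show "(\<lambda>j\<in>{..<w}. g j \<omega> $ i) \<in> (\<Pi>\<^sub>E j\<in>{..<w}. if j = 0 then {1} else {-1, 1})"
          using PiE_mem[OF pat_in[OF \<omega>] i] i by (simp add: sign_patterns_def)
        fix j assume j: "j \<in> {..<w}"
        show "(\<lambda>j\<in>{..<w}. g j \<omega> $ i) j = G i j"
        proof (cases "j = 0")
          case True
          then show ?thesis
            using PiE_mem[OF Gi[unfolded sign_patterns_def] j] j i flip_id[OF \<omega>] by simp
        next
          case False
          then have "g j \<omega> = vec n (\<lambda>i. G i j)"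
            using fun_cong[OF eq, of j] j by (simp add: target_def)
          then show ?thesis using i j by simp
        qed
      qed
      then show "?pat \<omega> i = G i" using i by simp
    qed
  qed
  have target_vals: "target G \<in> (\<Pi>\<^sub>E j\<in>{1..<w}. sign_vecs n)" if G: "G \<in> ?A" for G
  proof -
    have "G i j \<in> {-1, 1}" if "i < n" "j < w" for i j
      using that G sign_patterns_values[of "G i" w j] by auto
    then show ?thesis by (auto simp: target_def sign_vecs_def simp del: insert_iff)
  qed
  have prob_pat: "prob {\<omega> \<in> space M. ?flips \<omega> = target G} = 1 / card (sign_patterns w) ^ n" if G: "G \<in> ?A" for G
  proof -
    have single: "prob (g j -` {v} \<inter> space M) = 1 / 2 ^ n" if "1 \<le> j" "j < w" "v \<in> sign_vecs n" for j v
    proof -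
      have "prob (g j -` {v} \<inter> space M) = measure (distr M (count_space (sign_vecs n)) (g j)) {v}"
        using that by (intro measure_distr[symmetric] flips_meas) auto
      also have "\<dots> = 1 / 2 ^ n"
        using that finite_card_sign_vecs[of n] by (simp add: flips_uniform measure_uniform_count_measure)
      finally show ?thesis .
    qed
    have "prob {\<omega> \<in> space M. ?flips \<omega> = target G} = (\<Prod>j\<in>{1..<w}. prob (g j -` {target G j} \<inter> space M))"
    proof (cases "{1..<w} = {}")
      case True
      then show ?thesis by (simp add: target_def restrict_def prob_space)
    next
      case False
      have "{\<omega> \<in> space M. ?flips \<omega> = target G} = (\<Inter>j\<in>{1..<w}. g j -` {target G j} \<inter> space M)"
      proof -
        have "?flips \<omega> = target G \<longleftrightarrow> (\<forall>j\<in>{1..<w}. g j \<omega> = target G j)" for \<omega>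
          by (auto simp: target_def fun_eq_iff restrict_def)
        then show ?thesis using False by auto
      qed
      then show ?thesis
        using indep_varsD_finite[OF flips_indep False, of "\<lambda>j. {target G j}"] PiE_mem[OF target_vals[OF G]]
        by simp
    qed
    also have "\<dots> = (\<Prod>j\<in>{1..<w}. 1 / 2 ^ n)"
      using PiE_mem[OF target_vals[OF G]] by (intro prod.cong refl single) auto
    also have "\<dots> = 1 / (2 ^ (w - 1)) ^ n"
      by (simp add: power_one_over power_mult[symmetric] mult.commute)
    finally show ?thesis by (simp add: card_sign_patterns)
  qed
  define H where "H G z = (\<Prod>i<n. h i (G i) (z i))" for G z
  have H_meas: "H G \<in> borel_measurable (PiM {..<n} (\<lambda>_. PiM {..<m} (\<lambda>_. borel)))" if G: "G \<in> ?A" for G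
    unfolding H_def
  proof (intro borel_measurable_prod)
    fix i assume i: "i \<in> {..<n}"
    have "h i (G i) \<in> borel_measurable (PiM {..<m} (\<lambda>_. borel))"
      using i G by (intro h_meas) auto
    then show "(\<lambda>z. h i (G i) (z i)) \<in> borel_measurable (PiM {..<n} (\<lambda>_. PiM {..<m} (\<lambda>_. borel)))"
      using i by (intro measurable_compose[OF measurable_component_singleton])
  qed
  have y_rv: "?y i \<in> measurable M (PiM {..<m} (\<lambda>_. borel))" if "i < n" for i
    using units that by (auto simp: indep_vars_def)
  have hy_int: "integrable M (\<lambda>\<omega>. h i s (?y i \<omega>))" if "i < n" "s \<in> sign_patterns w" for i s
    by (rule integrable_const_bound[where B=1])
      (use measurable_compose[OF y_rv[OF that(1)] h_meas[OF that]] h_bound in auto)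
  have H_int: "integrable M (\<lambda>\<omega>. H G (\<lambda>i\<in>{..<n}. ?y i \<omega>))" if "G \<in> ?A" for G
  proof (rule integrable_const_bound[where B=1])
    have "(\<lambda>\<omega>. \<lambda>i\<in>{..<n}. ?y i \<omega>) \<in> measurable M (PiM {..<n} (\<lambda>_. PiM {..<m} (\<lambda>_. borel)))"
      using flips_data by (simp add: indep_rvs_def)
    from measurable_compose[OF this H_meas[OF that]]
    show "(\<lambda>\<omega>. H G (\<lambda>i\<in>{..<n}. ?y i \<omega>)) \<in> borel_measurable M" .
    show "AE \<omega> in M. cmod (H G (\<lambda>i\<in>{..<n}. ?y i \<omega>)) \<le> 1"
      unfolding H_def prod_norm[symmetric] by (intro AE_I2 prod_le_1) (auto simp: h_bound)
  qed
  have H_exp: "expectation (\<lambda>\<omega>. H G (\<lambda>i\<in>{..<n}. ?y i \<omega>)) = (\<Prod>i<n. expectation (\<lambda>\<omega>. h i (G i) (?y i \<omega>)))"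
    if G: "G \<in> ?A" for G
  proof -
    have "indep_vars (\<lambda>_. borel) (\<lambda>i \<omega>. h i (G i) (?y i \<omega>)) {..<n}"
      using G by (intro indep_vars_compose2[OF units] h_meas) auto
    then have "expectation (\<lambda>\<omega>. \<Prod>i<n. h i (G i) (?y i \<omega>)) = (\<Prod>i<n. expectation (\<lambda>\<omega>. h i (G i) (?y i \<omega>)))"
      using G by (intro indep_vars_lebesgue_integral hy_int) auto
    then show ?thesis by (simp add: H_def)
  qed
  define ind where "ind G f = (indicator {target G} f :: complex)" for G f
  have ind_meas: "ind G \<in> borel_measurable (PiM {1..<w} (\<lambda>_. count_space (sign_vecs n)))" if G: "G \<in> ?A" for G
  proof -
    have "{target G} = (\<Pi>\<^sub>E j\<in>{1..<w}. {target G j})"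
      by (subst PiE_singleton) (auto simp: target_def)
    moreover have "(\<Pi>\<^sub>E j\<in>{1..<w}. {target G j}) \<in> sets (PiM {1..<w} (\<lambda>_. count_space (sign_vecs n)))"
      using PiE_mem[OF target_vals[OF G]] by (intro sets_PiM_I_finite) auto
    ultimately show ?thesis
      unfolding ind_def by (intro borel_measurable_indicator) simp
  qed
  have flips_rv: "?flips \<in> measurable M (PiM {1..<w} (\<lambda>_. count_space (sign_vecs n)))"
    using flips_data by (simp add: indep_rvs_def)
  have ind_int: "integrable M (\<lambda>\<omega>. ind G (?flips \<omega>))" if "G \<in> ?A" for G
    by (rule integrable_const_bound[where B=1])
      (use measurable_compose[OF flips_rv ind_meas[OF that]] in \<open>auto simp: ind_def indicator_def\<close>)
  have ind_exp: "expectation (\<lambda>\<omega>. ind G (?flips \<omega>)) = 1 / card (sign_patterns w) ^ n" if G: "G \<in> ?A" for G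
  proof -
    have "expectation (\<lambda>\<omega>. ind G (?flips \<omega>)) = expectation (\<lambda>\<omega>. complex_of_real (indicator {\<omega> \<in> space M. ?flips \<omega> = target G} \<omega>))"
      by (intro Bochner_Integration.integral_cong) (auto simp: ind_def indicator_def)
    also have "\<dots> = complex_of_real (expectation (\<lambda>\<omega>. indicator {\<omega> \<in> space M. ?flips \<omega> = target G} \<omega>))"
      by (rule integral_complex_of_real)
    also have "\<dots> = complex_of_real (prob {\<omega> \<in> space M. ?flips \<omega> = target G})"
      unfolding Bochner_Integration.integral_indicator
      by (rule arg_cong[where f="\<lambda>A. complex_of_real (prob A)"]) blast
    finally show ?thesis unfolding prob_pat[OF G] by simp
  qed
  have "expectation (\<lambda>\<omega>. \<Prod>i<n. h i (\<lambda>j\<in>{..<w}. g j \<omega> $ i) (?y i \<omega>))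
      = expectation (\<lambda>\<omega>. \<Sum>G\<in>?A. H G (\<lambda>i\<in>{..<n}. ?y i \<omega>) * ind G (?flips \<omega>))"
  proof (intro Bochner_Integration.integral_cong refl)
    fix \<omega> assume \<omega>: "\<omega> \<in> space M"
    have "(\<Sum>G\<in>?A. H G (\<lambda>i\<in>{..<n}. ?y i \<omega>) * ind G (?flips \<omega>))
        = (\<Sum>G\<in>?A. if ?pat \<omega> = G then H G (\<lambda>i\<in>{..<n}. ?y i \<omega>) else 0)"
      using pat_iff[OF \<omega>] by (intro sum.cong refl) (auto simp: ind_def)
    also have "\<dots> = H (?pat \<omega>) (\<lambda>i\<in>{..<n}. ?y i \<omega>)"
      using pat_in[OF \<omega>] fin_A by (simp add: sum.delta)
    finally show "(\<Prod>i<n. h i (\<lambda>j\<in>{..<w}. g j \<omega> $ i) (?y i \<omega>))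
      = (\<Sum>G\<in>?A. H G (\<lambda>i\<in>{..<n}. ?y i \<omega>) * ind G (?flips \<omega>))"
      by (simp add: H_def)
  qed
  also have "\<dots> = (\<Sum>G\<in>?A. expectation (\<lambda>\<omega>. H G (\<lambda>i\<in>{..<n}. ?y i \<omega>) * ind G (?flips \<omega>)))"
  proof (intro Bochner_Integration.integral_sum)
    fix G assume G: "G \<in> ?A"
    show "integrable M (\<lambda>\<omega>. H G (\<lambda>i\<in>{..<n}. ?y i \<omega>) * ind G (?flips \<omega>))"
    proof (rule Bochner_Integration.integrable_bound[OF H_int[OF G]])
      show "(\<lambda>\<omega>. H G (\<lambda>i\<in>{..<n}. ?y i \<omega>) * ind G (?flips \<omega>)) \<in> borel_measurable M"
        using H_int[OF G] ind_int[OF G] by (intro borel_measurable_times) auto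
    qed (auto simp: ind_def indicator_def)
  qed
  also have "\<dots> = (\<Sum>G\<in>?A. (\<Prod>i<n. expectation (\<lambda>\<omega>. h i (G i) (?y i \<omega>))) * (1 / card (sign_patterns w) ^ n))"
  proof (intro sum.cong refl)
    fix G assume G: "G \<in> ?A"
    show "expectation (\<lambda>\<omega>. H G (\<lambda>i\<in>{..<n}. ?y i \<omega>) * ind G (?flips \<omega>))
        = (\<Prod>i<n. expectation (\<lambda>\<omega>. h i (G i) (?y i \<omega>))) * (1 / card (sign_patterns w) ^ n)"
      using indep_rvs_expectation_mult[where f="H G" and h="ind G", OF flips_data H_meas[OF G] ind_meas[OF G] H_int[OF G] ind_int[OF G]]
      unfolding H_exp[OF G] ind_exp[OF G] .
  qed
  also have "\<dots> = (\<Prod>i<n. \<Sum>s\<in>sign_patterns w. expectation (\<lambda>\<omega>. h i s (?y i \<omega>))) * (1 / card (sign_patterns w) ^ n)"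
    by (subst prod_sum_PiE) (simp_all add: finite_sign_patterns sum_divide_distrib)
  also have "\<dots> = (\<Prod>i<n. (\<Sum>s\<in>sign_patterns w. expectation (\<lambda>\<omega>. h i s (?y i \<omega>))) / card (sign_patterns w))"
    by (simp add: prod_dividef)
  finally show ?thesis .
qed

section \<open>From rejections to row counts\<close>

lemma order_statistic_less_imp_card:
  fixes T :: "nat \<Rightarrow> 'b::linorder"
  assumes "1 \<le> c" "c \<le> w" "sort (map T [0..<w]) ! (c - 1) < x"
  shows "c \<le> card {k \<in> {..<w}. T k < x}"
proof -
  let ?xs = "sort (map T [0..<w])"
  have "{..<c} \<subseteq> {i. i < length ?xs \<and> ?xs ! i < x}"
  proof
    fix i assume "i \<in> {..<c}"
    then have "?xs ! i \<le> ?xs ! (c - 1)"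
      using assms by (intro sorted_nth_mono) auto
    then show "i \<in> {i. i < length ?xs \<and> ?xs ! i < x}"
      using \<open>i \<in> {..<c}\<close> assms by auto
  qed
  then have "card {..<c} \<le> card {i. i < length ?xs \<and> ?xs ! i < x}"
    by (rule card_mono[rotated]) simp
  also have "\<dots> = length (filter (\<lambda>y. y < x) ?xs)"
    by (rule length_filter_conv_card[symmetric])
  also have "\<dots> = length (filter (\<lambda>y. y < x) (map T [0..<w]))"
    by (simp only: filter_sort length_sort)
  also have "\<dots> = card {i. i < length (map T [0..<w]) \<and> map T [0..<w] ! i < x}"
    by (rule length_filter_conv_card)
  also have "{i. i < length (map T [0..<w]) \<and> map T [0..<w] ! i < x} = {k \<in> {..<w}. T k < x}"
    by auto
  finally show ?thesis by simp
qed

text \<open>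
  The common consequence of a false rejection by either procedure, \<open>N\<close> being the set of true null
  hypotheses.
\<close>

definition many_smaller_rows :: "real \<Rightarrow> real mat \<Rightarrow> nat set \<Rightarrow> bool" where
  "many_smaller_rows \<alpha> A N \<longleftrightarrow> nat \<lceil>(1 - \<alpha>) * real (dim_row A)\<rceil>
     \<le> card {k \<in> {..<dim_row A}. max_stat A N k < max_stat A N 0}"

text \<open>
  Passing from the tested columns \<open>C\<close> to the true nulls \<open>N\<close> only lowers the row maxima, while the first
  row keeps its rejected entry, which lies in \<open>N\<close>.
\<close>

lemma max_T_step_imp_many_smaller_rows:
  assumes \<alpha>: "0 < \<alpha>" "\<alpha> < 1" and w: "0 < dim_row A"
    and C: "finite C" "N \<subseteq> C" and l: "l \<in> N" "l \<in> max_T_step \<alpha> A C"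
  shows "many_smaller_rows \<alpha> A N"
proof -
  let ?w = "dim_row A"
  let ?c = "nat \<lceil>(1 - \<alpha>) * real ?w\<rceil>"
  have c: "1 \<le> ?c" "?c \<le> ?w"
  proof -
    have "0 < (1 - \<alpha>) * real ?w" using \<alpha> w by simp
    then show "1 \<le> ?c" by linarith
    have "(1 - \<alpha>) * real ?w \<le> real ?w" using \<alpha> by (simp add: mult_left_le_one_le)
    then show "?c \<le> ?w" by linarith
  qed
  have "finite N" using C finite_subset by blast
  have "sort (map (max_stat A C) [0..<?w]) ! (?c - 1) < \<bar>A $$ (0, l)\<bar>"
    using l(2) by (simp add: max_T_step_def crit_value_def)
  from order_statistic_less_imp_card[OF c this]
  have "?c \<le> card {k \<in> {..<?w}. max_stat A C k < \<bar>A $$ (0, l)\<bar>}" .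
  also have "\<dots> \<le> card {k \<in> {..<?w}. max_stat A N k < max_stat A N 0}"
  proof (rule card_mono)
    have "max_stat A N k \<le> max_stat A C k" for k
      unfolding max_stat_def using C l(1) by (intro Max_mono image_mono) auto
    moreover have "\<bar>A $$ (0, l)\<bar> \<le> max_stat A N 0"
      unfolding max_stat_def using \<open>finite N\<close> l(1) by (intro Max_ge) auto
    ultimately show "{k \<in> {..<?w}. max_stat A C k < \<bar>A $$ (0, l)\<bar>}
        \<subseteq> {k \<in> {..<?w}. max_stat A N k < max_stat A N 0}"
      by (auto intro: order.strict_trans1 order.strict_trans2)
  qed simp
  finally show ?thesis by (simp add: many_smaller_rows_def)
qed

lemma remaining_subset: "remaining \<alpha> A t \<subseteq> {..<dim_col A}"
  by (induction t) auto

text \<open>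
  The first step of the sequential procedure that rejects a true null hypothesis is applied to a set
  of columns that still contains all true nulls, so it is covered by the same argument as
  the single-step method.
\<close>

lemma rejection_imp_many_smaller_rows:
  assumes \<alpha>: "0 < \<alpha>" "\<alpha> < 1" and w: "0 < dim_row A" and N: "N \<subseteq> {..<dim_col A}"
  shows "single_step_max_T \<alpha> A \<inter> N \<noteq> {} \<Longrightarrow> many_smaller_rows \<alpha> A N"
    and "sequential_max_T \<alpha> A \<inter> N \<noteq> {} \<Longrightarrow> many_smaller_rows \<alpha> A N"
proof -
  assume "single_step_max_T \<alpha> A \<inter> N \<noteq> {}"
  then obtain l where "l \<in> N" "l \<in> max_T_step \<alpha> A {..<dim_col A}"
    by (auto simp: single_step_max_T_def)
  then show "many_smaller_rows \<alpha> A N"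
    using max_T_step_imp_many_smaller_rows[OF \<alpha> w _ N] by blast
next
  assume "sequential_max_T \<alpha> A \<inter> N \<noteq> {}"
  then have ex: "\<exists>t. max_T_step \<alpha> A (remaining \<alpha> A t) \<inter> N \<noteq> {}"
    by (auto simp: sequential_max_T_def)
  define t where "t = (LEAST t. max_T_step \<alpha> A (remaining \<alpha> A t) \<inter> N \<noteq> {})"
  have t: "max_T_step \<alpha> A (remaining \<alpha> A t) \<inter> N \<noteq> {}"
    unfolding t_def using ex by (rule LeastI_ex)
  have "N \<subseteq> remaining \<alpha> A s" if "s \<le> t" for s
    using that
  proof (induction s)
    case 0
    then show ?case using N by simp
  next
    case (Suc s)
    then have "max_T_step \<alpha> A (remaining \<alpha> A s) \<inter> N = {}"
      using not_less_Least[of s "\<lambda>t. max_T_step \<alpha> A (remaining \<alpha> A t) \<inter> N \<noteq> {}"]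
      by (auto simp: t_def)
    then show ?case using Suc by auto
  qed
  then have "N \<subseteq> remaining \<alpha> A t" by simp
  moreover have "finite (remaining \<alpha> A t)"
    by (rule finite_subset[OF remaining_subset finite_lessThan])
  ultimately show "many_smaller_rows \<alpha> A N"
    using t max_T_step_imp_many_smaller_rows[OF \<alpha> w] by blast
qed

lemma dim_score_row:
  "dim_row (score_row F \<phi> X Z \<beta> \<gamma>) = dim_col X" "dim_col (score_row F \<phi> X Z \<beta> \<gamma>) = dim_row X"
  by (simp_all only: score_row_def Let_def index_mult_mat index_transpose_mat mat_diag_def dim_col_mat)

lemma dim_mean_vec: "dim_vec (mean_vec F X Z \<beta> \<gamma>) = dim_row Z"
  by (simp add: mean_vec_def lin_pred_def)

lemma score_contrib_eq:
  assumes "Z \<in> carrier_mat n d" "i < n"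
  shows "score_contrib F \<phi> X Z \<beta> \<gamma> y i
    = score_row F \<phi> X Z \<beta> \<gamma> $$ (0, i) * (y $ i - mean_vec F X Z \<beta> \<gamma> $ i)"
  using assms by (simp add: score_contrib_def dim_mean_vec)

lemma flipped_score_eq_sum:
  assumes X: "X \<in> carrier_mat n 1" and Z: "Z \<in> carrier_mat n d"
  shows "flipped_score F \<phi> X Z \<beta> \<gamma> g y
    = 1 / sqrt (real n) * (\<Sum>i<n. g $ i * score_contrib F \<phi> X Z \<beta> \<gamma> y i)"
proof -
  let ?R = "score_row F \<phi> X Z \<beta> \<gamma>"
  have R: "?R \<in> carrier_mat 1 n"
    using X dim_score_row[of F \<phi> X Z \<beta> \<gamma>] by (intro carrier_matI) auto
  have dim: "dim_vec (y - mean_vec F X Z \<beta> \<gamma>) = n"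
    using Z by (simp add: dim_mean_vec)
  have "(?R * mat_diag n (\<lambda>i. g $ i) *\<^sub>v (y - mean_vec F X Z \<beta> \<gamma>)) $ 0
      = (\<Sum>i<n. ?R $$ (0, i) * g $ i * (y - mean_vec F X Z \<beta> \<gamma>) $ i)"
    unfolding mat_diag_mult_right[OF R]
    using dim by (simp add: scalar_prod_def lessThan_atLeast0)
  then show ?thesis
    using X by (simp add: flipped_score_def score_contrib_def mult_ac)
qed

section \<open>Asymptotic exchangeability of the flipped scores\<close>

text \<open>
  The linear form in the flipped scores is regrouped by units, so that its exponential is a
  product over the units of functions of the sign pattern and the responses of that unit.
\<close>

lemma flipped_scores_exchangeable:
  fixes Y g :: "nat \<Rightarrow> nat \<Rightarrow> 'a \<Rightarrow> real vec" and r \<mu> :: "nat \<Rightarrow> nat \<Rightarrow> nat \<Rightarrow> real"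
    and S :: "nat \<Rightarrow> nat \<Rightarrow> nat \<Rightarrow> 'a \<Rightarrow> real"
  defines "\<nu> \<equiv> \<lambda>n l i \<omega>. r n l i * (Y n l \<omega> $ i - \<mu> n l i)"
  assumes prob: "\<And>n. prob_space (M n)" and N: "N \<subseteq> {..<m}" "N \<noteq> {}" and w: "1 \<le> w"
    and Y_meas: "\<And>n l i. l \<in> N \<Longrightarrow> i < n \<Longrightarrow> (\<lambda>\<omega>. Y n l \<omega> $ i) \<in> borel_measurable (M n)"
    and Y_sq: "\<And>n l i. l \<in> N \<Longrightarrow> i < n \<Longrightarrow> integrable (M n) (\<lambda>\<omega>. (Y n l \<omega> $ i)\<^sup>2)"
    and Y_mean: "\<And>n l i. l \<in> N \<Longrightarrow> i < n \<Longrightarrow> (\<integral>\<omega>. Y n l \<omega> $ i \<partial>M n) = \<mu> n l i"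
    and units: "\<And>n. prob_space.indep_vars (M n) (\<lambda>_. PiM {..<m} (\<lambda>_. borel))
      (\<lambda>i \<omega>. \<lambda>l\<in>{..<m}. Y n l \<omega> $ i) {..<n}"
    and flip_id: "\<And>n \<omega>. \<omega> \<in> space (M n) \<Longrightarrow> g n 0 \<omega> = vec n (\<lambda>_. 1)"
    and flips_meas: "\<And>n j. 1 \<le> j \<Longrightarrow> j < w \<Longrightarrow> g n j \<in> measurable (M n) (count_space (sign_vecs n))"
    and flips_uniform: "\<And>n j. 1 \<le> j \<Longrightarrow> j < w \<Longrightarrow>
      distr (M n) (count_space (sign_vecs n)) (g n j) = uniform_count_measure (sign_vecs n)"
    and flips_indep: "\<And>n. prob_space.indep_vars (M n) (\<lambda>_. count_space (sign_vecs n)) (g n) {1..<w}"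
    and flips_data: "\<And>n. indep_rvs (M n)
      (PiM {..<n} (\<lambda>_. PiM {..<m} (\<lambda>_. borel))) (\<lambda>\<omega>. \<lambda>i\<in>{..<n}. \<lambda>l\<in>{..<m}. Y n l \<omega> $ i)
      (PiM {1..<w} (\<lambda>_. count_space (sign_vecs n))) (\<lambda>\<omega>. \<lambda>j\<in>{1..<w}. g n j \<omega>)"
    and cov: "\<And>l l'. l \<in> N \<Longrightarrow> l' \<in> N \<Longrightarrow>
      (\<lambda>n. 1 / real n * (\<Sum>i<n. cov (M n) (\<nu> n l i) (\<nu> n l' i))) \<longlonglongrightarrow> L l l'"
    and L_pos: "\<And>l. l \<in> N \<Longrightarrow> 0 < L l l"
    and lind: "\<And>l. l \<in> N \<Longrightarrow> lindeberg M (\<lambda>n i. \<nu> n l i)"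
    and S_meas: "\<And>n j l. j < w \<Longrightarrow> l \<in> N \<Longrightarrow> S n j l \<in> borel_measurable (M n)"
    and S_eq: "\<And>n j l \<omega>. \<omega> \<in> space (M n) \<Longrightarrow> j < w \<Longrightarrow> l \<in> N \<Longrightarrow>
      S n j l \<omega> = 1 / sqrt (real n) * (\<Sum>i<n. g n j \<omega> $ i * \<nu> n l i \<omega>)"
  shows "asymptotically_exchangeable_rows M w N S L"
proof (rule asymptotically_exchangeable_rows.intro)
  have fin: "finite N" using N finite_subset by blast
  show "finite N" "N \<noteq> {}" "0 < w" using fin N w by auto
  show "prob_space (M n)" for n by (rule prob)
  show "S n j l \<in> borel_measurable (M n)" if "j < w" "l \<in> N" for n j l
    using S_meas that .
  show "0 < L l l" if "l \<in> N" for l using L_pos that .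
  have \<nu>_meas: "\<nu> n l i \<in> borel_measurable (M n)" if "l \<in> N" "i < n" for n l i
    using Y_meas[OF that] unfolding \<nu>_def by simp
  have Y_int: "integrable (M n) (\<lambda>\<omega>. Y n l \<omega> $ i)" if "l \<in> N" "i < n" for n l i
  proof -
    interpret prob_space "M n" by (rule prob)
    show ?thesis using Y_meas[OF that] Y_sq[OF that] by (rule square_integrable_imp_integrable)
  qed
  have \<nu>_sq: "integrable (M n) (\<lambda>\<omega>. (\<nu> n l i \<omega>)\<^sup>2)" if "l \<in> N" "i < n" for n l i
  proof -
    interpret prob_space "M n" by (rule prob)
    have "(\<lambda>\<omega>. (\<nu> n l i \<omega>)\<^sup>2) = (\<lambda>\<omega>. (r n l i)\<^sup>2 * ((Y n l \<omega> $ i)\<^sup>2 - 2 * \<mu> n l i * (Y n l \<omega> $ i) + (\<mu> n l i)\<^sup>2))"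
      by (simp add: \<nu>_def power2_eq_square algebra_simps)
    then show ?thesis using Y_sq[OF that] Y_int[OF that] by simp
  qed
  have \<nu>_mean: "(\<integral>\<omega>. \<nu> n l i \<omega> \<partial>M n) = 0" if "l \<in> N" "i < n" for n l i
  proof -
    interpret prob_space "M n" by (rule prob)
    show ?thesis using Y_int[OF that] Y_mean[OF that] by (simp add: \<nu>_def prob_space)
  qed
  fix t :: "nat \<Rightarrow> nat \<Rightarrow> real"
  define h where "h n i s y = iexp (\<Sum>l\<in>N. (\<Sum>j<w. t j l * s j) * (r n l i * (y l - \<mu> n l i) / sqrt (real n)))"
    for n i s and y :: "nat \<Rightarrow> real"
  have char_eq: "(\<integral>\<omega>. iexp (\<Sum>j<w. \<Sum>l\<in>N. t j l * S n j l \<omega>) \<partial>M n)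
    = (\<Prod>i<n. (\<Sum>s\<in>sign_patterns w. \<integral>\<omega>. iexp (\<Sum>l\<in>N. (\<Sum>j<w. t j l * s j) * (\<nu> n l i \<omega> / sqrt (real n))) \<partial>M n)
      / card (sign_patterns w))" for n
  proof -
    interpret prob_space "M n" by (rule prob)
    have "expectation (\<lambda>\<omega>. iexp (\<Sum>j<w. \<Sum>l\<in>N. t j l * S n j l \<omega>))
        = expectation (\<lambda>\<omega>. \<Prod>i<n. h n i (\<lambda>j\<in>{..<w}. g n j \<omega> $ i) (\<lambda>l\<in>{..<m}. Y n l \<omega> $ i))"
    proof (intro Bochner_Integration.integral_cong refl)
      fix \<omega> assume \<omega>: "\<omega> \<in> space (M n)"
      have "(\<Sum>j<w. \<Sum>l\<in>N. t j l * S n j l \<omega>)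
          = (\<Sum>j<w. \<Sum>l\<in>N. \<Sum>i<n. t j l * g n j \<omega> $ i * (\<nu> n l i \<omega> / sqrt (real n)))"
        using S_eq[OF \<omega>] by (simp add: sum_distrib_left sum_divide_distrib mult_ac)
      also have "\<dots> = (\<Sum>l\<in>N. \<Sum>j<w. \<Sum>i<n. t j l * g n j \<omega> $ i * (\<nu> n l i \<omega> / sqrt (real n)))"
        by (rule sum.swap)
      also have "\<dots> = (\<Sum>l\<in>N. \<Sum>i<n. \<Sum>j<w. t j l * g n j \<omega> $ i * (\<nu> n l i \<omega> / sqrt (real n)))"
        by (rule sum.cong[OF refl], rule sum.swap)
      also have "\<dots> = (\<Sum>i<n. \<Sum>l\<in>N. \<Sum>j<w. t j l * g n j \<omega> $ i * (\<nu> n l i \<omega> / sqrt (real n)))"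
        by (rule sum.swap)
      also have "\<dots> = (\<Sum>i<n. \<Sum>l\<in>N. (\<Sum>j<w. t j l * g n j \<omega> $ i) * (\<nu> n l i \<omega> / sqrt (real n)))"
        by (simp only: sum_distrib_right)
      finally have "iexp (\<Sum>j<w. \<Sum>l\<in>N. t j l * S n j l \<omega>)
          = (\<Prod>i<n. iexp (\<Sum>l\<in>N. (\<Sum>j<w. t j l * g n j \<omega> $ i) * (\<nu> n l i \<omega> / sqrt (real n))))"
        by (simp only: of_real_sum sum_distrib_left exp_sum finite_lessThan)
      also have "\<dots> = (\<Prod>i<n. h n i (\<lambda>j\<in>{..<w}. g n j \<omega> $ i) (\<lambda>l\<in>{..<m}. Y n l \<omega> $ i))"
      proof (intro prod.cong refl)
        fix i
        have "(\<Sum>l\<in>N. (\<Sum>j<w. t j l * g n j \<omega> $ i) * (\<nu> n l i \<omega> / sqrt (real n)))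
          = (\<Sum>l\<in>N. (\<Sum>j<w. t j l * (\<lambda>j\<in>{..<w}. g n j \<omega> $ i) j)
              * (r n l i * ((\<lambda>l\<in>{..<m}. Y n l \<omega> $ i) l - \<mu> n l i) / sqrt (real n)))"
          using N(1) by (intro sum.cong refl arg_cong2[where f="(*)"]) (auto simp: \<nu>_def)
        then show "iexp (\<Sum>l\<in>N. (\<Sum>j<w. t j l * g n j \<omega> $ i) * (\<nu> n l i \<omega> / sqrt (real n)))
          = h n i (\<lambda>j\<in>{..<w}. g n j \<omega> $ i) (\<lambda>l\<in>{..<m}. Y n l \<omega> $ i)"
          unfolding h_def by (simp only:)
      qed
      finally show "iexp (\<Sum>j<w. \<Sum>l\<in>N. t j l * S n j l \<omega>)
        = (\<Prod>i<n. h n i (\<lambda>j\<in>{..<w}. g n j \<omega> $ i) (\<lambda>l\<in>{..<m}. Y n l \<omega> $ i))" .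
    qed
    also have "\<dots> = (\<Prod>i<n. (\<Sum>s\<in>sign_patterns w. expectation (\<lambda>\<omega>. h n i s (\<lambda>l\<in>{..<m}. Y n l \<omega> $ i)))
        / card (sign_patterns w))"
    proof (rule flip_factorization[OF units flip_id flips_meas flips_uniform flips_indep flips_data])
      show "h n i s \<in> borel_measurable (PiM {..<m} (\<lambda>_. borel))" for i s
      proof -
        have [measurable]: "(\<lambda>y. y l) \<in> borel_measurable (PiM {..<m} (\<lambda>_. borel :: real measure))" if "l \<in> N" for l
          using that N(1) by (intro measurable_component_singleton) auto
        show ?thesis unfolding h_def by measurable
      qed
      show "cmod (h n i s y) \<le> 1" for i s y by (simp only: h_def norm_exp_i_times order_refl)
    qed
    also have "\<dots> = (\<Prod>i<n. (\<Sum>s\<in>sign_patterns w. \<integral>\<omega>. iexp (\<Sum>l\<in>N. (\<Sum>j<w. t j l * s j) * (\<nu> n l i \<omega> / sqrt (real n))) \<partial>M n)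
      / card (sign_patterns w))"
    proof -
      have "h n i s (\<lambda>l\<in>{..<m}. Y n l \<omega> $ i) = iexp (\<Sum>l\<in>N. (\<Sum>j<w. t j l * s j) * (\<nu> n l i \<omega> / sqrt (real n)))" for i s \<omega>
        unfolding h_def
        by (intro arg_cong[where f="\<lambda>x. iexp x"] sum.cong refl) (use N(1) in \<open>auto simp: \<nu>_def\<close>)
      then show ?thesis by (simp only:)
    qed
    finally show ?thesis .
  qed
  show "(\<lambda>n. \<integral>\<omega>. iexp (\<Sum>j<w. \<Sum>l\<in>N. t j l * S n j l \<omega>) \<partial>M n)
      \<longlonglongrightarrow> complex_of_real (exp (- row_quad w N L t / 2))"
    unfolding char_eq
  proof (rule averaged_char_product_limit[OF prob fin \<nu>_meas \<nu>_sq \<nu>_mean])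
    fix l l' assume l: "l \<in> N" "l' \<in> N"
    have "cov (M n) (\<nu> n l i) (\<nu> n l' i) = (\<integral>\<omega>. \<nu> n l i \<omega> * \<nu> n l' i \<omega> \<partial>M n)" if "i < n" for n i
      using \<nu>_mean[OF l(1) that] \<nu>_mean[OF l(2) that] by (simp add: cov_def)
    then show "(\<lambda>n. 1 / real n * (\<Sum>i<n. \<integral>\<omega>. \<nu> n l i \<omega> * \<nu> n l' i \<omega> \<partial>M n)) \<longlonglongrightarrow> L l l'"
      using cov[OF l] by simp
  next
    fix l and \<epsilon> :: real assume "l \<in> N" "0 < \<epsilon>"
    then show "(\<lambda>n. 1 / real n * (\<Sum>i<n. \<integral>\<omega>. (\<nu> n l i \<omega>)\<^sup>2 *
        indicator {\<omega>. \<bar>\<nu> n l i \<omega>\<bar> > \<epsilon> * sqrt (real n)} \<omega> \<partial>M n)) \<longlonglongrightarrow> 0"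
      using lind by (simp add: lindeberg_def)
  qed
qed

lemma edf_response_moments:
  assumes "prob_space M" "edf_at F \<phi>" "\<theta> \<in> edf_params F \<phi>"
    and dist: "distributed M (ref_measure F \<phi>) Y (\<lambda>y. ennreal (edf_density F \<theta> \<phi> y))"
  shows "Y \<in> borel_measurable M" "integrable M (\<lambda>\<omega>. (Y \<omega>)\<^sup>2)"
proof -
  have sets: "sets (ref_measure F \<phi>) = sets borel"
    using assms(2) by (simp add: edf_at_def)
  have Y: "Y \<in> measurable M (ref_measure F \<phi>)"
    using dist by (rule distributed_measurable)
  then show "Y \<in> borel_measurable M"
    by (simp add: measurable_cong_sets[OF refl sets])
  have "integrable (distr M (ref_measure F \<phi>) Y) (\<lambda>y. y\<^sup>2)"
    using assms(3) distributed_distr_eq_density[OF dist] by (simp add: edf_params_def edf_def)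
  then show "integrable M (\<lambda>\<omega>. (Y \<omega>)\<^sup>2)"
    by (rule integrable_distr[OF Y])
qed

lemma limsup_le_of_eventually_le_add:
  fixes X :: "nat \<Rightarrow> real"
  assumes "\<And>e. 0 < e \<Longrightarrow> \<forall>\<^sub>F n in sequentially. X n \<le> a + e"
  shows "limsup (\<lambda>n. ereal (X n)) \<le> ereal a"
proof (rule ereal_le_epsilon2)
  fix e :: real assume "0 < e"
  show "limsup (\<lambda>n. ereal (X n)) \<le> ereal a + ereal e"
    using assms[OF \<open>0 < e\<close>] by (intro Limsup_bounded) (auto elim!: eventually_mono)
qed

theorem theorem5:
  fixes m w k :: nat
    and \<alpha> :: real
    and F :: "nat \<Rightarrow> glm"
    and M :: "nat \<Rightarrow> 'a measure"
    and X Z :: "nat \<Rightarrow> real mat"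
    and \<theta> \<phi> :: "nat \<Rightarrow> nat \<Rightarrow> nat \<Rightarrow> real"
    and \<beta> \<beta>0 :: "nat \<Rightarrow> real"
    and \<gamma>0 :: "nat \<Rightarrow> real vec"
    and Y :: "nat \<Rightarrow> nat \<Rightarrow> 'a \<Rightarrow> real vec"
    and \<gamma>hat :: "nat \<Rightarrow> nat \<Rightarrow> 'a \<Rightarrow> real vec"
    and g :: "nat \<Rightarrow> nat \<Rightarrow> 'a \<Rightarrow> real vec"
  defines "\<N> \<equiv> {l. l < m \<and> \<beta> l = \<beta>0 l}"
    and "\<nu> \<equiv> \<lambda>n l i \<omega>. score_contrib (F l) (\<phi> n l) (X n) (Z n) (\<beta>0 l) (\<gamma>0 l) (Y n l \<omega>) i"
    and "S0 \<equiv> \<lambda>n j l \<omega>.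
           flipped_score (F l) (\<phi> n l) (X n) (Z n) (\<beta>0 l) (\<gamma>0 l) (g n j \<omega>) (Y n l \<omega>)"
    and "Shat \<equiv> \<lambda>n j l \<omega>.
           flipped_score (F l) (\<phi> n l) (X n) (Z n) (\<beta>0 l) (\<gamma>hat n l \<omega>) (g n j \<omega>) (Y n l \<omega>)"
  assumes "m \<ge> 2" and "w \<ge> 1" and "k \<ge> 1" and "0 < \<alpha>" and "\<alpha> < 1"
    and X_dim: "\<And>n. X n \<in> carrier_mat n 1"
    and Z_dim: "\<And>n. Z n \<in> carrier_mat n (k - 1)"
    and gamma0_dim: "\<And>l. l < m \<Longrightarrow> \<gamma>0 l \<in> carrier_vec (k - 1)"
    and prob: "\<And>n. prob_space (M n)"
    and link: "\<And>l. l < m \<Longrightarrow> link_function (F l)"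
    and family: "\<And>n l i. l < m \<Longrightarrow> i < n \<Longrightarrow> edf_at (F l) (\<phi> n l i)"
    and params: "\<And>n l i. l < m \<Longrightarrow> i < n \<Longrightarrow> \<theta> n l i \<in> edf_params (F l) (\<phi> n l i)"
    and Y_dim: "\<And>n l \<omega>. l < m \<Longrightarrow> \<omega> \<in> space (M n) \<Longrightarrow> Y n l \<omega> \<in> carrier_vec n"
    and Y_density: "\<And>n l i. l < m \<Longrightarrow> i < n \<Longrightarrow>
           distributed (M n) (ref_measure (F l) (\<phi> n l i)) (\<lambda>\<omega>. Y n l \<omega> $ i)
             (\<lambda>y. ennreal (edf_density (F l) (\<theta> n l i) (\<phi> n l i) y))"
    and link_range: "\<And>n l i. l < m \<Longrightarrow> i < n \<Longrightarrow>
           lin_pred (X n) (Z n) (\<beta> l) (\<gamma>0 l) $ i \<in> link (F l) ` mean_space (F l)"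
    and mean_model: "\<And>n l i. l < m \<Longrightarrow> i < n \<Longrightarrow>
           (\<integral>\<omega>. Y n l \<omega> $ i \<partial>M n) = mean_vec (F l) (X n) (Z n) (\<beta> l) (\<gamma>0 l) $ i"
    and units_indep: "\<And>n. prob_space.indep_vars (M n) (\<lambda>_. PiM {..<m} (\<lambda>_. borel))
           (\<lambda>i \<omega>. \<lambda>l\<in>{..<m}. Y n l \<omega> $ i) {..<n}"
    and ghat_dim: "\<And>n l \<omega>. l < m \<Longrightarrow> \<omega> \<in> space (M n) \<Longrightarrow> \<gamma>hat n l \<omega> \<in> carrier_vec (k - 1)"
    and ghat_consistent: "\<And>l r. l < m \<Longrightarrow> r < k - 1 \<Longrightarrow> op1 M (\<lambda>n \<omega>. \<gamma>hat n l \<omega> $ r - \<gamma>0 l $ r)"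
    and scores_measurable: "\<And>n j l. j < w \<Longrightarrow> l < m \<Longrightarrow> Shat n j l \<in> borel_measurable (M n)"
    and flip_id: "\<And>n \<omega>. \<omega> \<in> space (M n) \<Longrightarrow> g n 0 \<omega> = vec n (\<lambda>_. 1)"
    and flips_measurable: "\<And>n j. 1 \<le> j \<Longrightarrow> j < w \<Longrightarrow>
           g n j \<in> measurable (M n) (count_space (sign_vecs n))"
    and flips_uniform: "\<And>n j. 1 \<le> j \<Longrightarrow> j < w \<Longrightarrow>
           distr (M n) (count_space (sign_vecs n)) (g n j) = uniform_count_measure (sign_vecs n)"
    and flips_indep: "\<And>n. prob_space.indep_vars (M n) (\<lambda>_. count_space (sign_vecs n)) (g n) {1..<w}"
    and flips_data_indep: "\<And>n. indep_rvs (M n)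
           (PiM {..<n} (\<lambda>_. PiM {..<m} (\<lambda>_. borel))) (\<lambda>\<omega>. \<lambda>i\<in>{..<n}. \<lambda>l\<in>{..<m}. Y n l \<omega> $ i)
           (PiM {1..<w} (\<lambda>_. count_space (sign_vecs n))) (\<lambda>\<omega>. \<lambda>j\<in>{1..<w}. g n j \<omega>)"
    and cov_limit: "\<And>l l'. l \<in> \<N> \<Longrightarrow> l' \<in> \<N> \<Longrightarrow>
           \<exists>L. (\<lambda>n. 1 / real n * (\<Sum>i<n. cov (M n) (\<nu> n l i) (\<nu> n l' i))) \<longlonglongrightarrow> L \<and>
               (l = l' \<longrightarrow> L > 0)"
    and lindeberg: "\<And>l. l \<in> \<N> \<Longrightarrow> lindeberg M (\<lambda>n i. \<nu> n l i)"
    and plug_in: "\<And>j l. j < w \<Longrightarrow> l \<in> \<N> \<Longrightarrow> op1 M (\<lambda>n \<omega>. Shat n j l \<omega> - S0 n j l \<omega>)"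
  shows "limsup (\<lambda>n. ereal (fwer (M n)
             (\<lambda>\<omega>. single_step_max_T \<alpha> (mat w m (\<lambda>(j, l). Shat n j l \<omega>))) \<N>)) \<le> ereal \<alpha>
       \<and> limsup (\<lambda>n. ereal (fwer (M n)
             (\<lambda>\<omega>. sequential_max_T \<alpha> (mat w m (\<lambda>(j, l). Shat n j l \<omega>))) \<N>)) \<le> ereal \<alpha>"
proof -
  note N_def = \<open>\<N> \<equiv> {l. l < m \<and> \<beta> l = \<beta>0 l}\<close>
  have N_sub: "\<N> \<subseteq> {..<m}" and N_fin: "finite \<N>"
    by (auto simp: N_def)
  define c where "c = nat \<lceil>(1 - \<alpha>) * real w\<rceil>"
  let ?A = "\<lambda>n \<omega>. mat w m (\<lambda>(j, l). Shat n j l \<omega>)"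
  let ?T = "\<lambda>n \<omega> k. Max ((\<lambda>l. \<bar>Shat n k l \<omega>\<bar>) ` \<N>)"
  let ?ev = "\<lambda>n. {\<omega> \<in> space (M n). c \<le> card {k \<in> {..<w}. ?T n \<omega> k < ?T n \<omega> 0}}"
  have few: "real (w - c) / real w \<le> \<alpha>"
  proof -
    have "(1 - \<alpha>) * real w \<le> real c" unfolding c_def by (rule real_nat_ceiling_ge)
    then have "real w - real c \<le> \<alpha> * real w" by (simp add: algebra_simps)
    moreover have "0 \<le> \<alpha> * real w" using \<open>0 < \<alpha>\<close> by simp
    ultimately have "real (w - c) \<le> \<alpha> * real w" by (cases "c \<le> w") (auto simp: of_nat_diff)
    then show ?thesis using \<open>1 \<le> w\<close> by (simp add: field_simps)
  qed
  have level: "\<forall>\<^sub>F n in sequentially. measure (M n) (?ev n) \<le> \<alpha> + e" if "0 < e" "\<N> \<noteq> {}" for e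
  proof -
    define r where "r n l i = score_row (F l) (\<phi> n l) (X n) (Z n) (\<beta>0 l) (\<gamma>0 l) $$ (0, i)" for n l i
    define \<mu> where "\<mu> n l i = mean_vec (F l) (X n) (Z n) (\<beta>0 l) (\<gamma>0 l) $ i" for n l i
    have \<nu>_eq: "\<nu> n l i \<omega> = r n l i * (Y n l \<omega> $ i - \<mu> n l i)" if "i < n" for n l i \<omega>
      unfolding \<open>\<nu> \<equiv> _\<close> r_def \<mu>_def using score_contrib_eq[OF Z_dim that] .
    have S0_eq: "S0 n j l \<omega> = 1 / sqrt (real n) * (\<Sum>i<n. g n j \<omega> $ i * (r n l i * (Y n l \<omega> $ i - \<mu> n l i)))" for n j l \<omega>
      unfolding \<open>S0 \<equiv> _\<close> flipped_score_eq_sum[OF X_dim Z_dim] r_def \<mu>_def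
      by (simp add: score_contrib_eq[OF Z_dim])
    have S0_meas: "S0 n j l \<in> borel_measurable (M n)" if "j < w" "l \<in> \<N>" for n j l
    proof -
      have "l < m" using N_sub that(2) by auto
      have "(\<lambda>\<omega>. Shat n j l \<omega> - S0 n j l \<omega>) \<in> borel_measurable (M n)"
        using plug_in[OF that] by (simp add: op1_def)
      then have "(\<lambda>\<omega>. Shat n j l \<omega> - (Shat n j l \<omega> - S0 n j l \<omega>)) \<in> borel_measurable (M n)"
        using scores_measurable[OF that(1) \<open>l < m\<close>] by (rule borel_measurable_diff[rotated])
      then show ?thesis by simp
    qed
    define L where "L l l' = (SOME x. (\<lambda>n. 1 / real n * (\<Sum>i<n. cov (M n) (\<nu> n l i) (\<nu> n l' i))) \<longlonglongrightarrow> x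
      \<and> (l = l' \<longrightarrow> x > 0))" for l l'
    have L: "(\<lambda>n. 1 / real n * (\<Sum>i<n. cov (M n) (\<nu> n l i) (\<nu> n l' i))) \<longlonglongrightarrow> L l l'"
      "l = l' \<Longrightarrow> 0 < L l l'" if "l \<in> \<N>" "l' \<in> \<N>" for l l'
      using someI_ex[OF cov_limit[OF that]] unfolding L_def[symmetric] by auto
    have "asymptotically_exchangeable_rows M w \<N> S0 L"
    proof (rule flipped_scores_exchangeable[where Y=Y and g=g and r=r and \<mu>=\<mu>, OF prob N_sub \<open>\<N> \<noteq> {}\<close> \<open>1 \<le> w\<close>
        _ _ _ units_indep flip_id flips_measurable flips_uniform flips_indep flips_data_indep])
      fix n l i :: nat assume l: "l \<in> \<N>" and i: "i < n"
      have "l < m" using N_sub l by auto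
      note mom = edf_response_moments[OF prob family[OF \<open>l < m\<close> i] params[OF \<open>l < m\<close> i] Y_density[OF \<open>l < m\<close> i]]
      show "(\<lambda>\<omega>. Y n l \<omega> $ i) \<in> borel_measurable (M n)" "integrable (M n) (\<lambda>\<omega>. (Y n l \<omega> $ i)\<^sup>2)"
        using mom .
      show "(\<integral>\<omega>. Y n l \<omega> $ i \<partial>M n) = \<mu> n l i"
        using mean_model[OF \<open>l < m\<close> i] l by (simp add: \<mu>_def N_def)
    next
      fix l l' assume l: "l \<in> \<N>" "l' \<in> \<N>"
      have "\<nu> n p i = (\<lambda>\<omega>. r n p i * (Y n p \<omega> $ i - \<mu> n p i))" if "i < n" for n p i
        using \<nu>_eq[OF that] by auto
      then show "(\<lambda>n. 1 / real n * (\<Sum>i<n. cov (M n) (\<lambda>\<omega>. r n l i * (Y n l \<omega> $ i - \<mu> n l i))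
          (\<lambda>\<omega>. r n l' i * (Y n l' \<omega> $ i - \<mu> n l' i)))) \<longlonglongrightarrow> L l l'"
        using L(1)[OF l] by simp
    next
      fix l assume l: "l \<in> \<N>"
      show "0 < L l l" using L(2)[OF l l] by simp
      show "lindeberg M (\<lambda>n i \<omega>. r n l i * (Y n l \<omega> $ i - \<mu> n l i))"
        using lindeberg[OF l] \<nu>_eq by (simp add: lindeberg_def)
    qed (use S0_meas S0_eq in auto)
    then interpret asymptotically_exchangeable_rows M w \<N> S0 L .
    have "\<forall>\<^sub>F n in sequentially. measure (M n) (?ev n) \<le> real (w - c) / real w + e"
    proof (rule top_row_probability[OF _ _ \<open>0 < e\<close>])
      show "Shat n j l \<in> borel_measurable (M n)" if "j < w" "l \<in> \<N>" for n j l
        using scores_measurable that N_sub by auto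
      show "(\<lambda>n. measure (M n) {\<omega> \<in> space (M n). \<bar>Shat n j l \<omega> - S0 n j l \<omega>\<bar> > \<epsilon>}) \<longlonglongrightarrow> 0"
        if "j < w" "l \<in> \<N>" "0 < \<epsilon>" for j l \<epsilon>
        using plug_in[OF that(1,2)] that(3) by (simp add: op1_def)
    qed
    then show ?thesis
      by eventually_elim (use few in linarith)
  qed
  have ev_sets: "?ev n \<in> sets (M n)" if "\<N> \<noteq> {}" for n
    using \<open>1 \<le> w\<close> N_sub by (intro sets_top_row_event N_fin scores_measurable) auto
  have fwer_le: "fwer (M n) rej \<N> \<le> measure (M n) (?ev n)"
    if "\<N> \<noteq> {}" and rej: "\<And>\<omega>. rej \<omega> \<inter> \<N> \<noteq> {} \<Longrightarrow> many_smaller_rows \<alpha> (?A n \<omega>) \<N>" for n rej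
  proof -
    interpret prob_space "M n" by (rule prob)
    have "max_stat (?A n \<omega>) \<N> k = ?T n \<omega> k" if "k < w" for \<omega> k
      unfolding max_stat_def using that N_sub by (intro arg_cong[where f=Max] image_cong) auto
    then have many_iff: "many_smaller_rows \<alpha> (?A n \<omega>) \<N> \<longleftrightarrow> c \<le> card {k \<in> {..<w}. ?T n \<omega> k < ?T n \<omega> 0}" for \<omega>
      using \<open>1 \<le> w\<close> by (auto simp: many_smaller_rows_def c_def cong: conj_cong)
    show ?thesis
      unfolding fwer_def
    proof (intro finite_measure_mono ev_sets \<open>\<N> \<noteq> {}\<close> subsetI)
      fix \<omega> assume "\<omega> \<in> {\<omega> \<in> space (M n). rej \<omega> \<inter> \<N> \<noteq> {}}"
      then have "\<omega> \<in> space (M n)" "many_smaller_rows \<alpha> (?A n \<omega>) \<N>"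
        using rej by blast+
      then show "\<omega> \<in> ?ev n"
        unfolding many_iff by blast
    qed
  qed
  have bound: "limsup (\<lambda>n. ereal (fwer (M n) (rej n) \<N>)) \<le> ereal \<alpha>"
    if rej: "\<And>n \<omega>. rej n \<omega> \<inter> \<N> \<noteq> {} \<Longrightarrow> many_smaller_rows \<alpha> (?A n \<omega>) \<N>" for rej
  proof (rule limsup_le_of_eventually_le_add)
    fix e :: real assume "0 < e"
    show "\<forall>\<^sub>F n in sequentially. fwer (M n) (rej n) \<N> \<le> \<alpha> + e"
    proof (cases "\<N> = {}")
      case True
      then show ?thesis using \<open>0 < e\<close> \<open>0 < \<alpha>\<close> by (simp add: fwer_def)
    next
      case False
      from level[OF \<open>0 < e\<close> False] show ?thesis
        by eventually_elim (rule order_trans[OF fwer_le[OF False rej]])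
    qed
  qed
  have dims: "0 < dim_row (?A n \<omega>)" "\<N> \<subseteq> {..<dim_col (?A n \<omega>)}" for n \<omega>
    using \<open>1 \<le> w\<close> N_sub by auto
  show ?thesis
  proof (intro conjI bound)
    fix n \<omega>
    note reject = rejection_imp_many_smaller_rows[OF \<open>0 < \<alpha>\<close> \<open>\<alpha> < 1\<close> dims[of n \<omega>]]
    show "many_smaller_rows \<alpha> (?A n \<omega>) \<N>" if "single_step_max_T \<alpha> (?A n \<omega>) \<inter> \<N> \<noteq> {}"
      using that by (rule reject(1))
    show "many_smaller_rows \<alpha> (?A n \<omega>) \<N>" if "sequential_max_T \<alpha> (?A n \<omega>) \<inter> \<N> \<noteq> {}"
      using that by (rule reject(2))
  qed
qed


end
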